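(* Let $\lambda=(\lambda_1,\dots,\lambda_m)$ be a partition of $N=\sum_{i=1}^m\lambda_i$, with $\lambda_1\ge\dots\ge\lambda_m\ge1$. Assume that $\lambda\ne(1,1)$ and that either (i) $m>2$, or (ii) $m=2$ and $\lambda_1=\lambda_2$, or (iii) $m=2$, $\lambda_1>\lambda_2$, and the following conjectural statement holds: $C_{(\mu_1,\mu_2)}(-1,1)\ne0$ for all integers $\mu_1>\mu_2\ge1$. Then the orbit Dirichlet series $\mathsf{d}_{T_\lambda}(s)$ has a natural boundary at $\{s\in\mathbb{C}\mid\operatorname{Re}(s)=N-2\}$.
   Context: Orbits. For a map $T:X\to X$, a closed orbit of length $n\in\mathbb{N}=\{1,2,\dots\}$ is a set $\{x,T(x),T^2(x),\dots,T^n(x)=x\}$ of cardinality $n$. Let $\mathsf{O}_T(n)$ be the number of closed orbits of length $n$, assumed finite for all $n$. The orbit Dirichlet series of $T$ is $\mathsf{d}_T(s)=\sum_{n=1}^\infty \mathsf{O}_T(n)n^{-s}$. The maps $T_r$ and $T_\lambda$. For $r\in\mathbb{N}$, $T_r$ denotes a map such that $\mathsf{O}_{T_r}(n)=a_n(\mathbb{Z}^r)$ for all $n\in\mathbb{N}$, where $a_n(\mathbb{Z}^r)$ is the number of subgroups of index $n$ in $\mathbb{Z}^r$; equivalently $\mathsf{d}_{T_r}(s)=\prod_{i=0}^{r-1}\zeta(s-i)$. For a partition $\lambda=(\lambda_1,\dots,\lambda_m)$, $T_\lambda=T_{\lambda_1}\times\dots\times T_{\lambda_m}$ is the Cartesian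 product map (acting coordinatewise). For every partition $\lambda=(\lambda_1,\dots,\lambda_m)$ of $N=\sum_{i=1}^m\lambda_i$ with $m\ge2$ and $\lambda\ne(1,1)$, $\mathsf{d}_{T_\lambda}(s)$ converges for $\operatorname{Re}(s)>N$ and has a meromorphic continuation to $\{s\in\mathbb{C}\mid\operatorname{Re}(s)>N-2\}$. Natural boundary. That $\{\operatorname{Re}(s)=N-2\}$ is a natural boundary means that the meromorphic continuation of $\mathsf{d}_{T_\lambda}(s)$ to $\{\operatorname{Re}(s)>N-2\}$ cannot be continued meromorphically to a neighbourhood of any point of the line $\{\operatorname{Re}(s)=N-2\}$. The polynomials $C_\lambda$. $S_\lambda$ is the set of all words $w=w_1\dots w_N$ formed from all $N$ elements of the multiset containing $\lambda_i$ indistinguishable copies of the letter $i$, $i=1,\dots,m$, with letters ordered $1<2<\dots<m$. For $w\in S_\lambda$, $\operatorname{Des}(w)=\{i\in\{1,\dots,N-1\}\mid w_i>w_{i+1}\}$, $\operatorname{des}(w)=|\operatorname{Des}(w)|$, $\operatorname{maj}(w)=\sum_{i\in\operatorname{Des}(w)}i$, and $C_\lambda(x,q)=\sum_{w\in S_\lambda}x^{\operatorname{des}(w)}q^{\operatorname{maj}(w)}\in\mathbb{Z}[x,q]$. *)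

theory Defs
  imports
    "HOL-Complex_Analysis.Complex_Analysis"
    "HOL-Algebra.Product_Groups"
    "HOL-Combinatorics.Multiset_Permutations"
begin

text \<open>Closed orbits. A dynamical system is a map \<open>T\<close> restricted to a carrier set \<open>X\<close>.\<close>

definition closed_orbits :: "'a set \<Rightarrow> ('a \<Rightarrow> 'a) \<Rightarrow> nat \<Rightarrow> 'a set set" where
  "closed_orbits X T n =
     {A. \<exists>x\<in>X. A = {(T ^^ k) x |k. k \<le> n} \<and> (T ^^ n) x = x \<and> card A = n}"

definition orbit_count :: "'a set \<Rightarrow> ('a \<Rightarrow> 'a) \<Rightarrow> nat \<Rightarrow> nat" where
  "orbit_count X T n = card (closed_orbits X T n)"

text \<open>The term with index \<open>n\<close> is the one for orbit length \<open>Suc n\<close>.\<close>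

definition orbit_dirichlet_term :: "'a set \<Rightarrow> ('a \<Rightarrow> 'a) \<Rightarrow> complex \<Rightarrow> nat \<Rightarrow> complex" where
  "orbit_dirichlet_term X T s n =
     of_nat (orbit_count X T (Suc n)) * of_nat (Suc n) powr (- s)"

definition orbit_dirichlet :: "'a set \<Rightarrow> ('a \<Rightarrow> 'a) \<Rightarrow> complex \<Rightarrow> complex" where
  "orbit_dirichlet X T s = (\<Sum>n. orbit_dirichlet_term X T s n)"

definition int_lattice :: "nat \<Rightarrow> (nat \<Rightarrow> int) monoid" where
  "int_lattice r = product_group {..<r} (\<lambda>_. integer_group)"

text \<open>Meaningful for \<open>n \<ge> 1\<close> only: \<open>card\<close> of an infinite coset space is \<open>0\<close>.\<close>

definition index_subgroup_count :: "nat \<Rightarrow> nat \<Rightarrow> nat" where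
  "index_subgroup_count r n =
     card {H. subgroup H (int_lattice r) \<and> card (rcosets\<^bsub>int_lattice r\<^esub> H) = n}"

definition realizes_lattice_count :: "nat \<Rightarrow> 'a set \<Rightarrow> ('a \<Rightarrow> 'a) \<Rightarrow> bool" where
  "realizes_lattice_count r X T \<longleftrightarrow>
     T \<in> X \<rightarrow> X \<and>
     (\<forall>n\<ge>1. finite (closed_orbits X T n) \<and> orbit_count X T n = index_subgroup_count r n)"

text \<open>
  The product system \<open>T\<^sub>\<lambda>\<close> for a list \<open>l = [\<lambda>\<^sub>1, \<dots>, \<lambda>\<^sub>m]\<close>, where \<open>(X r, T r)\<close> is the system
  \<open>T\<^sub>r\<close>. List positions start from \<open>0\<close>.
\<close>

definition product_space :: "(nat \<Rightarrow> 'a set) \<Rightarrow> nat list \<Rightarrow> (nat \<Rightarrow> 'a) set" where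
  "product_space X l = (\<Pi>\<^sub>E i\<in>{..<length l}. X (l ! i))"

definition product_map :: "(nat \<Rightarrow> 'a \<Rightarrow> 'a) \<Rightarrow> nat list \<Rightarrow> (nat \<Rightarrow> 'a) \<Rightarrow> (nat \<Rightarrow> 'a)" where
  "product_map T l f = (\<lambda>i\<in>{..<length l}. T (l ! i) (f i))"

text \<open>
  The series converges on \<open>Re s > \<sigma>\<close>, and \<open>F\<close> continues its sum meromorphically to \<open>Re s > b\<close>.
\<close>

definition orbit_dirichlet_continuation ::
    "'a set \<Rightarrow> ('a \<Rightarrow> 'a) \<Rightarrow> real \<Rightarrow> real \<Rightarrow> (complex \<Rightarrow> complex) \<Rightarrow> bool" where
  "orbit_dirichlet_continuation X T \<sigma> b F \<longleftrightarrow>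
     F meromorphic_on {s. Re s > b} \<and>
     (\<forall>s. Re s > \<sigma> \<longrightarrow> summable (orbit_dirichlet_term X T s) \<and> F s = orbit_dirichlet X T s)"

text \<open>
  The predicate \<open>meromorphic_on\<close> allows arbitrary values on a discrete set, so two meromorphic
  functions are identified if they agree outside a set with no limit point in the domain. With
  equality everywhere, changing \<open>F\<close> at points that accumulate on the line would rule out every
  extension \<open>G\<close>.
\<close>

definition extends_meromorphically_to :: "(complex \<Rightarrow> complex) \<Rightarrow> real \<Rightarrow> complex \<Rightarrow> bool" where
  "extends_meromorphically_to F b z \<longleftrightarrow>
     (\<exists>U G. open U \<and> z \<in> U \<and> G meromorphic_on U \<and>
            (\<forall>\<^sub>\<approx>s\<in>U \<inter> {s. Re s > b}. G s = F s))"

definition orbit_dirichlet_natural_boundary ::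
    "'a set \<Rightarrow> ('a \<Rightarrow> 'a) \<Rightarrow> real \<Rightarrow> real \<Rightarrow> bool" where
  "orbit_dirichlet_natural_boundary X T \<sigma> b \<longleftrightarrow>
     (\<exists>F. orbit_dirichlet_continuation X T \<sigma> b F) \<and>
     (\<forall>F. orbit_dirichlet_continuation X T \<sigma> b F \<longrightarrow>
          (\<forall>z. Re z = b \<longrightarrow> \<not> extends_meromorphically_to F b z))"

definition multiset_words :: "nat list \<Rightarrow> nat list set" where
  "multiset_words l =
     permutations_of_multiset (\<Sum>i<length l. replicate_mset (l ! i) (Suc i))"

text \<open>Descent positions are counted from \<open>1\<close>, as in \<open>w\<^sub>1 \<dots> w\<^sub>N\<close>.\<close>

definition Des :: "nat list \<Rightarrow> nat set" where
  "Des w = {i \<in> {1..<length w}. w ! (i - 1) > w ! i}"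

definition des :: "nat list \<Rightarrow> nat" where
  "des w = card (Des w)"

definition maj :: "nat list \<Rightarrow> nat" where
  "maj w = \<Sum>(Des w)"

text \<open>\<open>\<int>[x, q]\<close> is rendered as \<open>\<int>[q][x]\<close>: the outer variable is \<open>x\<close>, the inner one is \<open>q\<close>.\<close>

definition C_poly :: "nat list \<Rightarrow> int poly poly" where
  "C_poly l = (\<Sum>w\<in>multiset_words l. monom (monom 1 (maj w)) (des w))"

definition eval_xq :: "int poly poly \<Rightarrow> int \<Rightarrow> int \<Rightarrow> int" where
  "eval_xq P x q = poly (poly P [:x:]) q"

end

theory Submission
  imports Defs "HOL-Real_Asymp.Real_Asymp"
begin

text \<open>
  Let \<open>m\<close> be the number of parts of the partition, \<open>N\<close> its size and \<open>z = s - N + 2\<close>, so that the line in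
  question is \<open>Re z = 0\<close>.

  \<^emph>\<open>The series as an Euler product.\<close> Counting subgroups of \<open>\<int> ^ (r + 1)\<close> by their intersection with \<open>\<int> ^ r\<close> gives
  \<open>a_n(\<int> ^ (r + 1)) = (\<Sum>d | d dvd n. d * a_d(\<int> ^ r))\<close>. The number of points fixed by the \<open>n\<close>-th iterate of a map is
  obtained from the numbers of closed orbits by the same divisor sum, so \<open>T_r\<close> has \<open>a_n(\<int> ^ (r + 1))\<close> such points.
  Fixed points of a product are tuples of fixed points. The resulting count is multiplicative, and its values
  at powers of \<open>p\<close> are products of Gaussian binomial coefficients. Their generating function has MacMahon's
  polynomial as numerator. For the orbit series this gives
  \<open>\<Prod>i=1..N. \<zeta>(z + N - 1 - i)\<close> times \<open>\<Prod>p. f p (p powr (- z))\<close> (lemma \<open>product_orbit_dirichlet\<close>), where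
  \<open>f p y = 1 + (m - 1) y + O(y / p)\<close> since only words with a single descent at the last position matter to leading
  order.

  \<^emph>\<open>Continuation.\<close> Write \<open>1 + (m - 1) y\<close> formally as an infinite product of integer powers of \<open>1 - y ^ k\<close>. Moving the
  factors with \<open>k \<le> K\<close> into powers of \<open>\<zeta>(k z)\<close> leaves a product that converges for \<open>Re z > 1 / (K + 1)\<close>. Only
  zeta on \<open>Re s > - 1\<close> enters, and there the trapezoidal rule provides it.

  \<^emph>\<open>The boundary.\<close> For large \<open>p\<close> the factor \<open>f p\<close> has a real root in \<open>(- 1, 0)\<close>, bounded away from \<open>0\<close>. For \<open>m > 2\<close> it is
  close to \<open>- 1 / (m - 1)\<close>; for \<open>m = 2\<close> it is close to \<open>- 1\<close>, and the term of order \<open>1 / p\<close> moves it inside the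
  unit circle because the partition is not \<open>(1, 1)\<close>. The corresponding points \<open>z\<close> lie in \<open>Re z > 0\<close>, and as \<open>p\<close>
  grows they accumulate at every point of the line. If the function extended across such a point, all but
  finitely many of these zeros would have to be cancelled by zeros of the \<open>\<zeta>(k z)\<close>, with \<open>k\<close> of order \<open>ln p\<close>. Distinct primes
  give distinct points. The number of zeros of zeta up to height \<open>h\<close> is bounded by a polynomial in \<open>h\<close>, so that
  the sum of the reciprocals of the primes would converge. It diverges, and there is no extension
  (theorem \<open>natural_boundary\<close>).
\<close>

section \<open>The Riemann zeta function to the right of -1\<close>

text \<open>The trapezoidal-rule error of \<open>(s - 1) x powr (- s)\<close> on \<open>[n + 1, n + 2]\<close>. Multiplying by
  \<open>s - 1\<close> removes the pole of zeta, so that the series below defines \<open>(s - 1) \<zeta>(s)\<close> itself.\<close>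

definition zeta_correction :: "complex \<Rightarrow> nat \<Rightarrow> complex" where
  "zeta_correction s n =
     (s - 1) / 2 * (of_nat (n + 1) powr (- s) + of_nat (n + 2) powr (- s))
     + (of_nat (n + 2) powr (1 - s) - of_nat (n + 1) powr (1 - s))"

definition zeta_reg :: "complex \<Rightarrow> complex" where
  "zeta_reg s = (s - 1) / 2 + 1 + (\<Sum>n. zeta_correction s n)"

definition zeta :: "complex \<Rightarrow> complex" where
  "zeta s = zeta_reg s / (s - 1)"

lemma norm_nat_powr: "n > 0 \<Longrightarrow> norm (of_nat n powr s :: complex) = real n powr Re s"
  using norm_powr_real_powr[of "of_nat n" s] by simp

text \<open>The error vanishes to second order at the left endpoint of the interval, and its second derivative in
  the length \<open>t\<close> of the interval is \<open>s (s - 1) (s + 1) t / 2 \<cdot> (x + t) powr (- s - 2)\<close>. The gain of two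
  powers of \<open>n\<close> is what carries the series to \<open>Re s > -1\<close>.\<close>

lemma zeta_correction_bound:
  assumes "Re s > -2"
  shows "norm (zeta_correction s n)
           \<le> norm s * norm (s - 1) * norm (s + 1) * real (n + 1) powr (- Re s - 2)"
proof -
  define x :: real where "x = real (n + 1)"
  have x: "x \<ge> 1" by (simp add: x_def)
  define c :: complex where "c = of_real x"
  define S where "S = closed_segment (0::complex) 1"
  \<comment> \<open>\<open>f i\<close> is the \<open>i\<close>-th derivative of the error in the length \<open>t\<close> of the interval.\<close>
  define f where "f = (\<lambda>i::nat. \<lambda>t::complex.
     if i = 0 then (s - 1) * (t / 2) * (c powr (-s) + (c + t) powr (-s)) + (c + t) powr (1 - s) - c powr (1 - s)
     else if i = 1 then (s - 1) / 2 * (c powr (-s) - (c + t) powr (-s)) - s * (s - 1) / 2 * t * (c + t) powr (- s - 1)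
     else s * (s - 1) * (s + 1) / 2 * t * (c + t) powr (- s - 2))"
  have S: "\<exists>u. 0 \<le> u \<and> u \<le> 1 \<and> t = of_real u" if "t \<in> S" for t
    using that unfolding S_def by (auto simp: in_segment scaleR_conv_of_real)
  have pos: "c + t \<notin> \<real>\<^sub>\<le>\<^sub>0 \<and> c + t \<noteq> 0" if "t \<in> S" for t
  proof -
    obtain u where u: "0 \<le> u" "t = of_real u" using S[OF \<open>t \<in> S\<close>] by auto
    have "c + t = of_real (x + u)" by (simp add: c_def u)
    moreover have "x + u > 0" using x u by simp
    ultimately show ?thesis by (metis complex_nonpos_Reals_iff Re_complex_of_real not_less of_real_eq_0_iff less_irrefl)
  qed
  have d: "((\<lambda>t. (c + t) powr w) has_field_derivative w * (c + t) powr (w - 1)) (at t within S)"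
    if "t \<in> S" for t w
    using pos[OF that] by (auto intro!: derivative_eq_intros)
  have der: "(f i has_field_derivative f (Suc i) t) (at t within S)" if "t \<in> S" "i \<le> 1" for i t
  proof -
    define q where "q = (\<lambda>w t. (c + t) powr w)"
    have dq: "((\<lambda>t. q w t) has_field_derivative w * q (w - 1) t) (at t within S)" for w
      using d[OF that(1), of w] by (simp add: q_def)
    have e0: "f 0 = (\<lambda>t. (s - 1) / 2 * (t * (c powr (-s) + q (-s) t)) + q (1 - s) t - c powr (1 - s))"
      by (simp add: f_def q_def fun_eq_iff)
    have e1: "f 1 = (\<lambda>t. (s - 1) / 2 * (c powr (-s) - q (-s) t) - s * (s - 1) / 2 * (t * q (- s - 1) t))"
      by (simp add: f_def q_def fun_eq_iff)
    have e2: "f 2 t = s * (s - 1) * (s + 1) / 2 * t * q (- s - 2) t"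
      by (simp add: f_def q_def)
    have x: "1 - s - 1 = - s" "- s - 1 - 1 = - s - 2" by simp_all
    consider "i = 0" | "i = 1" using \<open>i \<le> 1\<close> by linarith
    then show ?thesis
    proof cases
      case 1
      have "(f 0 has_field_derivative f 1 t) (at t within S)"
        unfolding e0 by (rule DERIV_cong, (rule derivative_intros dq)+) (subst e1, simp add: x field_simps)
      then show ?thesis using 1 by simp
    next
      case 2
      have "(f 1 has_field_derivative f 2 t) (at t within S)"
        unfolding e1 by (rule DERIV_cong, (rule derivative_intros dq)+) (subst e2, simp add: x field_simps)
      then show ?thesis using 2 by (simp add: numeral_2_eq_2)
    qed
  qed
  have bd: "norm (f (Suc 1) t) \<le> norm s * norm (s - 1) * norm (s + 1) / 2 * x powr (- Re s - 2)" if "t \<in> S" for t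
  proof -
    obtain u where u: "0 \<le> u" "u \<le> 1" "t = of_real u" using S[OF \<open>t \<in> S\<close>] by auto
    have e: "c + t = of_real (x + u)" by (simp add: c_def u)
    have "norm ((c + t) powr (- s - 2)) = (x + u) powr (- Re s - 2)"
      unfolding e using x u norm_powr_real_powr[of "of_real (x + u)" "- s - 2"] by (simp del: of_real_add)
    also have "\<dots> \<le> x powr (- Re s - 2)"
      using x u assms by (intro powr_mono2') auto
    finally have 1: "norm ((c + t) powr (- s - 2)) \<le> x powr (- Re s - 2)" .
    have 2: "norm t \<le> 1" using u by simp
    have "norm (f (Suc 1) t) = norm s * norm (s - 1) * norm (s + 1) / 2 * (norm t * norm ((c + t) powr (- s - 2)))"
      by (simp add: f_def norm_mult norm_divide)
    also have "\<dots> \<le> norm s * norm (s - 1) * norm (s + 1) / 2 * (1 * x powr (- Re s - 2))"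
      using 1 2 by (intro mult_left_mono mult_mono) auto
    finally show ?thesis by simp
  qed
  have "norm (f 0 1 - (\<Sum>i\<le>1. f i 0 * (1 - 0) ^ i / fact i))
     \<le> norm s * norm (s - 1) * norm (s + 1) / 2 * x powr (- Re s - 2) * norm (1 - 0 :: complex) ^ (Suc 1) / fact 1"
    by (rule complex_Taylor[where S = S and f = f]) (use der bd in \<open>auto simp: S_def\<close>)
  moreover have "(\<Sum>i\<le>1. f i 0 * (1 - 0) ^ i / fact i) = 0"
    by (simp add: f_def)
  moreover have "f 0 1 = zeta_correction s n"
    by (simp add: f_def zeta_correction_def c_def x_def add_ac)
  ultimately have "norm (zeta_correction s n) \<le> norm s * norm (s - 1) * norm (s + 1) / 2 * x powr (- Re s - 2)"
    by simp
  also have "\<dots> \<le> norm s * norm (s - 1) * norm (s + 1) * x powr (- Re s - 2)"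
    by (simp add: mult_right_mono)
  finally show ?thesis by (simp add: x_def)
qed

lemma summable_Suc_powr: "a < -1 \<Longrightarrow> summable (\<lambda>n. real (n + 1) powr a)"
  using summable_ignore_initial_segment[of "\<lambda>n. real n powr a" 1] summable_real_powr_iff[of a] by simp

lemma zeta_reg_holomorphic: "zeta_reg holomorphic_on {s. Re s > -1}"
proof -
  have hol: "(\<lambda>s. zeta_correction s n) holomorphic_on A" for n A
    unfolding zeta_correction_def by (intro holomorphic_intros) (auto simp: complex_nonpos_Reals_iff)
  have "(\<lambda>s. \<Sum>n. zeta_correction s n) holomorphic_on {s. Re s > -1}"
  proof (rule holomorphic_uniform_sequence[where f = "\<lambda>m s. \<Sum>n<m. zeta_correction s n"])
    show "open {s. - 1 < Re s}" by (rule open_halfspace_Re_gt)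
    show "(\<lambda>s. \<Sum>n<m. zeta_correction s n) holomorphic_on {s. - 1 < Re s}" for m
      by (intro holomorphic_intros hol)
    fix s assume "s \<in> {s. - 1 < Re s}"
    then have s: "Re s > -1" by simp
    define d where "d = (Re s + 1) / 2"
    have d: "d > 0" using s by (simp add: d_def)
    have re: "Re z \<ge> Re s - d" "norm z \<le> norm s + d" if "z \<in> cball s d" for z
    proof -
      have n: "norm (s - z) \<le> d" using that by (simp add: dist_norm)
      then have "Re (s - z) \<le> d" using complex_Re_le_cmod order_trans by blast
      then show "Re z \<ge> Re s - d" by simp
      show "norm z \<le> norm s + d" using n norm_triangle_sub[of z s] by (simp add: norm_minus_commute)
    qed
    have gt: "Re z > -1" if "z \<in> cball s d" for z
      using re(1)[OF that] s by (simp add: d_def field_simps)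
    define C where "C = norm s + d + 1"
    have "uniform_limit (cball s d) (\<lambda>m s. \<Sum>n<m. zeta_correction s n) (\<lambda>s. \<Sum>n. zeta_correction s n) sequentially"
    proof (rule Weierstrass_m_test)
      show "summable (\<lambda>n. C * C * C * real (n + 1) powr (- (Re s - d) - 2))"
        using s by (intro summable_mult summable_Suc_powr) (simp add: d_def)
      fix n z assume z: "z \<in> cball s d"
      have C: "norm z \<le> C" "norm (z - 1) \<le> C" "norm (z + 1) \<le> C"
        using re(2)[OF z] norm_triangle_ineq4[of z 1] norm_triangle_ineq[of z 1] by (auto simp: C_def)
      have "norm (zeta_correction z n) \<le> norm z * norm (z - 1) * norm (z + 1) * real (n + 1) powr (- Re z - 2)"
        using gt[OF z] by (intro zeta_correction_bound) auto
      also have "\<dots> \<le> C * C * C * real (n + 1) powr (- (Re s - d) - 2)"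
        using C re[OF z] by (intro mult_mono powr_mono) (use d in \<open>auto simp: C_def\<close>)
      finally show "norm (zeta_correction z n) \<le> C * C * C * real (n + 1) powr (- (Re s - d) - 2)" .
    qed
    moreover have "cball s d \<subseteq> {s. - 1 < Re s}" using gt by auto
    ultimately show "\<exists>d>0. cball s d \<subseteq> {s. - 1 < Re s} \<and>
        uniform_limit (cball s d) (\<lambda>m s. \<Sum>n<m. zeta_correction s n) (\<lambda>s. \<Sum>n. zeta_correction s n) sequentially"
      using d by blast
  qed
  then show ?thesis
    unfolding zeta_reg_def[abs_def] by (intro holomorphic_intros) auto
qed

lemma nat_powr_summable:
  assumes "Re s > 1" shows "summable (\<lambda>n. norm (of_nat (n + 1) powr (- s) :: complex))"
proof -
  have "norm (of_nat (n + 1) powr (- s) :: complex) = real (n + 1) powr (- Re s)" for n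
    by (subst norm_nat_powr) auto
  then show ?thesis using summable_Suc_powr[of "- Re s"] assms by simp
qed

text \<open>Summing the correction terms, the trapezoid part gives \<open>(s - 1) (\<zeta>(s) - 1 / 2)\<close> and the remaining part
  telescopes to \<open>- 1\<close>.\<close>

lemma zeta_sums:
  assumes "Re s > 1" shows "(\<lambda>n. of_nat (n + 1) powr (- s)) sums zeta s"
proof -
  define a :: "nat \<Rightarrow> complex" where "a n = of_nat (n + 1) powr (- s)" for n
  define Z where "Z = (\<Sum>n. a n)"
  have "summable a" unfolding a_def using nat_powr_summable[OF assms] by (rule summable_norm_cancel)
  then have Z: "a sums Z" by (simp add: Z_def summable_sums)
  then have Z1: "(\<lambda>n. a (Suc n)) sums (Z - a 0)" by (simp add: sums_Suc_iff)
  define g :: "nat \<Rightarrow> complex" where "g n = of_nat (n + 1) powr (1 - s)" for n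
  have "g \<longlonglongrightarrow> 0"
  proof (rule Lim_null_comparison)
    have "norm (g n) = real (n + 1) powr (1 - Re s)" for n
      unfolding g_def by (subst norm_nat_powr) auto
    then show "\<forall>\<^sub>F n in sequentially. norm (g n) \<le> real (n + 1) powr (1 - Re s)" by simp
    show "(\<lambda>n. real (n + 1) powr (1 - Re s)) \<longlonglongrightarrow> 0"
      using assms by (intro tendsto_neg_powr filterlim_compose[OF filterlim_real_sequentially] filterlim_add_const_nat_at_top) auto
  qed
  then have "(\<lambda>n. g (Suc n) - g n) sums (0 - g 0)" by (rule telescope_sums)
  then have A: "(\<lambda>n. (s - 1) / 2 * (a n + a (Suc n)) + (g (Suc n) - g n)) sums
      ((s - 1) / 2 * (Z + (Z - a 0)) + (0 - g 0))" (is "_ sums ?L")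
    by (intro sums_add sums_mult Z Z1)
  have B: "(\<lambda>n. (s - 1) / 2 * (a n + a (Suc n)) + (g (Suc n) - g n)) = zeta_correction s"
    by (simp add: fun_eq_iff zeta_correction_def a_def g_def add_ac)
  have C: "?L = (s - 1) * Z - (s - 1) / 2 - 1"
    by (simp add: a_def g_def field_simps)
  have "zeta_correction s sums ((s - 1) * Z - (s - 1) / 2 - 1)"
    using A unfolding B C .
  then have "zeta_reg s = (s - 1) * Z"
    by (simp add: zeta_reg_def sums_iff)
  then have "zeta s = Z" using assms by (auto simp: zeta_def)
  then show ?thesis using Z unfolding a_def[abs_def] by simp
qed

lemma zeta_holomorphic: "zeta holomorphic_on {s. Re s > -1} - {1}"
  unfolding zeta_def[abs_def]
  by (intro holomorphic_intros holomorphic_on_subset[OF zeta_reg_holomorphic]) auto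

lemma zeta_meromorphic: "zeta meromorphic_on {s. Re s > -1}"
  unfolding zeta_def[abs_def]
  by (intro meromorphic_intros analytic_on_imp_meromorphic_on)
     (use zeta_reg_holomorphic in \<open>simp add: analytic_on_open open_halfspace_Re_gt\<close>)

text \<open>Only the polynomial growth in vertical strips matters: it keeps the number of zeros up to a given
  height polynomial.\<close>

lemma zeta_reg_polynomial_bound:
  "\<exists>A>0. \<forall>s. Re s \<ge> -1/2 \<longrightarrow> norm (zeta_reg s) \<le> A * (norm s + 2) ^ 3"
proof -
  define B where "B = (\<Sum>n. real (n + 1) powr (- 3 / 2))"
  have sB: "summable (\<lambda>n. real (n + 1) powr (- 3 / 2))" by (rule summable_Suc_powr) simp
  have B0: "B \<ge> 0" unfolding B_def by (intro suminf_nonneg sB) simp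
  have "norm (zeta_reg s) \<le> (1 + B) * (norm s + 2) ^ 3" if s: "Re s \<ge> -1/2" for s
  proof -
    define C where "C = norm s + 2"
    have C: "norm s \<le> C" "norm (s - 1) \<le> C" "norm (s + 1) \<le> C" "C \<ge> 2"
      using norm_triangle_ineq4[of s 1] norm_triangle_ineq[of s 1] by (auto simp: C_def)
    have bd: "norm (zeta_correction s n) \<le> C ^ 3 * real (n + 1) powr (- 3 / 2)" for n
    proof -
      have "norm (zeta_correction s n) \<le> norm s * norm (s - 1) * norm (s + 1) * real (n + 1) powr (- Re s - 2)"
        using s by (intro zeta_correction_bound) auto
      also have "\<dots> \<le> C * C * C * real (n + 1) powr (- 3 / 2)"
        using C s by (intro mult_mono powr_mono) (auto simp: field_simps)
      finally show ?thesis by (simp add: power3_eq_cube)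
    qed
    have "norm (\<Sum>n. zeta_correction s n) \<le> (\<Sum>n. C ^ 3 * real (n + 1) powr (- 3 / 2))"
      using bd sB by (intro norm_suminf_le summable_mult) auto
    also have "\<dots> = C ^ 3 * B" unfolding B_def using sB by (rule suminf_mult)
    finally have 1: "norm (\<Sum>n. zeta_correction s n) \<le> C ^ 3 * B" .
    have "norm (zeta_reg s) \<le> norm ((s - 1) / 2) + 1 + norm (\<Sum>n. zeta_correction s n)"
      unfolding zeta_reg_def by (metis (no_types) add_right_mono norm_one norm_triangle_ineq order_trans)
    also have "\<dots> \<le> C + C ^ 3 * B"
      using 1 C(2,4) by (simp add: norm_divide)
    also have "\<dots> \<le> C ^ 3 + C ^ 3 * B" using C(4) power_increasing[of 1 3 C] by simp
    finally show ?thesis unfolding C_def[symmetric] by (simp add: algebra_simps)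
  qed
  moreover have "1 + B > 0" using B0 by simp
  ultimately show ?thesis by blast
qed

section \<open>Zeros of the zeta function\<close>

text \<open>A form of Jensen's inequality: every zero in the smaller disc can be divided out by a Blaschke factor,
  which leaves the maximum on the circle of radius \<open>R\<close> unchanged and increases the value at the centre by
  a factor of at least \<open>R / r\<close>.\<close>

lemma zero_count_disc:
  fixes f :: "complex \<Rightarrow> complex"
  assumes "finite Z" and "f holomorphic_on cball 0 R" and "0 < r" "r < R"
    and "\<And>z. norm z \<le> R \<Longrightarrow> norm (f z) \<le> M"
    and "\<And>a. a \<in> Z \<Longrightarrow> norm a \<le> r \<and> f a = 0"
  shows "norm (f 0) * (R / r) ^ card Z \<le> M"
  using assms(1,2,5,6)
proof (induction Z arbitrary: f rule: finite_induct)
  case empty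
  then show ?case using assms(3,4) by simp
next
  case (insert a Z)
  have R: "R > 0" using assms(3,4) by simp
  have a: "norm a \<le> r" "f a = 0" using insert.prems(3) by auto
  have M0: "M \<ge> 0" using insert.prems(2)[of 0] R order_trans[OF norm_ge_zero[of "f 0"]] by simp
  show ?case
  proof (cases "a = 0")
    case True
    then show ?thesis using a M0 by simp
  next
    case False
    \<comment> \<open>Dividing out the zero \<open>a\<close> by a Blaschke factor does not change the modulus on the circle.\<close>
    define g where "g = (\<lambda>z. if z = a then deriv f a else f z / (z - a))"
    define h where "h = (\<lambda>z. g z * (of_real (R ^ 2) - cnj a * z) / of_real R)"
    have "(\<lambda>z. if z = a then deriv f a else (f z - f a) / (z - a)) holomorphic_on cball 0 R"
      using insert.prems(1) a assms(4) by (intro pole_lemma) auto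
    then have g: "g holomorphic_on cball 0 R" by (simp add: g_def a(2) cong: if_cong)
    then have h: "h holomorphic_on cball 0 R"
      unfolding h_def using R by (intro holomorphic_intros) auto
    have bd: "norm (h z) \<le> M" if z: "norm z \<le> R" for z
    proof (rule maximum_modulus_frontier[where S = "cball 0 R" and f = h])
      show "h holomorphic_on interior (cball 0 R)" by (rule holomorphic_on_subset[OF h]) simp
      show "continuous_on (closure (cball 0 R)) h" using h by (simp add: holomorphic_on_imp_continuous_on)
      show "z \<in> cball 0 R" using z by simp
      fix w assume "w \<in> frontier (cball (0::complex) R)"
      then have w: "norm w = R" by simp
      then have "w \<noteq> a" using a(1) assms(4) by auto
      have "of_real (R ^ 2) - cnj a * w = w * cnj (w - a)"
        using w by (simp add: algebra_simps complex_norm_square[symmetric])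
      then have "norm (of_real (R ^ 2) - cnj a * w) = R * norm (w - a)"
        using w by (metis complex_mod_cnj norm_mult)
      then have "norm (h w) = norm (f w)"
        using \<open>w \<noteq> a\<close> R by (simp add: h_def g_def norm_mult norm_divide)
      then show "norm (h w) \<le> M" using insert.prems(2)[of w] w by simp
    qed simp
    have "norm (h 0) * (R / r) ^ card Z \<le> M"
    proof (rule insert.IH[OF h bd])
      fix b assume "b \<in> Z"
      then show "norm b \<le> r \<and> h b = 0"
        using insert.prems(3)[of b] insert.hyps(2) by (auto simp: h_def g_def)
    qed auto
    moreover have "norm (f 0) * (R / r) \<le> norm (h 0)"
    proof -
      have "norm (h 0) = norm (f 0) * (R / norm a)"
        using False R by (simp add: h_def g_def norm_mult norm_divide power2_eq_square)
      moreover have "R / r \<le> R / norm a" using a(1) False R assms(3) by (intro divide_left_mono) auto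
      ultimately show ?thesis using mult_left_mono[of "R / r" "R / norm a" "norm (f 0)"] by simp
    qed
    then have "norm (f 0) * (R / r) * (R / r) ^ card Z \<le> norm (h 0) * (R / r) ^ card Z"
      using R assms(3) by (intro mult_right_mono) auto
    ultimately show ?thesis using insert.hyps by (simp add: mult.assoc)
  qed
qed

text \<open>The terms after the first have absolute values that sum to \<open>\<pi>\<^sup>2 / 6 - 1 < 3 / 4\<close>.\<close>

lemma zeta_lower_bound: "norm (zeta (Complex 2 t)) \<ge> 1 / 4"
proof -
  define s where "s = Complex 2 t"
  define a :: "nat \<Rightarrow> complex" where "a n = of_nat (n + 1) powr (- s)" for n
  have a: "a sums zeta s" unfolding a_def using zeta_sums[of s] by (simp add: s_def)
  have na: "norm (a n) = 1 / (real n + 1) ^ 2" for n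
  proof -
    have "norm (a n) = real (n + 1) powr (- 2)" unfolding a_def by (subst norm_nat_powr) (auto simp: s_def)
    then show ?thesis by (simp add: powr_minus powr_numeral divide_inverse add_ac)
  qed
  have sq: "(\<lambda>n. 1 / (real n + 1) ^ 2) sums (pi ^ 2 / 6)" using inverse_squares_sums by (simp add: add_ac)
  have a0: "a 0 = 1" by (simp add: a_def)
  have a1: "(\<lambda>n. a (Suc n)) sums (zeta s - 1)" using a a0 by (simp add: sums_Suc_iff)
  have sq1: "(\<lambda>n. norm (a (Suc n))) sums (pi ^ 2 / 6 - 1)"
    using sq sums_Suc_iff[of "\<lambda>n. norm (a n)" "pi ^ 2 / 6 - 1"] unfolding na[symmetric] by (simp add: a0)
  have "norm (zeta s - 1) \<le> pi ^ 2 / 6 - 1"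
    using a1 sq1 by (metis order_refl norm_sums_le)
  also have "pi \<le> 32 / 10" using pi_approx(2) by simp
  then have "pi ^ 2 / 6 - 1 \<le> (32 / 10) ^ 2 / 6 - 1" by (intro diff_right_mono divide_right_mono power_mono) auto
  finally have "norm (zeta s - 1) \<le> 3 / 4" by (simp add: power2_eq_square)
  moreover have "norm (1 :: complex) \<le> norm (zeta s) + norm (zeta s - 1)"
    using norm_triangle_ineq4[of "zeta s" "zeta s - 1"] by simp
  ultimately show ?thesis by (simp add: s_def)
qed

text \<open>\<open>zeta_reg\<close> is used instead of \<open>zeta\<close> since division by zero makes \<open>zeta 1 = 0\<close>.\<close>

definition zeta_zeros :: "complex set" where
  "zeta_zeros = {s. 0 \<le> Re s \<and> Re s \<le> 1 \<and> zeta_reg s = 0}"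

text \<open>The disc of radius \<open>21 / 10\<close> around \<open>2 + (a + 1 / 2) \<i>\<close> covers the rectangle in question, and the disc of
  radius \<open>5 / 2\<close> stays in \<open>Re s \<ge> - 1 / 2\<close>, where the growth is polynomial.\<close>

lemma zeta_zeros_strip:
  "\<exists>B>0. \<forall>a. finite {s \<in> zeta_zeros. a \<le> Im s \<and> Im s \<le> a + 1}
        \<and> real (card {s \<in> zeta_zeros. a \<le> Im s \<and> Im s \<le> a + 1}) \<le> B * (\<bar>a\<bar> + 8) ^ 3"
proof -
  obtain A where A: "A > 0" "\<And>s. Re s \<ge> -1/2 \<Longrightarrow> norm (zeta_reg s) \<le> A * (norm s + 2) ^ 3"
    using zeta_reg_polynomial_bound by blast
  have "finite {s \<in> zeta_zeros. a \<le> Im s \<and> Im s \<le> a + 1}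
        \<and> card {s \<in> zeta_zeros. a \<le> Im s \<and> Im s \<le> a + 1} \<le> nat \<lfloor>21 * A * (\<bar>a\<bar> + 8) ^ 3\<rfloor>" (is "finite ?S \<and> _") for a
  proof (rule finite_if_finite_subsets_card_bdd)
    fix G assume G: "G \<subseteq> ?S" "finite G"
    \<comment> \<open>The real part \<open>2\<close> of the centre gives a lower bound for zeta there.\<close>
    define c where "c = Complex 2 (a + 1 / 2)"
    define f where "f = (\<lambda>z. zeta_reg (c + z))"
    define Z where "Z = (\<lambda>z. z - c) ` G"
    have rew: "Re (c + z) \<ge> - 1 / 2" "norm (c + z) + 2 \<le> \<bar>a\<bar> + 8" if "norm z \<le> 5 / 2" for z
    proof -
      have "\<bar>Re z\<bar> \<le> 5 / 2" using abs_Re_le_cmod[of z] that by linarith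
      then show "Re (c + z) \<ge> - 1 / 2" by (simp add: c_def)
      have "norm c \<le> 2 + \<bar>a + 1 / 2\<bar>" using cmod_le[of c] by (simp add: c_def)
      then show "norm (c + z) + 2 \<le> \<bar>a\<bar> + 8"
        using norm_triangle_ineq[of c z] that by linarith
    qed
    have "norm (f 0) * ((5 / 2) / (21 / 10)) ^ card Z \<le> A * (\<bar>a\<bar> + 8) ^ 3"
    proof (rule zero_count_disc)
      show "finite Z" using G by (simp add: Z_def)
      have "(zeta_reg \<circ> (\<lambda>z. c + z)) holomorphic_on cball 0 (5 / 2)"
        by (rule holomorphic_on_compose_gen[OF _ zeta_reg_holomorphic])
           (use rew(1) in \<open>fastforce intro!: holomorphic_intros\<close>)+
      then show "f holomorphic_on cball 0 (5 / 2)" by (simp add: f_def comp_def)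
      fix z :: complex assume z: "norm z \<le> 5 / 2"
      have "norm (f z) \<le> A * (norm (c + z) + 2) ^ 3" unfolding f_def using rew(1)[OF z] by (intro A(2)) simp
      also have "\<dots> \<le> A * (\<bar>a\<bar> + 8) ^ 3" using rew(2)[OF z] A(1) by (intro mult_left_mono power_mono) auto
      finally show "norm (f z) \<le> A * (\<bar>a\<bar> + 8) ^ 3" .
    next
      fix b assume "b \<in> Z"
      then obtain s where s: "s \<in> ?S" "b = s - c" using G by (auto simp: Z_def)
      have "f b = 0" using s by (simp add: f_def zeta_zeros_def)
      have "\<bar>Re b\<bar> \<le> 2" "\<bar>Im b\<bar> \<le> 1 / 2" using s by (auto simp: c_def zeta_zeros_def abs_if)
      then have "(Re b)^2 \<le> 2 ^ 2" "(Im b)^2 \<le> (1 / 2) ^ 2" using power_mono[of "\<bar>Re b\<bar>" 2 2] power_mono[of "\<bar>Im b\<bar>" "1/2" 2] by auto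
      then have "(norm b) ^ 2 \<le> (21 / 10) ^ 2" unfolding cmod_power2 by (simp add: power2_eq_square)
      then have "norm b \<le> 21 / 10" by (rule power2_le_imp_le) simp
      with \<open>f b = 0\<close> show "norm b \<le> 21 / 10 \<and> f b = 0" by simp
    qed auto
    moreover have "norm (f 0) \<ge> 1 / 4"
    proof -
      have "f 0 = (c - 1) * zeta c" by (auto simp: f_def zeta_def c_def complex_eq_iff)
      moreover have "norm (c - 1) \<ge> 1" using complex_Re_le_cmod[of "c - 1"] by (simp add: c_def)
      ultimately show ?thesis using zeta_lower_bound[of "a + 1/2"] mult_mono[of 1 "norm (c - 1)" "1/4" "norm (zeta c)"]
        by (simp add: norm_mult c_def)
    qed
    moreover have "1 + real (card Z) * (4 / 21) \<le> (1 + 4 / 21) ^ card Z"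
      by (rule Bernoulli_inequality) simp
    then have "real (card Z) * (4 / 21) \<le> ((5 / 2) / (21 / 10)) ^ card Z" by simp
    ultimately have "1 / 4 * (real (card Z) * (4 / 21)) \<le> A * (\<bar>a\<bar> + 8) ^ 3"
      using mult_mono[of "1/4" "norm (f 0)" "real (card Z) * (4 / 21)" "((5 / 2) / (21 / 10)) ^ card Z"] by simp
    moreover have "card Z = card G" unfolding Z_def by (rule card_image) (auto simp: inj_on_def)
    ultimately have "real (card G) \<le> 21 * A * (\<bar>a\<bar> + 8) ^ 3" by simp
    then show "card G \<le> nat \<lfloor>21 * A * (\<bar>a\<bar> + 8) ^ 3\<rfloor>" by (simp add: le_nat_iff le_floor_iff)
  qed
  note * = this
  have "real (card {s \<in> zeta_zeros. a \<le> Im s \<and> Im s \<le> a + 1}) \<le> 21 * A * (\<bar>a\<bar> + 8) ^ 3" for a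
  proof -
    have "real (nat \<lfloor>21 * A * (\<bar>a\<bar> + 8) ^ 3\<rfloor>) \<le> 21 * A * (\<bar>a\<bar> + 8) ^ 3" using A(1) by simp
    then show ?thesis using *[of a] by (meson of_nat_le_iff order_trans)
  qed
  then show ?thesis using * A(1) by (intro exI[of _ "21 * A"]) auto
qed

text \<open>A polynomial number of zeros in each strip of height one is dominated by exponential decay.\<close>

lemma zeta_zeros_exp_summable:
  assumes c: "c > 0"
  shows "(\<lambda>s. exp (- c * norm s)) summable_on zeta_zeros"
proof -
  obtain B where B: "B > 0" "\<And>a. finite {s \<in> zeta_zeros. a \<le> Im s \<and> Im s \<le> a + 1}"
      "\<And>a. real (card {s \<in> zeta_zeros. a \<le> Im s \<and> Im s \<le> a + 1}) \<le> B * (\<bar>a\<bar> + 8) ^ 3"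
    using zeta_zeros_strip by blast
  define N where "N = (\<lambda>s. nat \<lfloor>\<bar>Im s\<bar>\<rfloor>)"
  define g where "g = (\<lambda>n::nat. 2 * B * (real n + 9) ^ 3 * exp (- c * real n))"
  have g: "summable g"
  proof (rule summable_comparison_test_bigo)
    show "summable (\<lambda>n. norm (real n powr (-2)))" by (simp add: summable_real_powr_iff)
    show "g \<in> O(\<lambda>n. real n powr (-2))" unfolding g_def using c by real_asymp
  qed
  have strip: "real (card S) * exp (- c * real n) \<le> g n"
    if S: "S \<subseteq> zeta_zeros" "\<And>s. s \<in> S \<Longrightarrow> N s = n" for S n
  proof -
    let ?T = "\<lambda>a. {s \<in> zeta_zeros. a \<le> Im s \<and> Im s \<le> a + 1}"
    have "S \<subseteq> ?T (real n) \<union> ?T (- real n - 1)"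
    proof
      fix s assume s: "s \<in> S"
      then have "real n \<le> \<bar>Im s\<bar>" "\<bar>Im s\<bar> \<le> real n + 1"
        using S(2)[OF s] by (auto simp: N_def)
      then show "s \<in> ?T (real n) \<union> ?T (- real n - 1)" using S(1) s by (auto simp: abs_if split: if_splits)
    qed
    then have "card S \<le> card (?T (real n) \<union> ?T (- real n - 1))" by (intro card_mono finite_UnI) (use B(2)[of "real n"] B(2)[of "- real n - 1"] in auto)
    also have "\<dots> \<le> card (?T (real n)) + card (?T (- real n - 1))" by (rule card_Un_le)
    finally have "real (card S) \<le> real (card (?T (real n))) + real (card (?T (- real n - 1)))" by linarith
    also have "\<dots> \<le> B * (\<bar>real n\<bar> + 8) ^ 3 + B * (\<bar>- real n - 1\<bar> + 8) ^ 3" by (intro add_mono B(3))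
    also have "\<dots> \<le> B * (real n + 9) ^ 3 + B * (real n + 9) ^ 3"
      using B(1) by (intro add_mono[OF mult_left_mono[OF power_mono] mult_left_mono[OF power_mono]]) auto
    also have "\<dots> = 2 * B * (real n + 9) ^ 3" by simp
    finally show ?thesis unfolding g_def by (intro mult_right_mono) auto
  qed
  show ?thesis
  proof (rule nonneg_bdd_above_summable_on)
    show "bdd_above (sum (\<lambda>s. exp (- c * norm s)) ` {F. F \<subseteq> zeta_zeros \<and> finite F})"
    proof (rule bdd_aboveI2)
      fix F assume F: "F \<in> {F. F \<subseteq> zeta_zeros \<and> finite F}"
      have "(\<Sum>s\<in>F. exp (- c * norm s)) \<le> (\<Sum>s\<in>F. exp (- c * real (N s)))"
      proof (rule sum_mono)
        fix s
        have "real (N s) \<le> norm s" using abs_Im_le_cmod[of s] by (simp add: N_def) linarith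
        then show "exp (- c * norm s) \<le> exp (- c * real (N s))" using c by simp
      qed
      also have "\<dots> = (\<Sum>n\<in>N ` F. \<Sum>s\<in>{s\<in>F. N s = n}. exp (- c * real (N s)))"
        using F by (intro sum.image_gen) auto
      also have "\<dots> = (\<Sum>n\<in>N ` F. real (card {s\<in>F. N s = n}) * exp (- c * real n))"
        by (intro sum.cong) auto
      also have "\<dots> \<le> (\<Sum>n\<in>N ` F. g n)" using F by (intro sum_mono strip) auto
      also have "\<dots> \<le> suminf g" using F B(1) by (intro sum_le_suminf g) (auto simp: g_def)
      finally show "(\<Sum>s\<in>F. exp (- c * norm s)) \<le> suminf g" .
    qed
  qed auto
qed

section \<open>Euler products\<close>

definition smooth_numbers :: "nat set \<Rightarrow> nat set" where
  "smooth_numbers P = {n. n > 0 \<and> prime_factors n \<subseteq> P}"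

text \<open>Unique factorisation in the form needed for an induction over a set of primes.\<close>

lemma smooth_numbers_insert:
  assumes p: "prime p" "p \<notin> P" and P: "\<forall>q\<in>P. prime q"
  shows "bij_betw (\<lambda>(k, n). p ^ k * n) (UNIV \<times> smooth_numbers P) (smooth_numbers (insert p P))"
proof (rule bij_betw_byWitness[where f' = "\<lambda>n. (multiplicity p n, n div p ^ multiplicity p n)"])
  have cop: "\<not> p dvd n" if "n \<in> smooth_numbers P" for n
    using that p by (auto simp: smooth_numbers_def prime_factors_dvd)
  show "\<forall>a\<in>UNIV \<times> smooth_numbers P.
      (\<lambda>n. (multiplicity p n, n div p ^ multiplicity p n)) (case a of (k, n) \<Rightarrow> p ^ k * n) = a"
  proof (rule ballI)
    fix a :: "nat \<times> nat" assume "a \<in> UNIV \<times> smooth_numbers P"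
    then obtain k n where n: "n \<in> smooth_numbers P" and a: "a = (k, n)" by auto
    from n have n0: "n > 0" by (simp add: smooth_numbers_def)
    have "multiplicity p (p ^ k * n) = k"
      using cop[OF n] p n0 by (simp add: prime_elem_multiplicity_mult_distrib not_dvd_imp_multiplicity_0)
    then show "(\<lambda>n. (multiplicity p n, n div p ^ multiplicity p n)) (case a of (k, n) \<Rightarrow> p ^ k * n) = a"
      using p a by (simp add: prime_gt_0_nat)
  qed
  show "\<forall>a'\<in>smooth_numbers (insert p P).
      (case (multiplicity p a', a' div p ^ multiplicity p a') of (k, n) \<Rightarrow> p ^ k * n) = a'"
    by (simp add: multiplicity_dvd)
  show "(\<lambda>(k, n). p ^ k * n) ` (UNIV \<times> smooth_numbers P) \<subseteq> smooth_numbers (insert p P)"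
  proof (rule image_subsetI)
    fix a :: "nat \<times> nat" assume "a \<in> UNIV \<times> smooth_numbers P"
    then obtain k n where n: "n \<in> smooth_numbers P" and a: "a = (k, n)" by auto
    have "prime_factors (p ^ k * n) = prime_factors (p ^ k) \<union> prime_factors n"
      using n p by (intro prime_factors_product) (auto simp: smooth_numbers_def)
    moreover have "prime_factors (p ^ k) \<subseteq> {p}"
      using p by (auto simp: prime_factors_dvd dest: prime_dvd_power primes_dvd_imp_eq)
    ultimately show "(case a of (k, n) \<Rightarrow> p ^ k * n) \<in> smooth_numbers (insert p P)"
      using n p a by (auto simp: smooth_numbers_def prime_gt_0_nat)
  qed
  show "(\<lambda>n. (multiplicity p n, n div p ^ multiplicity p n)) ` smooth_numbers (insert p P) \<subseteq> UNIV \<times> smooth_numbers P"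
  proof (rule image_subsetI)
    fix n assume n: "n \<in> smooth_numbers (insert p P)"
    then have n0: "n > 0" by (simp add: smooth_numbers_def)
    obtain m where m: "n = p ^ multiplicity p n * m" "\<not> p dvd m"
      using p n0 by (metis multiplicity_decompose' not_prime_unit gr_implies_not0)
    have "n div p ^ multiplicity p n = m" using m(1) p
      by (metis nonzero_mult_div_cancel_left power_not_zero not_prime_0)
    moreover have "m \<in> smooth_numbers P"
    proof -
      have "m > 0" using m n0 by (metis gr0I mult_0_right)
      moreover have "m dvd n" using m(1) by (metis dvd_triv_right)
      then have "prime_factors m \<subseteq> prime_factors n" using n0 by (intro dvd_prime_factors) auto
      ultimately show ?thesis using n m(2) by (auto simp: smooth_numbers_def)
    qed
    ultimately show "(multiplicity p n, n div p ^ multiplicity p n) \<in> UNIV \<times> smooth_numbers P" by simp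
  qed
qed

lemma multiplicative_has_sum_smooth:
  fixes f :: "nat \<Rightarrow> 'a :: {real_normed_field, banach}"
  assumes f1: "f 1 = 1" and mult: "\<And>m n. coprime m n \<Longrightarrow> f (m * n) = f m * f n"
    and "finite P" and "\<forall>p\<in>P. prime p"
    and "\<And>p. p \<in> P \<Longrightarrow> summable (\<lambda>k. norm (f (p ^ k)))"
  shows "(\<lambda>n. norm (f n)) summable_on smooth_numbers P
       \<and> (f has_sum (\<Prod>p\<in>P. \<Sum>k. f (p ^ k))) (smooth_numbers P)"
  using assms(3-5)
proof (induction P rule: finite_induct)
  case empty
  have "smooth_numbers {} = {1}"
    by (auto simp: smooth_numbers_def prime_factorization_empty_iff)
  then show ?case by (simp add: f1[simplified] has_sum_finite_iff)
next
  case (insert p P)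
  have p: "prime p" using insert.prems by simp
  have IH: "(\<lambda>n. norm (f n)) summable_on smooth_numbers P"
     "(f has_sum (\<Prod>p\<in>P. \<Sum>k. f (p ^ k))) (smooth_numbers P)"
    using insert by auto
  have bij: "bij_betw (\<lambda>(k, n). p ^ k * n) (UNIV \<times> smooth_numbers P) (smooth_numbers (insert p P))"
    using insert p by (intro smooth_numbers_insert) auto
  have fm: "f (p ^ k * n) = f (p ^ k) * f n" if "n \<in> smooth_numbers P" for k n
  proof (rule mult)
    have "\<not> p dvd n" using that p insert.hyps by (auto simp: smooth_numbers_def prime_factors_dvd)
    then show "coprime (p ^ k) n" using p by (simp add: prime_imp_coprime)
  qed
  have sp: "summable (\<lambda>k. norm (f (p ^ k)))" using insert.prems by simp
  have hs1: "((\<lambda>k. f (p ^ k)) has_sum (\<Sum>k. f (p ^ k))) UNIV"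
    using sp by (intro norm_summable_imp_has_sum) (auto intro: summable_sums summable_norm_cancel)
  have hs2: "((\<lambda>k. norm (f (p ^ k))) has_sum (\<Sum>k. norm (f (p ^ k)))) UNIV"
    using sp by (intro norm_summable_imp_has_sum) (auto intro: summable_sums)
  have S: "(\<lambda>x. norm (f (case x of (k, n) \<Rightarrow> p ^ k * n))) summable_on (UNIV \<times> smooth_numbers P)"
  proof (rule summable_on_SigmaI)
    fix k :: nat
    have "((\<lambda>n. norm (f (p ^ k)) * norm (f n)) has_sum
            (norm (f (p ^ k)) * infsum (\<lambda>n. norm (f n)) (smooth_numbers P))) (smooth_numbers P)"
      using IH(1) by (intro has_sum_cmult_right) auto
    also have "?this \<longleftrightarrow> ((\<lambda>n. norm (f (case (k, n) of (k, n) \<Rightarrow> p ^ k * n))) has_sum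
            (norm (f (p ^ k)) * infsum (\<lambda>n. norm (f n)) (smooth_numbers P))) (smooth_numbers P)"
      by (intro has_sum_cong) (simp add: fm norm_mult)
    finally show "((\<lambda>n. norm (f (case (k, n) of (k, n) \<Rightarrow> p ^ k * n))) has_sum
            (norm (f (p ^ k)) * infsum (\<lambda>n. norm (f n)) (smooth_numbers P))) (smooth_numbers P)" .
  next
    show "(\<lambda>k. norm (f (p ^ k)) * infsum (\<lambda>n. norm (f n)) (smooth_numbers P)) summable_on UNIV"
      using has_sum_imp_summable[OF hs2] by (rule summable_on_cmult_left)
  qed auto
  have "((\<lambda>x. f (case x of (k, n) \<Rightarrow> p ^ k * n)) has_sum
      ((\<Sum>k. f (p ^ k)) * (\<Prod>p\<in>P. \<Sum>k. f (p ^ k)))) (UNIV \<times> smooth_numbers P)"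
  proof (rule has_sum_SigmaI)
    fix k :: nat
    have "((\<lambda>n. f (p ^ k) * f n) has_sum (f (p ^ k) * (\<Prod>p\<in>P. \<Sum>k. f (p ^ k)))) (smooth_numbers P)"
      using IH(2) by (intro has_sum_cmult_right)
    also have "?this \<longleftrightarrow> ((\<lambda>n. f (case (k, n) of (k, n) \<Rightarrow> p ^ k * n)) has_sum
        (f (p ^ k) * (\<Prod>p\<in>P. \<Sum>k. f (p ^ k)))) (smooth_numbers P)"
      by (intro has_sum_cong) (simp add: fm)
    finally show "((\<lambda>n. f (case (k, n) of (k, n) \<Rightarrow> p ^ k * n)) has_sum
        (f (p ^ k) * (\<Prod>p\<in>P. \<Sum>k. f (p ^ k)))) (smooth_numbers P)" .
  next
    show "((\<lambda>k. f (p ^ k) * (\<Prod>p\<in>P. \<Sum>k. f (p ^ k))) has_sum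
        ((\<Sum>k. f (p ^ k)) * (\<Prod>p\<in>P. \<Sum>k. f (p ^ k)))) UNIV"
      using hs1 by (rule has_sum_cmult_left)
    show "(\<lambda>x. f (case x of (k, n) \<Rightarrow> p ^ k * n)) summable_on (UNIV \<times> smooth_numbers P)"
      using S by (rule abs_summable_summable)
  qed
  then have "(f has_sum (\<Prod>p\<in>insert p P. \<Sum>k. f (p ^ k))) (smooth_numbers (insert p P))"
    using has_sum_reindex_bij_betw[OF bij, of f] insert.hyps by simp
  moreover have "(\<lambda>n. norm (f n)) summable_on smooth_numbers (insert p P)"
    using summable_on_reindex_bij_betw[OF bij, of "\<lambda>n. norm (f n)"] S by simp
  ultimately show ?case by simp
qed

text \<open>The sum over the numbers with all prime factors at most \<open>x\<close> is the product over \<open>p \<le> x\<close> of the local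
  sums. For the absolute values these products stay below the exponential of the sum of the local tails,
  which gives absolute convergence; the limit follows since every number up to \<open>x\<close> is such a number.\<close>

theorem euler_product:
  fixes f :: "nat \<Rightarrow> 'a :: {real_normed_field, banach}"
  assumes f1: "f 1 = 1" and mult: "\<And>m n. coprime m n \<Longrightarrow> f (m * n) = f m * f n"
    and loc: "\<And>p. prime p \<Longrightarrow> summable (\<lambda>k. norm (f (p ^ k)))"
    and sum: "summable (\<lambda>p. if prime p then (\<Sum>k. norm (f (p ^ Suc k))) else 0)"
  shows "(\<lambda>n. norm (f n)) summable_on {1..}"
    and "(\<lambda>x. \<Prod>p | prime p \<and> p \<le> x. \<Sum>k. f (p ^ k)) \<longlonglongrightarrow> infsum f {1..}"
proof -
  define Pr where "Pr = (\<lambda>x::nat. {p. prime p \<and> p \<le> x})"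
  have Pr: "finite (Pr x)" "\<forall>p\<in>Pr x. prime p" for x unfolding Pr_def by auto
  have sm: "{1..x} \<subseteq> smooth_numbers (Pr x)" for x
    by (auto simp: smooth_numbers_def Pr_def prime_factors_dvd dest!: dvd_imp_le)
  have sub: "smooth_numbers (Pr x) \<subseteq> {1..}" for x by (auto simp: smooth_numbers_def)
  define t where "t = (\<lambda>p. if prime p then (\<Sum>k. norm (f (p ^ Suc k))) else 0)"
  have t0: "t p \<ge> 0" for p
    unfolding t_def using summable_Suc_iff[THEN iffD2, OF loc] by (auto intro!: suminf_nonneg simp del: power_Suc)
  have hs: "(\<lambda>n. norm (f n)) summable_on smooth_numbers (Pr x)"
      "(f has_sum (\<Prod>p\<in>Pr x. \<Sum>k. f (p ^ k))) (smooth_numbers (Pr x))" for x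
    using multiplicative_has_sum_smooth[OF f1 mult Pr] loc Pr(2) by auto
  have hsn: "((\<lambda>n. norm (f n)) has_sum (\<Prod>p\<in>Pr x. \<Sum>k. norm (f (p ^ k)))) (smooth_numbers (Pr x))" for x
    using multiplicative_has_sum_smooth[of "\<lambda>n. norm (f n)", OF _ _ Pr] loc Pr(2) f1 mult
    by (auto simp: norm_mult)
  have bound: "(\<Prod>p\<in>Pr x. \<Sum>k. norm (f (p ^ k))) \<le> exp (suminf t)" for x
  proof -
    have "(\<Sum>k. norm (f (p ^ k))) \<le> exp (t p)" if "p \<in> Pr x" for p
    proof -
      have "prime p" using that Pr by auto
      then have "(\<Sum>k. norm (f (p ^ k))) = 1 + t p"
        using suminf_split_head[OF loc[of p]] f1 by (simp add: t_def)
      then show ?thesis by (simp add: exp_ge_add_one_self)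
    qed
    then have "(\<Prod>p\<in>Pr x. \<Sum>k. norm (f (p ^ k))) \<le> (\<Prod>p\<in>Pr x. exp (t p))"
      using loc Pr(2) by (intro prod_mono) (auto intro!: suminf_nonneg)
    also have "\<dots> = exp (\<Sum>p\<in>Pr x. t p)" by (simp add: exp_sum Pr)
    also have "(\<Sum>p\<in>Pr x. t p) \<le> suminf t"
      using sum t0 Pr by (intro sum_le_suminf) (auto simp: t_def[abs_def])
    finally show ?thesis by simp
  qed
  show summable: "(\<lambda>n. norm (f n)) summable_on {1..}"
  proof (rule nonneg_bdd_above_summable_on)
    show "bdd_above (sum (\<lambda>n. norm (f n)) ` {F. F \<subseteq> {1..} \<and> finite F})"
    proof (rule bdd_aboveI2)
      fix F :: "nat set" assume F: "F \<in> {F. F \<subseteq> {1..} \<and> finite F}"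
      obtain x where x: "F \<subseteq> {..x}" using F finite_nat_iff_bounded_le by auto
      have "F \<subseteq> smooth_numbers (Pr x)" using F x sm[of x] by (auto simp: subset_iff)
      then have "(\<Sum>n\<in>F. norm (f n)) \<le> (\<Prod>p\<in>Pr x. \<Sum>k. norm (f (p ^ k)))"
        using F by (intro finite_sum_le_has_sum[OF hsn]) auto
      also note bound
      finally show "(\<Sum>n\<in>F. norm (f n)) \<le> exp (suminf t)" .
    qed
  qed auto
  have fs: "f summable_on {1..}" using summable by (rule abs_summable_summable)
  have "(\<lambda>x. infsum f (smooth_numbers (Pr x))) \<longlonglongrightarrow> infsum f {1..}"
  proof (rule Lim_transform2[OF tendsto_const], rule Lim_null_comparison)
    have tail: "norm (infsum f {1..} - infsum f (smooth_numbers (Pr x)))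
        \<le> infsum (\<lambda>n. norm (f n)) {1..} - (\<Sum>n\<in>{1..x}. norm (f n))" for x
    proof -
      have "infsum f {1..} - infsum f (smooth_numbers (Pr x)) = infsum f ({1..} - smooth_numbers (Pr x))"
        using fs sub summable_on_subset_banach[OF fs sub] by (subst infsum_Diff) auto
      also have "norm \<dots> \<le> infsum (\<lambda>n. norm (f n)) ({1..} - smooth_numbers (Pr x))"
        by (intro norm_infsum_bound summable_on_subset_banach[OF summable]) auto
      also have "\<dots> \<le> infsum (\<lambda>n. norm (f n)) ({1..} - {1..x})"
        using sm by (intro infsum_mono2 summable_on_subset_banach[OF summable]) auto
      also have "\<dots> = infsum (\<lambda>n. norm (f n)) {1..} - (\<Sum>n\<in>{1..x}. norm (f n))"
        using summable by (subst infsum_Diff) auto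
      finally show ?thesis .
    qed
    then show "\<forall>\<^sub>F x in sequentially. norm (infsum f {1..} - infsum f (smooth_numbers (Pr x)))
        \<le> infsum (\<lambda>n. norm (f n)) {1..} - (\<Sum>n\<in>{1..x}. norm (f n))" by simp
    have "((\<lambda>n. norm (f (Suc n))) has_sum infsum (\<lambda>n. norm (f n)) {1..}) UNIV"
    proof -
      have "bij_betw Suc UNIV {1..}" by (auto simp: bij_betw_def image_iff gr0_conv_Suc Suc_le_eq)
      from has_sum_reindex_bij_betw[OF this, of "\<lambda>n. norm (f n)"] show ?thesis using summable by simp
    qed
    then have "(\<lambda>n. norm (f (Suc n))) sums infsum (\<lambda>n. norm (f n)) {1..}" by (rule has_sum_imp_sums)
    then have "(\<lambda>x. \<Sum>n<x. norm (f (Suc n))) \<longlonglongrightarrow> infsum (\<lambda>n. norm (f n)) {1..}" by (simp add: sums_def)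
    moreover have "(\<Sum>n<x. norm (f (Suc n))) = (\<Sum>n\<in>{1..x}. norm (f n))" for x
      by (rule sum.reindex_bij_witness[of _ "\<lambda>n. n - 1" Suc]) auto
    ultimately have "(\<lambda>x. \<Sum>n\<in>{1..x}. norm (f n)) \<longlonglongrightarrow> infsum (\<lambda>n. norm (f n)) {1..}" by simp
    from tendsto_diff[OF tendsto_const this, of "infsum (\<lambda>n. norm (f n)) {1..}"]
    show "(\<lambda>x. infsum (\<lambda>n. norm (f n)) {1..} - (\<Sum>n\<in>{1..x}. norm (f n))) \<longlonglongrightarrow> 0" by simp
  qed
  then show "(\<lambda>x. \<Prod>p | prime p \<and> p \<le> x. \<Sum>k. f (p ^ k)) \<longlonglongrightarrow> infsum f {1..}"
    using hs(2)[THEN infsumI] by (simp add: Pr_def)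
qed

lemma infsum_nat_from_1:
  fixes f :: "nat \<Rightarrow> 'a :: {real_normed_field, banach}"
  assumes "(\<lambda>n. norm (f n)) summable_on {1..}"
  shows "(\<lambda>n. f (Suc n)) sums infsum f {1..}"
proof -
  have "bij_betw Suc UNIV {1..}" by (auto simp: bij_betw_def image_iff gr0_conv_Suc Suc_le_eq)
  from has_sum_reindex_bij_betw[OF this, of f] show ?thesis
    using abs_summable_summable[OF assms] by (intro has_sum_imp_sums) simp
qed

lemma prime_geometric:
  fixes x :: "'a :: {real_normed_field, banach}"
  assumes "norm x < 1"
  shows "summable (\<lambda>k. norm (x ^ k))" and "(\<Sum>k. norm (x ^ Suc k)) = norm x / (1 - norm x)"
proof -
  show "summable (\<lambda>k. norm (x ^ k))" using assms by (simp add: norm_power summable_geometric)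
  have "(\<lambda>k. norm x * norm x ^ k) sums (norm x * (1 / (1 - norm x)))"
    using assms by (intro sums_mult geometric_sums) simp
  then show "(\<Sum>k. norm (x ^ Suc k)) = norm x / (1 - norm x)"
    by (simp add: norm_power norm_mult sums_iff)
qed

text \<open>Otherwise the Euler product for \<open>1 / n\<close> would make the harmonic series converge.\<close>

theorem prime_reciprocals_diverge: "\<not> summable (\<lambda>p::nat. if prime p then 1 / real p else 0)"
proof
  assume sum: "summable (\<lambda>p::nat. if prime p then 1 / real p else 0)"
  define f where "f = (\<lambda>n. 1 / real n)"
  have "(\<lambda>n. norm (f n)) summable_on {1..}"
  proof (rule euler_product)
    fix p :: nat assume p: "prime p"
    have "summable (\<lambda>k. norm ((1 / real p) ^ k))"
      using prime_gt_1_nat[OF p] by (intro prime_geometric) simp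
    then show "summable (\<lambda>k. norm (f (p ^ k)))" by (simp add: f_def power_one_over)
  next
    show "summable (\<lambda>p. if prime p then \<Sum>k. norm (f (p ^ Suc k)) else 0)"
    proof (rule summable_comparison_test')
      show "summable (\<lambda>p::nat. 2 * (if prime p then 1 / real p else 0))" using sum by (rule summable_mult)
      fix p :: nat
      show "norm (if prime p then \<Sum>k. norm (f (p ^ Suc k)) else 0) \<le> 2 * (if prime p then 1 / real p else 0)"
      proof (cases "prime p")
        case True
        then have p2: "real p \<ge> 2" using prime_ge_2_nat[of p] by simp
        have "(\<Sum>k. norm (f (p ^ Suc k))) = (\<Sum>k. norm ((1 / real p) ^ Suc k))"
          by (simp add: f_def power_one_over)
        also have "\<dots> = (1 / real p) / (1 - 1 / real p)"
          using p2 by (subst prime_geometric) auto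
        also have "\<dots> \<le> 2 * (1 / real p)" using p2 by (simp add: field_simps)
        finally have "(\<Sum>k. norm (f (p ^ Suc k))) \<le> 2 * (1 / real p)" .
        moreover have "(\<Sum>k. norm (f (p ^ Suc k))) \<ge> 0"
          using \<open>(\<Sum>k. norm (f (p ^ Suc k))) = (\<Sum>k. norm ((1 / real p) ^ Suc k))\<close>
            \<open>(\<Sum>k. norm ((1 / real p) ^ Suc k)) = (1 / real p) / (1 - 1 / real p)\<close> p2 by simp
        ultimately show ?thesis using True by simp
      qed simp
    qed
  qed (simp_all add: f_def)
  then have "(\<lambda>n. f (Suc n)) sums infsum f {1..}" by (rule infsum_nat_from_1)
  then have "summable (\<lambda>n. inverse (real (Suc n)))" by (auto simp: sums_iff f_def inverse_eq_divide)
  then show False using not_summable_harmonic summable_Suc_iff[of "\<lambda>n. inverse (real n)"] by blast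
qed

text \<open>The limit is nonzero because the products of the \<open>1 - p powr (- s)\<close> are bounded by the exponential of the
  sum of the \<open>p powr (- Re s)\<close>.\<close>

lemma zeta_euler_product:
  assumes s: "Re s > 1"
  shows "zeta s \<noteq> 0"
    and "(\<lambda>x. \<Prod>p | prime p \<and> p \<le> x. 1 - of_nat p powr (- s)) \<longlonglongrightarrow> 1 / zeta s"
proof -
  define f :: "nat \<Rightarrow> complex" where "f = (\<lambda>n. of_nat n powr (- s))"
  define a where "a = Re s"
  have nf: "norm (f n) = real n powr (- a)" if "n > 0" for n
    using that unfolding f_def by (subst norm_nat_powr) (auto simp: a_def)
  have mult: "f (m * n) = f m * f n" for m n
    by (simp add: f_def powr_times_real)
  have f1: "f 1 = 1" by (simp add: f_def)
  have pow: "f (p ^ k) = f p ^ k" for p k by (induction k) (simp_all add: mult f1[simplified])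
  have small: "norm (f p) \<le> 1 / 2" if "prime p" for p
  proof -
    have p2: "real p \<ge> 2" using prime_ge_2_nat[OF that] by simp
    have "norm (f p) = real p powr (- a)" using that by (intro nf prime_gt_0_nat)
    also have "\<dots> \<le> real p powr (-1)" using p2 s by (intro powr_mono) (auto simp: a_def)
    also have "\<dots> \<le> 1 / 2" using p2 by (simp add: powr_minus_divide)
    finally show ?thesis .
  qed
  have sum_primes: "summable (\<lambda>p. if prime p then norm (f p) else 0)"
  proof (rule summable_comparison_test')
    show "summable (\<lambda>n. real n powr (- a))" using s by (simp add: summable_real_powr_iff a_def)
    show "norm (if prime n then norm (f n) else 0) \<le> real n powr (- a)" for n
      using nf[of n] by (auto simp: prime_gt_0_nat)
  qed
  have loc: "summable (\<lambda>k. norm (f (p ^ k)))" if "prime p" for p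
    unfolding pow using small[OF that] by (intro prime_geometric) simp
  have sum: "summable (\<lambda>p. if prime p then \<Sum>k. norm (f (p ^ Suc k)) else 0)"
  proof (rule summable_comparison_test')
    show "summable (\<lambda>p. 2 * (if prime p then norm (f p) else 0))" using sum_primes by (rule summable_mult)
    fix p
    have "\<bar>\<Sum>k. norm (f (p ^ Suc k))\<bar> \<le> 2 * norm (f p)" if "prime p"
    proof -
      have E: "(\<Sum>k. norm (f (p ^ Suc k))) = norm (f p) / (1 - norm (f p))"
        unfolding pow using small[OF that] by (intro prime_geometric) simp
      have "norm (f p) / (1 - norm (f p)) \<le> 2 * norm (f p)"
        using small[OF that] divide_left_mono[of "1 / 2" "1 - norm (f p)" "norm (f p)"] by simp
      moreover have "norm (f p) / (1 - norm (f p)) \<ge> 0" using small[OF that] by simp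
      ultimately show ?thesis unfolding E by (simp only: abs_of_nonneg)
    qed
    then show "norm (if prime p then \<Sum>k. norm (f (p ^ Suc k)) else 0) \<le> 2 * (if prime p then norm (f p) else 0)"
      by simp
  qed
  note ep = euler_product[of f, OF f1 mult loc sum]
  have "(\<lambda>n. f (Suc n)) sums infsum f {1..}" by (rule infsum_nat_from_1[OF ep(1)])
  then have "infsum f {1..} = zeta s"
    using zeta_sums[OF s] sums_unique2 by (fastforce simp: f_def)
  then have lim: "(\<lambda>x. \<Prod>p | prime p \<and> p \<le> x. \<Sum>k. f (p ^ k)) \<longlonglongrightarrow> zeta s" using ep(2) by simp
  have geo: "(\<Sum>k. f (p ^ k)) = inverse (1 - f p)" if "prime p" for p
    unfolding pow using small[OF that] by (subst suminf_geometric) (auto simp: inverse_eq_divide)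
  have "(\<Prod>p | prime p \<and> p \<le> x. \<Sum>k. f (p ^ k)) = inverse (\<Prod>p | prime p \<and> p \<le> x. 1 - f p)" for x
    unfolding prod_inversef[symmetric] by (intro prod.cong) (auto simp: geo)
  then have lim2: "(\<lambda>x. inverse (\<Prod>p | prime p \<and> p \<le> x. 1 - f p)) \<longlonglongrightarrow> zeta s" using lim by simp
  define S where "S = suminf (\<lambda>p. if prime p then norm (f p) else 0)"
  have ub: "norm (\<Prod>p | prime p \<and> p \<le> x. 1 - f p) \<le> exp S" for x
  proof -
    have "norm (\<Prod>p | prime p \<and> p \<le> x. 1 - f p) \<le> (\<Prod>p | prime p \<and> p \<le> x. exp (norm (f p)))"
      unfolding prod_norm[symmetric]
    proof (intro prod_mono conjI)
      fix p
      have "norm (1 - f p) \<le> 1 + norm (f p)" using norm_triangle_ineq4[of 1 "f p"] by simp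
      also have "\<dots> \<le> exp (norm (f p))" by (rule exp_ge_add_one_self)
      finally show "norm (1 - f p) \<le> exp (norm (f p))" .
    qed simp
    also have "\<dots> = exp (\<Sum>p | prime p \<and> p \<le> x. norm (f p))" by (simp add: exp_sum)
    also have "(\<Sum>p | prime p \<and> p \<le> x. norm (f p)) = (\<Sum>p | prime p \<and> p \<le> x. if prime p then norm (f p) else 0)"
      by (intro sum.cong) auto
    also have "\<dots> \<le> S" unfolding S_def using sum_primes by (intro sum_le_suminf) auto
    finally show ?thesis by simp
  qed
  have nz: "1 - f p \<noteq> 0" if "prime p" for p using small[OF that] by auto
  have "exp (- S) \<le> norm (inverse (\<Prod>p | prime p \<and> p \<le> x. 1 - f p))" for x
  proof -
    have "(\<Prod>p | prime p \<and> p \<le> x. 1 - f p) \<noteq> 0" using nz by simp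
    then show ?thesis using ub[of x] by (simp add: norm_inverse exp_minus le_imp_inverse_le)
  qed
  then have "exp (- S) \<le> norm (zeta s)"
    by (intro tendsto_lowerbound[OF tendsto_norm[OF lim2]]) auto
  then show nz': "zeta s \<noteq> 0" using exp_gt_zero[of "- S"] by (metis norm_zero not_le)
  show "(\<lambda>x. \<Prod>p | prime p \<and> p \<le> x. 1 - of_nat p powr (- s)) \<longlonglongrightarrow> 1 / zeta s"
    using tendsto_inverse[OF lim2 nz'] by (simp add: f_def inverse_eq_divide)
qed

section \<open>MacMahon's polynomials\<close>

text \<open>The coefficients in \<open>x\<close> of MacMahon's polynomial, the numerator of the generating function of
  \<open>gauss_prod q js\<close>. Multiplying the \<open>k\<close>-th coefficient of \<open>G(x) = P(x) / (\<Prod>i\<le>M. 1 - q ^ i x)\<close> by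
  \<open>(1 - q ^ (k + j)) / (1 - q ^ j)\<close> turns \<open>G(x)\<close> into \<open>(G(x) - q ^ j G(q x)) / (1 - q ^ j)\<close>, and the recursion
  is the resulting rule for the numerator. For the entries \<open>r, \<dots>, 1\<close> of each part \<open>r\<close> of a partition
  this is the polynomial that enumerates multiset permutations by descents and major index.\<close>

primrec macmahon_coeff :: "real \<Rightarrow> nat list \<Rightarrow> nat \<Rightarrow> real" where
  "macmahon_coeff q [] = (\<lambda>k. if k = 0 then 1 else 0)"
| "macmahon_coeff q (j # js) = (\<lambda>k. case k of 0 \<Rightarrow> 1 | Suc k \<Rightarrow>
     ((1 - q ^ (j + Suc k)) * macmahon_coeff q js (Suc k)
       - (q ^ Suc (length js) - q ^ (j + k)) * macmahon_coeff q js k) / (1 - q ^ j))"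

text \<open>The block \<open>r, \<dots>, 1\<close> contributes the Gaussian binomial coefficient of \<open>k + r\<close> over \<open>r\<close>.\<close>

definition gauss_prod :: "real \<Rightarrow> nat list \<Rightarrow> nat \<Rightarrow> real" where
  "gauss_prod q js k = (\<Prod>j\<leftarrow>js. (1 - q ^ (k + j)) / (1 - q ^ j))"

lemma gauss_prod_simps [simp]:
  "gauss_prod q [] k = 1"
  "gauss_prod q (j # js) k = (1 - q ^ (k + j)) / (1 - q ^ j) * gauss_prod q js k"
  by (simp_all add: gauss_prod_def)

lemma gauss_prod_append: "gauss_prod q (xs @ ys) k = gauss_prod q xs k * gauss_prod q ys k"
  by (simp add: gauss_prod_def)

lemma macmahon_coeff_0 [simp]: "macmahon_coeff q js 0 = 1"
  by (cases js) simp_all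

lemma macmahon_coeff_degree: "length js < k \<Longrightarrow> macmahon_coeff q js k = 0"
  by (induction js arbitrary: k) (auto split: nat.split)

lemma gauss_prod_sums:
  fixes t :: complex
  assumes q: "q > 1" and "\<forall>j\<in>set js. j \<ge> 1" and "norm t * q ^ length js < 1"
  shows "(\<lambda>k. of_real (gauss_prod q js k) * t ^ k) sums
     ((\<Sum>k\<le>length js. of_real (macmahon_coeff q js k) * t ^ k) / (\<Prod>i\<le>length js. 1 - of_real q ^ i * t))"
  using assms(2,3)
proof (induction js arbitrary: t)
  case Nil
  then show ?case using geometric_sums[of t] by simp
next
  case (Cons j js)
  define M where "M = length js"
  define Q :: complex where "Q = of_real q"
  define c where "c = (\<lambda>k. complex_of_real (macmahon_coeff q js k))"
  define c' where "c' = (\<lambda>k. complex_of_real (macmahon_coeff q (j # js) k))"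
  define P where "P = (\<lambda>t. \<Sum>k\<le>M. c k * t ^ k)"
  define D where "D = (\<lambda>t. \<Prod>i\<le>M. 1 - Q ^ i * t)"
  have j: "j \<ge> 1" "\<forall>j\<in>set js. j \<ge> 1" using Cons.prems by auto
  have qj: "q ^ j > 1" using q j by (simp add: one_less_power)
  have Qj: "1 - Q ^ j \<noteq> 0" using qj by (metis Q_def eq_iff_diff_eq_0 of_real_eq_1_iff of_real_power less_irrefl)
  have small: "norm (Q ^ i * t) < 1" if "i \<le> Suc M" for i
  proof -
    have "norm (Q ^ i * t) = q ^ i * norm t" using q by (simp add: Q_def norm_mult norm_power)
    also have "\<dots> \<le> q ^ Suc M * norm t" using q that by (intro mult_right_mono power_increasing) auto
    also have "\<dots> < 1" using Cons.prems by (simp add: M_def mult.commute)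
    finally show ?thesis .
  qed
  have nz: "1 - Q ^ i * t \<noteq> 0" if "i \<le> Suc M" for i using small[OF that] by auto
  have 1: "(\<lambda>k. of_real (gauss_prod q js k) * t ^ k) sums (P t / D t)"
    unfolding P_def D_def c_def Q_def M_def
    by (rule Cons.IH) (use small[of M] j q in \<open>auto simp: M_def Q_def norm_mult norm_power mult.commute\<close>)
  have 2: "(\<lambda>k. of_real (gauss_prod q js k) * (Q * t) ^ k) sums (P (Q * t) / D (Q * t))"
    unfolding P_def D_def c_def Q_def M_def
    by (rule Cons.IH) (use small[of "Suc M"] j q in \<open>auto simp: M_def Q_def norm_mult norm_power mult_ac\<close>)
  have S1: "(\<lambda>k. (of_real (gauss_prod q js k) * t ^ k - Q ^ j * (of_real (gauss_prod q js k) * (Q * t) ^ k)) / (1 - Q ^ j))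
     sums ((P t / D t - Q ^ j * (P (Q * t) / D (Q * t))) / (1 - Q ^ j))"
    by (intro sums_divide sums_diff sums_mult 1 2)
  have S2: "(of_real (gauss_prod q js k) * t ^ k - Q ^ j * (of_real (gauss_prod q js k) * (Q * t) ^ k)) / (1 - Q ^ j)
     = of_real (gauss_prod q (j # js) k) * t ^ k" for k
    using Qj by (simp add: Q_def power_mult_distrib power_add field_simps)
  have S3: "(P t / D t - Q ^ j * (P (Q * t) / D (Q * t))) / (1 - Q ^ j)
      = (\<Sum>k\<le>Suc M. c' k * t ^ k) / (\<Prod>i\<le>Suc M. 1 - Q ^ i * t)"
  proof -
    define E where "E = (\<Prod>i\<le>Suc M. 1 - Q ^ i * t)"
    have E1: "E = D t * (1 - Q ^ Suc M * t)" by (simp add: E_def D_def)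
    have E2: "E = (1 - t) * D (Q * t)"
      unfolding E_def D_def by (subst prod.atMost_Suc_shift) (simp add: mult_ac)
    have E: "E \<noteq> 0" unfolding E_def using nz by (subst prod_zero_iff) auto
    have "(1 - Q ^ Suc M * t) * P t - Q ^ j * (1 - t) * P (Q * t) = (1 - Q ^ j) * (\<Sum>k\<le>Suc M. c' k * t ^ k)"
    proof -
      have cM: "c (Suc M) = 0" by (simp add: c_def M_def macmahon_coeff_degree)
      have c0: "c 0 = 1" "c' 0 = 1" by (simp_all add: c_def c'_def)
      have cS: "(1 - Q ^ j) * c' (Suc k) = (1 - Q ^ (j + Suc k)) * c (Suc k) - (Q ^ Suc M - Q ^ (j + k)) * c k" for k
        using Qj by (simp add: c'_def c_def Q_def M_def)
      have ext: "(\<Sum>k\<le>M. c k * x ^ k) = c 0 + (\<Sum>k\<le>M. c (Suc k) * x ^ Suc k)" for x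
      proof -
        have "(\<Sum>k\<le>M. c k * x ^ k) = (\<Sum>k\<le>Suc M. c k * x ^ k)" by (simp add: cM)
        also have "\<dots> = c 0 + (\<Sum>k\<le>M. c (Suc k) * x ^ Suc k)" by (subst sum.atMost_Suc_shift) simp
        finally show ?thesis .
      qed
      have "(1 - Q ^ j) * (\<Sum>k\<le>Suc M. c' k * t ^ k)
          = (1 - Q ^ j) + (\<Sum>k\<le>M. ((1 - Q ^ j) * c' (Suc k)) * t ^ Suc k)"
        by (subst sum.atMost_Suc_shift) (simp add: c0 algebra_simps sum_distrib_left)
      also have "(\<Sum>k\<le>M. ((1 - Q ^ j) * c' (Suc k)) * t ^ Suc k)
          = (\<Sum>k\<le>M. c (Suc k) * t ^ Suc k) - Q ^ j * (\<Sum>k\<le>M. c (Suc k) * (Q * t) ^ Suc k)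
            - Q ^ Suc M * t * (\<Sum>k\<le>M. c k * t ^ k) + Q ^ j * t * (\<Sum>k\<le>M. c k * (Q * t) ^ k)"
        unfolding cS sum_distrib_left sum_subtractf[symmetric] sum.distrib[symmetric]
        by (intro sum.cong refl) (simp add: power_add power_mult_distrib algebra_simps)
      also have "(\<Sum>k\<le>M. c (Suc k) * t ^ Suc k) = P t - 1" using ext[of t] by (simp add: P_def c0)
      also have "(\<Sum>k\<le>M. c (Suc k) * (Q * t) ^ Suc k) = P (Q * t) - 1" using ext[of "Q * t"] by (simp add: P_def c0)
      also have "(\<Sum>k\<le>M. c k * t ^ k) = P t" by (simp add: P_def)
      also have "(\<Sum>k\<le>M. c k * (Q * t) ^ k) = P (Q * t)" by (simp add: P_def)
      finally show ?thesis by (simp add: algebra_simps)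
    qed
    note num = this
    have "D t \<noteq> 0" using E E1 by auto
    have "D (Q * t) \<noteq> 0" using E E2 by auto
    have quot1: "P t / D t * E = (1 - Q ^ Suc M * t) * P t"
      unfolding E1 using \<open>D t \<noteq> 0\<close> by (simp del: power_Suc)
    have quot2: "P (Q * t) / D (Q * t) * E = (1 - t) * P (Q * t)"
      unfolding E2 using \<open>D (Q * t) \<noteq> 0\<close> by simp
    have "(P t / D t - Q ^ j * (P (Q * t) / D (Q * t))) * E = P t / D t * E - Q ^ j * (P (Q * t) / D (Q * t) * E)"
      by (simp only: left_diff_distrib mult.assoc)
    also have "\<dots> = (1 - Q ^ Suc M * t) * P t - Q ^ j * (1 - t) * P (Q * t)"
      by (simp only: quot1 quot2 mult.assoc)
    also note num
    finally have "(P t / D t - Q ^ j * (P (Q * t) / D (Q * t))) * E = (\<Sum>k\<le>Suc M. c' k * t ^ k) * (1 - Q ^ j)"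
      by (simp only: mult.commute)
    then show ?thesis unfolding E_def[symmetric] by (rule iffD2[OF frac_eq_eq[OF Qj E]])
  qed
  show ?case using S1 unfolding S2 S3 unfolding c'_def M_def Q_def length_Cons .
qed

text \<open>The growth of one step of the recursion. The quotient by \<open>q ^ j - 1 \<ge> q ^ j / 2\<close> absorbs the factor
  \<open>q ^ j\<close>.\<close>

lemma macmahon_step_bound:
  assumes q: "q \<ge> 2" and j: "j \<ge> 1" and k: "k \<le> m" "k \<le> length js \<or> macmahon_coeff q js k = 0"
    and m: "Suc (length js) \<le> j + m"
  shows "\<bar>macmahon_coeff q (j # js) (Suc k)\<bar>
     \<le> 2 * q ^ Suc k * \<bar>macmahon_coeff q js (Suc k)\<bar> + 4 * q ^ m * \<bar>macmahon_coeff q js k\<bar>"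
proof -
  have q1: "q \<ge> 1" "q > 0" using q by auto
  have qj: "q ^ j \<ge> 2" using q j power_increasing[of 1 j q] by simp
  have inv: "1 / \<bar>1 - q ^ j\<bar> \<le> 2 / q ^ j"
    using qj by (simp add: field_simps abs_if)
  have A: "\<bar>1 - q ^ (j + Suc k)\<bar> \<le> q ^ j * q ^ Suc k"
  proof -
    have "\<bar>1 - x\<bar> \<le> x" if "x \<ge> 1" for x :: real using that by linarith
    from this[OF one_le_power[OF q1(1), of "j + Suc k"]] show ?thesis by (simp only: power_add)
  qed
  have B: "\<bar>q ^ Suc (length js) - q ^ (j + k)\<bar> \<le> q ^ j * (2 * q ^ m)"
  proof -
    have "q ^ Suc (length js) \<le> q ^ (j + m)" "q ^ (j + k) \<le> q ^ (j + m)"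
      using m k q1 by (intro power_increasing; simp)+
    moreover have "0 \<le> q ^ Suc (length js)" "0 \<le> q ^ (j + k)" using q1 by simp_all
    ultimately show ?thesis by (simp add: power_add abs_if)
  qed
  have "\<bar>macmahon_coeff q (j # js) (Suc k)\<bar> =
     \<bar>(1 - q ^ (j + Suc k)) * macmahon_coeff q js (Suc k)
       - (q ^ Suc (length js) - q ^ (j + k)) * macmahon_coeff q js k\<bar> * (1 / \<bar>1 - q ^ j\<bar>)"
    by (simp add: abs_divide)
  also have "\<dots> \<le> (\<bar>1 - q ^ (j + Suc k)\<bar> * \<bar>macmahon_coeff q js (Suc k)\<bar>
       + \<bar>q ^ Suc (length js) - q ^ (j + k)\<bar> * \<bar>macmahon_coeff q js k\<bar>) * (2 / q ^ j)"
    using inv by (intro mult_mono) (auto simp: abs_mult[symmetric] intro: abs_triangle_ineq4)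
  also have "\<dots> \<le> (q ^ j * q ^ Suc k * \<bar>macmahon_coeff q js (Suc k)\<bar>
       + q ^ j * (2 * q ^ m) * \<bar>macmahon_coeff q js k\<bar>) * (2 / q ^ j)"
    using A B q1 by (intro mult_right_mono add_mono) auto
  also have "\<dots> = 2 * q ^ Suc k * \<bar>macmahon_coeff q js (Suc k)\<bar> + 4 * q ^ m * \<bar>macmahon_coeff q js k\<bar>"
    using q1 by (simp add: field_simps)
  finally show ?thesis .
qed

fun triangle :: "nat \<Rightarrow> nat" where
  "triangle 0 = 0" | "triangle (Suc k) = triangle k + Suc k"

text \<open>The major index of a word of length \<open>n\<close> with \<open>k\<close> descents is at most
  \<open>(n - 1) + \<dots> + (n - k) = n k - k (k + 1) / 2\<close>, and this is the degree in \<open>q\<close> that the recursion preserves.\<close>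

lemma macmahon_coeff_bound:
  assumes "\<forall>j\<in>set js. j \<ge> 1"
  shows "\<exists>C\<ge>1. \<forall>q\<ge>2. \<forall>k. \<bar>macmahon_coeff q js k\<bar> * q ^ triangle k \<le> C * q ^ (length js * k)"
  using assms
proof (induction js)
  case Nil
  show ?case by (intro exI[of _ 1]) auto
next
  case (Cons j js)
  then obtain C where C: "C \<ge> 1" "\<And>q k. q \<ge> 2 \<Longrightarrow> \<bar>macmahon_coeff q js k\<bar> * q ^ triangle k \<le> C * q ^ (length js * k)"
    by auto
  define M where "M = length js"
  have "\<bar>macmahon_coeff q (j # js) k\<bar> * q ^ triangle k \<le> 6 * C * q ^ (length (j # js) * k)" if q: "q \<ge> 2" for q k
  proof (cases k)
    case 0
    then show ?thesis using C(1) by simp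
  next
    case (Suc k')
    show ?thesis
    proof (cases "k' \<le> M")
      case True
      have "\<bar>macmahon_coeff q (j # js) (Suc k')\<bar>
        \<le> 2 * q ^ Suc k' * \<bar>macmahon_coeff q js (Suc k')\<bar> + 4 * q ^ M * \<bar>macmahon_coeff q js k'\<bar>"
        using True Cons.prems q by (intro macmahon_step_bound) (auto simp: M_def)
      then have "\<bar>macmahon_coeff q (j # js) (Suc k')\<bar> * q ^ triangle (Suc k')
        \<le> (2 * q ^ Suc k' * \<bar>macmahon_coeff q js (Suc k')\<bar> + 4 * q ^ M * \<bar>macmahon_coeff q js k'\<bar>) * q ^ triangle (Suc k')"
        using q by (intro mult_right_mono) auto
      also have "\<dots> = 2 * q ^ Suc k' * (\<bar>macmahon_coeff q js (Suc k')\<bar> * q ^ triangle (Suc k'))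
          + 4 * q ^ (M + Suc k') * (\<bar>macmahon_coeff q js k'\<bar> * q ^ triangle k')"
        by (simp add: algebra_simps power_add)
      also have "\<dots> \<le> 2 * q ^ Suc k' * (C * q ^ (M * Suc k')) + 4 * q ^ (M + Suc k') * (C * q ^ (M * k'))"
        using C(2)[OF q, of "Suc k'"] C(2)[OF q, of k'] q unfolding M_def
        by (intro add_mono mult_left_mono) auto
      also have "\<dots> = 6 * C * q ^ (length (j # js) * Suc k')"
        by (simp add: M_def power_add algebra_simps)
      finally show ?thesis using Suc by simp
    next
      case False
      then show ?thesis using Suc C(1) q
        by (simp add: macmahon_coeff_degree[of js k'] macmahon_coeff_degree[of js "Suc k'"] M_def)
    qed
  qed
  then show ?case using C(1) by (intro exI[of _ "6 * C"]) auto
qed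

text \<open>A word in a single letter has no descents.\<close>

lemma macmahon_coeff_block: "macmahon_coeff q (rev [1..<Suc r]) k = (if k = 0 then 1 else 0)"
proof (induction r arbitrary: k)
  case (Suc r)
  have "rev [1..<Suc (Suc r)] = Suc r # rev [1..<Suc r]" by simp
  then show ?case using Suc by (auto split: nat.split simp del: upt_Suc)
qed simp

text \<open>A word in two letters has at most as many descents as occurrences of either letter.\<close>

lemma macmahon_coeff_two_blocks_degree:
  "b < k \<Longrightarrow> macmahon_coeff q (rev [1..<Suc b] @ rev [1..<Suc a]) k = 0"
proof (induction b arbitrary: k)
  case 0
  then show ?case by (simp add: macmahon_coeff_block[unfolded One_nat_def] del: upt_Suc)
next
  case (Suc b)
  have "rev [1..<Suc (Suc b)] = Suc b # rev [1..<Suc b]" by simp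
  then show ?case using Suc by (auto split: nat.split simp del: upt_Suc)
qed

text \<open>In a word in two letters no two descents are adjacent, so the major index is at most
  \<open>(n - 1) + (n - 3) + \<dots> = n k - k\<^sup>2\<close>.\<close>

lemma macmahon_coeff_two_blocks_bound:
  assumes "b \<le> a"
  shows "\<exists>C\<ge>1. \<forall>q\<ge>2. \<forall>k. \<bar>macmahon_coeff q (rev [1..<Suc b] @ rev [1..<Suc a]) k\<bar> * q ^ (k * k) \<le> C * q ^ ((b + a) * k)"
  using assms
proof (induction b)
  case 0
  show ?case by (intro exI[of _ 1]) (auto simp: macmahon_coeff_block[unfolded One_nat_def] simp del: upt_Suc)
next
  case (Suc b)
  define js where "js = rev [1..<Suc b] @ rev [1..<Suc a]"
  have js: "rev [1..<Suc (Suc b)] @ rev [1..<Suc a] = Suc b # js" by (simp add: js_def)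
  have len: "length js = b + a" by (simp add: js_def)
  obtain C where C: "C \<ge> 1" "\<And>q k. q \<ge> 2 \<Longrightarrow> \<bar>macmahon_coeff q js k\<bar> * q ^ (k * k) \<le> C * q ^ ((b + a) * k)"
    using Suc unfolding js_def by auto
  have "\<bar>macmahon_coeff q (Suc b # js) k\<bar> * q ^ (k * k) \<le> 6 * C * q ^ ((Suc b + a) * k)" if q: "q \<ge> 2" for q k
  proof (cases k)
    case 0
    then show ?thesis using C(1) by simp
  next
    case (Suc k')
    show ?thesis
    proof (cases "k' \<le> b")
      case True
      have "\<bar>macmahon_coeff q (Suc b # js) (Suc k')\<bar>
        \<le> 2 * q ^ Suc k' * \<bar>macmahon_coeff q js (Suc k')\<bar> + 4 * q ^ a * \<bar>macmahon_coeff q js k'\<bar>"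
        using True \<open>Suc b \<le> a\<close> q by (intro macmahon_step_bound) (auto simp: len)
      then have "\<bar>macmahon_coeff q (Suc b # js) (Suc k')\<bar> * q ^ (Suc k' * Suc k')
        \<le> (2 * q ^ Suc k' * \<bar>macmahon_coeff q js (Suc k')\<bar> + 4 * q ^ a * \<bar>macmahon_coeff q js k'\<bar>) * q ^ (Suc k' * Suc k')"
        using q by (intro mult_right_mono) auto
      also have "\<dots> = 2 * q ^ Suc k' * (\<bar>macmahon_coeff q js (Suc k')\<bar> * q ^ (Suc k' * Suc k'))
          + 4 * q ^ (a + 2 * k' + 1) * (\<bar>macmahon_coeff q js k'\<bar> * q ^ (k' * k'))"
      proof -
        have ring: "(2 * p * x + 4 * r * y) * w = 2 * p * (x * w) + 4 * e * (y * v)" if "r * w = e * v"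
          for p x r y w e v :: real using that by (simp add: algebra_simps)
        have "a + Suc k' * Suc k' = a + 2 * k' + 1 + k' * k'" by simp
        then have "q ^ a * q ^ (Suc k' * Suc k') = q ^ (a + 2 * k' + 1) * q ^ (k' * k')"
          by (simp only: power_add[symmetric])
        then show ?thesis by (rule ring)
      qed
      also have "\<dots> \<le> 2 * q ^ Suc k' * (C * q ^ ((b + a) * Suc k')) + 4 * q ^ (a + 2 * k' + 1) * (C * q ^ ((b + a) * k'))"
        using C(2)[OF q, of "Suc k'"] C(2)[OF q, of k'] q by (intro add_mono mult_left_mono) auto
      also have "4 * q ^ (a + 2 * k' + 1) * (C * q ^ ((b + a) * k')) = 4 * C * q ^ (a + 2 * k' + 1 + (b + a) * k')"
        by (simp add: power_add)
      also have "\<dots> \<le> 4 * C * q ^ ((Suc b + a) * Suc k')"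
      proof (intro mult_left_mono power_increasing)
        show "a + 2 * k' + 1 + (b + a) * k' \<le> (Suc b + a) * Suc k'" using True by simp
      qed (use q C(1) in auto)
      also have "2 * q ^ Suc k' * (C * q ^ ((b + a) * Suc k')) = 2 * C * q ^ ((Suc b + a) * Suc k')"
      proof -
        have "(Suc b + a) * Suc k' = Suc k' + (b + a) * Suc k'" by simp
        then have "q ^ ((Suc b + a) * Suc k') = q ^ Suc k' * q ^ ((b + a) * Suc k')" by (simp only: power_add[symmetric])
        then show ?thesis by (simp only: mult_ac)
      qed
      finally show ?thesis using Suc by simp
    next
      case False
      have Z: "macmahon_coeff q (Suc b # js) (Suc k') = 0"
        unfolding js[symmetric] using False by (intro macmahon_coeff_two_blocks_degree) simp
      show ?thesis unfolding Suc Z using C(1) q by simp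
    qed
  qed
  then show ?case unfolding js using C(1) by (intro exI[of _ "6 * C"]) auto
qed

text \<open>The coefficient of \<open>x\<close> in the product of the generating function with its denominator.\<close>

lemma macmahon_coeff_1:
  assumes "q > 1" "\<forall>j\<in>set js. j \<ge> 1"
  shows "macmahon_coeff q js 1 = gauss_prod q js 1 - (\<Sum>i\<le>length js. q ^ i)"
  using assms(2)
proof (induction js)
  case (Cons j js)
  define S where "S = (\<lambda>n. \<Sum>i\<le>n. q ^ i)"
  have S: "S n = (1 - q ^ Suc n) / (1 - q)" for n
    unfolding S_def using assms(1) sum_gp0[of q n] by simp
  have "q ^ j > 1" using assms(1) Cons.prems by (intro one_less_power) auto
  then have qj: "1 - q ^ j \<noteq> 0" "1 - q \<noteq> 0" using assms(1) by auto
  have IH: "macmahon_coeff q js (Suc 0) = gauss_prod q js (Suc 0) - S (length js)" using Cons by (simp add: S_def)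
  have "macmahon_coeff q (j # js) 1 = ((1 - q ^ Suc j) * (gauss_prod q js 1 - S (length js)) - (q ^ Suc (length js) - q ^ j)) / (1 - q ^ j)"
    by (simp add: IH)
  also have "\<dots> = gauss_prod q (j # js) 1 - ((1 - q ^ Suc j) * S (length js) + q ^ Suc (length js) - q ^ j) / (1 - q ^ j)"
    by (simp add: diff_divide_distrib add_divide_distrib algebra_simps)
  also have "((1 - q ^ Suc j) * S (length js) + q ^ Suc (length js) - q ^ j) / (1 - q ^ j) = S (Suc (length js))"
    unfolding S using qj by (simp add: divide_simps) (simp add: algebra_simps)
  finally show ?case by (simp add: S_def)
qed simp

lemma gauss_prod_block: 
  assumes "q > 1" shows "gauss_prod q (rev [1..<Suc r]) 1 = (\<Sum>i\<le>r. q ^ i)"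
proof (induction r)
  case (Suc r)
  have "rev [1..<Suc (Suc r)] = Suc r # rev [1..<Suc r]" by simp
  then have "gauss_prod q (rev [1..<Suc (Suc r)]) 1 = (1 - q ^ Suc (Suc r)) / (1 - q ^ Suc r) * (\<Sum>i\<le>r. q ^ i)"
    using Suc by (simp del: upt_Suc)
  also have "(\<Sum>i\<le>r. q ^ i) = (1 - q ^ Suc r) / (1 - q)" using assms sum_gp0[of q r] by simp
  also have "1 - q ^ Suc r \<noteq> 0" using assms one_less_power[of q "Suc r"] by auto
  then have "(1 - q ^ Suc (Suc r)) / (1 - q ^ Suc r) * ((1 - q ^ Suc r) / (1 - q)) = (1 - q ^ Suc (Suc r)) / (1 - q)" by simp
  also have "\<dots> = (\<Sum>i\<le>Suc r. q ^ i)" using assms sum_gp0[of q "Suc r"] by simp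
  finally show ?case .
qed simp

section \<open>Local factors of a partition\<close>

text \<open>Reversed, so that the first part of the partition is the first block that the recursion meets; for two
  parts this puts the larger one first.\<close>

definition partition_steps :: "nat list \<Rightarrow> nat list" where
  "partition_steps l = concat (map (\<lambda>r. rev [1..<Suc r]) (rev l))"

lemma partition_steps_simps:
  "partition_steps [] = []"
  "partition_steps (r # l) = partition_steps l @ rev [1..<Suc r]"
  by (simp_all add: partition_steps_def)

lemma length_partition_steps: "length (partition_steps l) = sum_list l"
  by (induction l) (simp_all add: partition_steps_simps)

lemma partition_steps_pos: "\<forall>j\<in>set (partition_steps l). j \<ge> 1"
  by (induction l) (auto simp: partition_steps_simps)

lemma gauss_prod_partition_steps:
  "gauss_prod q (partition_steps l) k = (\<Prod>r\<leftarrow>l. gauss_prod q (rev [1..<Suc r]) k)"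
  by (induction l) (simp_all add: partition_steps_simps gauss_prod_append del: upt_Suc)

text \<open>Coefficients in the variable \<open>y = q ^ (n - 1) x\<close>, where \<open>n\<close> is the size of the partition. In
  this variable a word with a single descent, at position \<open>n - 1\<close>, has weight \<open>y\<close>, and all other words with
  descents have weight \<open>O(y / q)\<close>.\<close>

definition local_coeff :: "real \<Rightarrow> nat list \<Rightarrow> nat \<Rightarrow> real" where
  "local_coeff q l k = macmahon_coeff q (partition_steps l) k / q ^ ((sum_list l - 1) * k)"

lemma local_coeff_0 [simp]: "local_coeff q l 0 = 1"
  by (simp add: local_coeff_def)

definition geom :: "real \<Rightarrow> nat \<Rightarrow> real" where
  "geom q r = (\<Sum>i\<le>r. q ^ i)"

lemma geom_closed: "q \<noteq> 1 \<Longrightarrow> geom q r = (1 - q ^ Suc r) / (1 - q)"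
  unfolding geom_def using sum_gp0[of q r] by simp

lemma local_coeff_1:
  assumes "q > 1"
  shows "local_coeff q l 1 = ((\<Prod>r\<leftarrow>l. geom q r) - geom q (sum_list l)) / q ^ (sum_list l - 1)"
  unfolding local_coeff_def macmahon_coeff_1[OF assms partition_steps_pos] gauss_prod_partition_steps
    gauss_prod_block[OF assms] length_partition_steps geom_def by simp

text \<open>Two or more descents lose at least one power of \<open>q\<close> against \<open>(n - 1) k\<close>.\<close>

lemma local_coeff_higher_bound:
  assumes "sum_list l \<ge> 1"
  shows "\<exists>C\<ge>0. \<forall>q\<ge>2. \<forall>k\<ge>2. \<bar>local_coeff q l k\<bar> \<le> C / q"
proof -
  define N where "N = sum_list l"
  obtain C where C: "C \<ge> 1" "\<And>q k. q \<ge> 2 \<Longrightarrow> \<bar>macmahon_coeff q (partition_steps l) k\<bar> * q ^ triangle k \<le> C * q ^ (N * k)"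
    using macmahon_coeff_bound[OF partition_steps_pos] unfolding length_partition_steps N_def by blast
  have tri: "triangle k \<ge> k + 1" if "k \<ge> 2" for k
    using that by (induction k rule: dec_induct) (simp_all add: numeral_2_eq_2)
  have "\<bar>local_coeff q l k\<bar> \<le> C / q" if q: "q \<ge> 2" and k: "k \<ge> 2" for q k
  proof -
    have "\<bar>macmahon_coeff q (partition_steps l) k\<bar> * q ^ (k + 1) \<le> \<bar>macmahon_coeff q (partition_steps l) k\<bar> * q ^ triangle k"
      using q tri[OF k] by (intro mult_left_mono power_increasing) auto
    also have "\<dots> \<le> C * q ^ (N * k)" by (rule C(2)[OF q])
    also have "N * k = (N - 1) * k + k" using assms unfolding N_def[symmetric] by (cases N) auto
    finally have "\<bar>macmahon_coeff q (partition_steps l) k\<bar> * q * q ^ k \<le> C * q ^ ((N - 1) * k) * q ^ k"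
      by (simp add: power_add mult_ac)
    then have "\<bar>macmahon_coeff q (partition_steps l) k\<bar> * q \<le> C * q ^ ((N - 1) * k)"
      using q by (simp add: mult_le_cancel_right)
    then show ?thesis using q by (simp add: local_coeff_def N_def[symmetric] abs_divide divide_simps mult_ac)
  qed
  then show ?thesis using C(1) by (intro exI[of _ C]) auto
qed

text \<open>Expansion to second order in \<open>1 / q\<close>.\<close>

lemma geom_normalised:
  assumes q: "q \<ge> 2"
  shows "1 \<le> geom q r / q ^ r" "geom q r / q ^ r \<le> 2"
    and "r \<ge> 1 \<Longrightarrow> \<bar>geom q r / q ^ r - 1 - 1 / q\<bar> \<le> 2 / q\<^sup>2"
proof -
  have step: "geom q (Suc r) / q ^ Suc r = 1 + (geom q r / q ^ r) / q" for r
    using q by (simp add: geom_def field_simps)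
  have b: "1 \<le> geom q r / q ^ r \<and> geom q r / q ^ r \<le> 2" for r
  proof (induction r)
    case 0
    then show ?case by (simp add: geom_def)
  next
    case (Suc r)
    have "0 \<le> (geom q r / q ^ r) / q" by (rule divide_nonneg_nonneg) (use Suc q in linarith)+
    moreover have "(geom q r / q ^ r) / q \<le> 2 / 2" using Suc q by (intro frac_le) auto
    ultimately show ?case unfolding step by simp
  qed
  then show "1 \<le> geom q r / q ^ r" "geom q r / q ^ r \<le> 2" by auto
  assume "r \<ge> 1"
  then obtain r' where r: "r = Suc r'" by (cases r) auto
  show "\<bar>geom q r / q ^ r - 1 - 1 / q\<bar> \<le> 2 / q\<^sup>2"
  proof (cases r')
    case 0
    have "geom q r / q ^ r - 1 - 1 / q = 0" unfolding r 0 step using q by (simp add: geom_def)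
    then show ?thesis by simp
  next
    case (Suc r'')
    have "geom q r / q ^ r - 1 - 1 / q = (geom q r'' / q ^ r'') / q\<^sup>2"
      unfolding r Suc step using q by (simp add: field_simps power2_eq_square)
    moreover have "0 \<le> (geom q r'' / q ^ r'') / q\<^sup>2"
      by (rule divide_nonneg_nonneg) (use b[of r''] in \<open>linarith, simp\<close>)
    moreover have "(geom q r'' / q ^ r'') / q\<^sup>2 \<le> 2 / q\<^sup>2" using b[of r''] by (intro divide_right_mono) auto
    ultimately show ?thesis by simp
  qed
qed

lemma geom_product_bound:
  assumes "\<forall>r\<in>set l. r \<ge> 1"
  shows "\<exists>C\<ge>0. \<forall>q\<ge>2. \<bar>(\<Prod>r\<leftarrow>l. geom q r) / q ^ sum_list l - 1 - real (length l) / q\<bar> \<le> C / q\<^sup>2"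
  using assms
proof (induction l)
  case Nil
  then show ?case by (intro exI[of _ 0]) auto
next
  case (Cons r l)
  then obtain C where C: "C \<ge> 0" "\<And>q. q \<ge> 2 \<Longrightarrow> \<bar>(\<Prod>r\<leftarrow>l. geom q r) / q ^ sum_list l - 1 - real (length l) / q\<bar> \<le> C / q\<^sup>2"
    by auto
  define m where "m = real (length l)"
  have "\<bar>(\<Prod>r\<leftarrow>r # l. geom q r) / q ^ sum_list (r # l) - 1 - real (length (r # l)) / q\<bar> \<le> (2 * C + 2 + 3 * m) / q\<^sup>2"
    if q: "q \<ge> 2" for q
  proof -
    define A where "A = (\<Prod>r\<leftarrow>l. geom q r) / q ^ sum_list l"
    define e where "e = geom q r / q ^ r"
    define a where "a = A - 1 - m / q"
    define d where "d = e - 1 - 1 / q"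
    have e: "1 \<le> e" "e \<le> 2" "\<bar>d\<bar> \<le> 2 / q\<^sup>2"
      unfolding e_def d_def using geom_normalised[OF q] Cons.prems by auto
    have a: "\<bar>a\<bar> \<le> C / q\<^sup>2" unfolding a_def A_def m_def by (rule C(2)[OF q])
    have "(\<Prod>r\<leftarrow>r # l. geom q r) / q ^ sum_list (r # l) - 1 - real (length (r # l)) / q
        = A * e - 1 - (m + 1) / q" by (simp add: A_def e_def m_def power_add mult_ac add_ac)
    also have "\<dots> = a * e + (1 + m / q) * d + m / q\<^sup>2"
      using q by (simp add: a_def d_def field_simps power2_eq_square)
    also have "\<bar>\<dots>\<bar> \<le> \<bar>a\<bar> * e + (1 + m / q) * \<bar>d\<bar> + m / q\<^sup>2"
    proof -
      have "\<bar>a * e\<bar> = \<bar>a\<bar> * e" "\<bar>(1 + m / q) * d\<bar> = (1 + m / q) * \<bar>d\<bar>" "\<bar>m / q\<^sup>2\<bar> = m / q\<^sup>2"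
        using e q by (simp_all add: abs_mult m_def)
      then show ?thesis using abs_triangle_ineq[of "a * e + (1 + m / q) * d" "m / q\<^sup>2"] abs_triangle_ineq[of "a * e" "(1 + m / q) * d"]
        by linarith
    qed
    also have "\<dots> \<le> (C / q\<^sup>2) * 2 + (1 + m) * (2 / q\<^sup>2) + m / q\<^sup>2"
    proof (intro add_mono mult_mono order_refl)
      show "m / q \<le> m" using q by (simp add: m_def divide_simps mult_le_cancel_left1)
    qed (use e a q in \<open>auto simp: m_def\<close>)
    also have "\<dots> = (2 * C + 2 + 3 * m) / q\<^sup>2" using q by (simp add: field_simps)
    finally show ?thesis .
  qed
  then show ?case using C(1) by (intro exI[of _ "2 * C + 2 + 3 * m"]) (auto simp: m_def)
qed

text \<open>There are \<open>m - 1\<close> words with a single descent at the last possible position, one for each last letter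
  other than the largest.\<close>

lemma local_coeff_1_bound:
  assumes l: "\<forall>r\<in>set l. r \<ge> 1" "l \<noteq> []"
  shows "\<exists>C\<ge>0. \<forall>q\<ge>2. \<bar>local_coeff q l 1 - (real (length l) - 1)\<bar> \<le> C / q"
proof -
  define N where "N = sum_list l"
  have N: "N \<ge> 1" using l by (cases l) (auto simp: N_def)
  obtain C where C: "C \<ge> 0" "\<And>q. q \<ge> 2 \<Longrightarrow> \<bar>(\<Prod>r\<leftarrow>l. geom q r) / q ^ N - 1 - real (length l) / q\<bar> \<le> C / q\<^sup>2"
    using geom_product_bound[OF l(1)] unfolding N_def by blast
  have "\<bar>local_coeff q l 1 - (real (length l) - 1)\<bar> \<le> (C + 2) / q" if q: "q \<ge> 2" for q
  proof -
    define A where "A = (\<Prod>r\<leftarrow>l. geom q r) / q ^ N"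
    define e where "e = geom q N / q ^ N"
    have "q ^ N = q * q ^ (N - 1)" using N by (metis Suc_diff_1 less_le_trans power_Suc zero_less_one)
    then have L: "local_coeff q l 1 = q * (A - e)"
      using q local_coeff_1[of q l] by (simp add: N_def[symmetric] A_def e_def diff_divide_distrib right_diff_distrib)
    have "local_coeff q l 1 - (real (length l) - 1)
       = q * ((A - 1 - real (length l) / q) - (e - 1 - 1 / q))"
      unfolding L using q by (simp add: field_simps)
    also have "\<bar>\<dots>\<bar> \<le> q * (C / q\<^sup>2 + 2 / q\<^sup>2)"
      using C(2)[OF q] geom_normalised(3)[OF q N] q
      by (simp add: abs_mult A_def e_def)
    also have "\<dots> = (C + 2) / q" using q by (simp add: field_simps power2_eq_square)
    finally show ?thesis .
  qed
  then show ?thesis using C(1) by (intro exI[of _ "C + 2"]) auto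
qed

text \<open>For two parts the coefficient is the product of the \<open>1 / q\<close>-analogues of \<open>a\<close> and \<open>b\<close>, which exceeds its limit \<open>1\<close> by at least \<open>1 / q\<close> as soon
  as \<open>a \<ge> 2\<close>. This second-order term pushes the roots of the local factors into the half-plane.\<close>

lemma local_coeff_two_parts_1:
  assumes q: "q \<ge> 2" and ab: "a \<ge> 2" "b \<ge> 1"
  shows "local_coeff q [a, b] 1 \<ge> 1 + 1 / q"
proof -
  obtain a' where a': "a = Suc (Suc a')" using ab by (metis Suc_diff_Suc diff_0_eq_0 less_eq_Suc_le numeral_2_eq_2 old.nat.exhaust not0_implies_Suc Suc_le_D Suc_le_mono)
  obtain b' where b': "b = Suc b'" using ab by (cases b) auto
  have "geom q a * geom q b - geom q (a + b) = q * geom q (Suc a') * geom q b'"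
    using q by (simp add: geom_closed a' b' divide_simps) (simp add: power_add algebra_simps)
  moreover have "geom q (Suc a') \<ge> q ^ a' + q ^ Suc a'"
    using q sum_nonneg[of "{..<a'}" "\<lambda>i. q ^ i"] by (simp add: geom_def lessThan_Suc_atMost[symmetric])
  moreover have "geom q b' \<ge> q ^ b'"
    using q sum_nonneg[of "{..<b'}" "\<lambda>i. q ^ i"] by (simp add: geom_def lessThan_Suc_atMost[symmetric])
  moreover have "0 \<le> geom q (Suc a')" using q by (simp add: geom_def sum_nonneg)
  ultimately have "geom q a * geom q b - geom q (a + b) \<ge> q * (q ^ a' + q ^ Suc a') * q ^ b'"
    using q by (auto intro!: mult_mono)
  then have "local_coeff q [a, b] 1 \<ge> q * (q ^ a' + q ^ Suc a') * q ^ b' / q ^ (a + b - 1)"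
    using q by (subst local_coeff_1) (auto intro!: divide_right_mono)
  also have "q * (q ^ a' + q ^ Suc a') * q ^ b' / q ^ (a + b - 1) = 1 + 1 / q"
    using q by (simp add: a' b' field_simps power_add)
  finally show ?thesis .
qed

lemma local_coeff_two_parts_bound:
  assumes ab: "b \<le> a" "b \<ge> 1"
  shows "\<exists>C\<ge>0. \<forall>q\<ge>2. \<forall>k\<ge>2. \<bar>local_coeff q [a, b] k\<bar> \<le> C / q\<^sup>2"
proof -
  have st: "partition_steps [a, b] = rev [1..<Suc b] @ rev [1..<Suc a]"
    by (simp add: partition_steps_simps)
  obtain C where C: "C \<ge> 1" "\<And>q k. q \<ge> 2 \<Longrightarrow> \<bar>macmahon_coeff q (partition_steps [a, b]) k\<bar> * q ^ (k * k) \<le> C * q ^ ((b + a) * k)"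
    using macmahon_coeff_two_blocks_bound[OF ab(1)] unfolding st by blast
  have "\<bar>local_coeff q [a, b] k\<bar> \<le> C / q\<^sup>2" if q: "q \<ge> 2" and k: "k \<ge> 2" for q k
  proof -
    have "2 * k \<le> k * k" using k by simp
    then have k2: "k + 2 \<le> k * k" using k by linarith
    have "\<bar>macmahon_coeff q (partition_steps [a, b]) k\<bar> * q ^ (k + 2) \<le> \<bar>macmahon_coeff q (partition_steps [a, b]) k\<bar> * q ^ (k * k)"
      using q k2 by (intro mult_left_mono power_increasing) auto
    also have "\<dots> \<le> C * q ^ ((b + a) * k)" by (rule C(2)[OF q])
    also have "(b + a) * k = (a + b - 1) * k + k" using ab by (cases b) auto
    finally have "\<bar>macmahon_coeff q (partition_steps [a, b]) k\<bar> * q\<^sup>2 * q ^ k \<le> C * q ^ ((a + b - 1) * k) * q ^ k"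
      by (simp only: power_add mult_ac)
    then have "\<bar>macmahon_coeff q (partition_steps [a, b]) k\<bar> * q\<^sup>2 \<le> C * q ^ ((a + b - 1) * k)"
      using q by (simp add: mult_le_cancel_right)
    then show ?thesis using q by (simp add: local_coeff_def abs_divide divide_simps mult_ac)
  qed
  then show ?thesis using C(1) by (intro exI[of _ C]) auto
qed

section \<open>Continuation of near-linear Euler products\<close>

lemma prod_powi:
  fixes f :: "'b \<Rightarrow> 'a :: field"
  shows "(\<Prod>x\<in>A. f x powi n) = (\<Prod>x\<in>A. f x) powi n"
  by (induction A rule: infinite_finite_induct) (auto simp: power_int_mult_distrib)

lemma zeta_euler_product_lessThan:
  assumes "Re s > 1"
  shows "(\<lambda>N. \<Prod>n<N. if prime n then 1 - of_nat n powr (- s) else 1) \<longlonglongrightarrow> 1 / zeta s"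
proof -
  have "(\<Prod>n<Suc x. if prime n then 1 - of_nat n powr (- s) else 1)
      = (\<Prod>p | prime p \<and> p \<le> x. 1 - of_nat p powr (- s))" for x :: nat
    by (intro prod.mono_neutral_cong_right) auto
  then have "(\<lambda>x. \<Prod>n<Suc x. if prime n then 1 - of_nat n powr (- s) else 1) \<longlonglongrightarrow> 1 / zeta s"
    using zeta_euler_product(2)[OF assms] by simp
  then show ?thesis by (rule LIMSEQ_imp_Suc)
qed

lemma one_minus_power_nonzero:
  assumes "norm (y :: complex) < 1" "k \<ge> 1"
  shows "1 - y ^ k \<noteq> 0"
proof -
  have "norm y ^ k < 1" using assms by (subst power_less_one_iff) auto
  then have "norm (y ^ k) \<noteq> norm (1 :: complex)" by (simp add: norm_power)
  then show ?thesis by auto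
qed

lemma norm_prime_powr: "prime p \<Longrightarrow> norm (of_nat p powr (- z) :: complex) = real p powr (- Re z)"
  by (subst norm_nat_powr) (auto simp: prime_gt_0_nat)

lemma norm_prime_powr_less_1: "prime p \<Longrightarrow> Re z > 0 \<Longrightarrow> norm (of_nat p powr (- z) :: complex) < 1"
  using prime_gt_1_nat[of p] by (simp add: norm_prime_powr powr_less_one)

text \<open>Euler products \<open>\<Prod>p. f p (p powr (- z))\<close> whose local factors \<open>f p y = (\<Sum>k\<le>d. b p k y ^ k)\<close> differ from
  \<open>1 + u y\<close> by \<open>O(1 / p)\<close>. The integers \<open>c k\<close> are the exponents in the formal factorisation
  \<open>1 + u y = (\<Prod>k. (1 - y ^ k) ^ (- c k))\<close>; up to level \<open>K\<close> they remove all terms of order at most \<open>K\<close>.\<close>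

locale near_linear_euler_product =
  fixes u d :: nat and b :: "nat \<Rightarrow> nat \<Rightarrow> real" and C :: real and c :: "nat \<Rightarrow> int"
  assumes d: "d \<ge> 1" and C: "C \<ge> 0"
    and b0: "prime p \<Longrightarrow> b p 0 = 1"
    and b1: "prime p \<Longrightarrow> \<bar>b p 1 - real u\<bar> \<le> C / real p"
    and b2: "prime p \<Longrightarrow> k \<ge> 2 \<Longrightarrow> \<bar>b p k\<bar> \<le> C / real p"
    and exponents: "0 < r \<Longrightarrow> r < 1 \<Longrightarrow> \<exists>B. \<forall>y::complex. norm y \<le> r \<longrightarrow>
      norm ((1 + of_nat u * y) * (\<Prod>k=1..K. (1 - y ^ k) powi c k) - 1) \<le> B * norm y ^ Suc K"
begin

definition local_factor :: "nat \<Rightarrow> complex \<Rightarrow> complex" where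
  "local_factor p y = (\<Sum>k\<le>d. of_real (b p k) * y ^ k)"

definition corrected_factor :: "nat \<Rightarrow> nat \<Rightarrow> complex \<Rightarrow> complex" where
  "corrected_factor K p y = local_factor p y * (\<Prod>k=1..K. (1 - y ^ k) powi c k)"

definition euler_factor :: "nat \<Rightarrow> nat \<Rightarrow> complex \<Rightarrow> complex" where
  "euler_factor K n z = (if prime n then corrected_factor K n (of_nat n powr (- z)) else 1)"

definition regular_part :: "nat \<Rightarrow> complex \<Rightarrow> complex" where
  "regular_part K z = lim (\<lambda>N. \<Prod>n<N. euler_factor K n z)"

lemma local_factor_near_linear:
  assumes p: "prime p" and y: "norm y \<le> 1"
  shows "norm (local_factor p y - (1 + of_nat u * y)) \<le> real d * C * (norm y / real p)"
proof -
  obtain d' where d': "d = Suc d'" using d by (cases d) auto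
  have "local_factor p y = (\<Sum>k\<le>d'. of_real (b p (Suc k)) * y ^ Suc k) + 1"
    unfolding local_factor_def unfolding d' by (subst sum.atMost_Suc_shift) (simp add: b0 p)
  also have "(\<Sum>k\<le>d'. of_real (b p (Suc k)) * y ^ Suc k) - of_nat u * y
      = (\<Sum>k\<le>d'. of_real (b p (Suc k) - (if k = 0 then real u else 0)) * y ^ Suc k)"
  proof -
    have "of_nat u * y = (\<Sum>k\<le>d'. of_real (if k = 0 then real u else 0) * y ^ Suc k)"
      by (subst sum.remove[of _ 0]) auto
    then show ?thesis by (simp only: sum_subtractf[symmetric] of_real_diff left_diff_distrib)
  qed
  then have "(\<Sum>k\<le>d'. of_real (b p (Suc k)) * y ^ Suc k) + 1 - (1 + of_nat u * y)
      = (\<Sum>k\<le>d'. of_real (b p (Suc k) - (if k = 0 then real u else 0)) * y ^ Suc k)" by simp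
  also have "norm \<dots> \<le> (\<Sum>k\<le>d'. C / real p * norm y)"
  proof (intro order_trans[OF norm_sum] sum_mono)
    fix k
    have "\<bar>b p (Suc k) - (if k = 0 then real u else 0)\<bar> \<le> C / real p"
      using b1[OF p] b2[OF p, of "Suc k"] by (cases k) auto
    moreover have "norm (y ^ Suc k) \<le> norm y"
      using y by (simp add: norm_mult norm_power mult_left_le power_le_one)
    ultimately show "norm (of_real (b p (Suc k) - (if k = 0 then real u else 0)) * y ^ Suc k) \<le> C / real p * norm y"
      unfolding norm_mult[of _ "y ^ Suc k"] norm_of_real using C by (intro mult_mono) auto
  qed
  also have "\<dots> = real d * C * (norm y / real p)" by (simp add: d' algebra_simps add_divide_distrib)
  finally show ?thesis .
qed

lemma correction_holomorphic:
  "(\<lambda>y. \<Prod>k=1..K. (1 - y ^ k) powi c k) holomorphic_on ball 0 1"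
  by (intro holomorphic_intros) (use one_minus_power_nonzero in auto)

text \<open>The correction leaves \<open>O(y ^ (K + 1))\<close> from the linear part and \<open>O(y / p)\<close> from the perturbation. With
  \<open>y = p powr (- z)\<close> both are summable over \<open>p\<close> for \<open>Re z > 1 / (K + 1)\<close>.\<close>

lemma corrected_factor_bound:
  assumes r: "0 < r" "r < 1"
  shows "\<exists>A\<ge>0. \<forall>p y. prime p \<longrightarrow> norm y \<le> r \<longrightarrow>
    norm (corrected_factor K p y - 1) \<le> A * (norm y ^ Suc K + norm y / real p)"
proof -
  define h where "h = (\<lambda>y::complex. \<Prod>k=1..K. (1 - y ^ k) powi c k)"
  obtain B where B: "\<And>y. norm y \<le> r \<Longrightarrow> norm ((1 + of_nat u * y) * h y - 1) \<le> B * norm y ^ Suc K"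
    using exponents[OF r, of K] unfolding h_def by blast
  have "bounded (h ` cball 0 r)"
    using r unfolding h_def
    by (intro compact_imp_bounded compact_continuous_image holomorphic_on_imp_continuous_on holomorphic_on_subset[OF correction_holomorphic]) auto
  then obtain H where H: "H > 0" "\<And>y. norm y \<le> r \<Longrightarrow> norm (h y) \<le> H"
    unfolding bounded_pos by (metis image_eqI mem_cball_0)
  define A where "A = \<bar>B\<bar> + real d * C * H"
  have "norm (corrected_factor K p y - 1) \<le> A * (norm y ^ Suc K + norm y / real p)"
    if p: "prime p" and y: "norm y \<le> r" for p y
  proof -
    have "corrected_factor K p y - 1 = ((1 + of_nat u * y) * h y - 1) + (local_factor p y - (1 + of_nat u * y)) * h y"
      by (simp add: corrected_factor_def h_def algebra_simps)
    also have "norm \<dots> \<le> norm ((1 + of_nat u * y) * h y - 1) + norm (local_factor p y - (1 + of_nat u * y)) * norm (h y)"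
      by (metis norm_triangle_ineq norm_mult)
    also have "\<dots> \<le> \<bar>B\<bar> * norm y ^ Suc K + real d * C * (norm y / real p) * H"
    proof (intro add_mono mult_mono)
      have "norm ((1 + of_nat u * y) * h y - 1) \<le> B * norm y ^ Suc K" by (rule B[OF y])
      also have "\<dots> \<le> \<bar>B\<bar> * norm y ^ Suc K" by (intro mult_right_mono) auto
      finally show "norm ((1 + of_nat u * y) * h y - 1) \<le> \<bar>B\<bar> * norm y ^ Suc K" .
      show "norm (local_factor p y - (1 + of_nat u * y)) \<le> real d * C * (norm y / real p)"
        using y r by (intro local_factor_near_linear p) auto
    qed (use H y C in auto)
    also have "real d * C * (norm y / real p) * H = (real d * C * H) * (norm y / real p)" by simp
    also have "\<bar>B\<bar> * norm y ^ Suc K + (real d * C * H) * (norm y / real p) \<le> A * norm y ^ Suc K + A * (norm y / real p)"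
      unfolding A_def using H(1) C by (intro add_mono mult_right_mono) auto
    finally show ?thesis by (simp add: algebra_simps)
  qed
  moreover have "A \<ge> 0" unfolding A_def using H(1) C by auto
  ultimately show ?thesis by blast
qed

lemma euler_factor_holomorphic: "(\<lambda>z. euler_factor K n z) holomorphic_on {z. Re z > 0}"
proof (cases "prime n")
  case True
  have "(corrected_factor K n \<circ> (\<lambda>z. of_nat n powr (- z))) holomorphic_on {z. Re z > 0}"
  proof (rule holomorphic_on_compose_gen)
    show "(\<lambda>z. of_nat n powr (- z) :: complex) holomorphic_on {z. Re z > 0}"
      using True by (intro holomorphic_intros) (auto simp: prime_gt_0_nat)
    show "corrected_factor K n holomorphic_on ball 0 1"
      unfolding corrected_factor_def[abs_def] local_factor_def
      by (intro holomorphic_intros correction_holomorphic)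
    show "(\<lambda>z. of_nat n powr (- z)) ` {z. Re z > 0} \<subseteq> ball (0::complex) 1"
      using norm_prime_powr_less_1[OF True] by auto
  qed
  then show ?thesis using True by (simp add: euler_factor_def comp_def)
qed (simp add: euler_factor_def)

lemma euler_factor_majorant:
  assumes \<sigma>: "\<sigma> > 0" "real (Suc K) * \<sigma> > 1"
  shows "\<exists>M. summable M \<and> (\<forall>n z. Re z \<ge> \<sigma> \<longrightarrow> norm (euler_factor K n z - 1) \<le> M n)"
proof -
  define r where "r = 2 powr (- \<sigma>)"
  have r: "0 < r" "r < 1" using \<sigma> by (auto simp: r_def powr_less_one)
  obtain A where A: "A \<ge> 0" "\<And>p y. prime p \<Longrightarrow> norm y \<le> r \<Longrightarrow>
      norm (corrected_factor K p y - 1) \<le> A * (norm y ^ Suc K + norm y / real p)"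
    using corrected_factor_bound[OF r] by blast
  define M where "M = (\<lambda>n::nat. A * (real n powr (- (real (Suc K) * \<sigma>)) + real n powr (- 1 - \<sigma>)))"
  have "summable M"
    unfolding M_def using \<sigma> by (intro summable_mult summable_add) (auto simp: summable_real_powr_iff)
  moreover have "norm (euler_factor K n z - 1) \<le> M n" if z: "Re z \<ge> \<sigma>" for n z
  proof (cases "prime n")
    case True
    have n: "real n \<ge> 2" using prime_ge_2_nat[OF True] by simp
    define y :: complex where "y = of_nat n powr (- z)"
    have ny: "norm y \<le> real n powr (- \<sigma>)"
      unfolding y_def norm_prime_powr[OF True] using n z by (intro powr_mono) auto
    also have "\<dots> \<le> r" unfolding r_def using n \<sigma> by (intro powr_mono2') auto
    finally have yr: "norm y \<le> r" .
    have "norm (corrected_factor K n y - 1) \<le> A * (norm y ^ Suc K + norm y / real n)"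
      by (rule A(2)[OF True yr])
    also have "\<dots> \<le> A * ((real n powr (- \<sigma>)) ^ Suc K + real n powr (- \<sigma>) / real n)"
      using ny A(1) n by (intro mult_left_mono add_mono power_mono divide_right_mono) auto
    also have "(real n powr (- \<sigma>)) ^ Suc K = real n powr (- (real (Suc K) * \<sigma>))"
      using n by (simp only: powr_realpow[symmetric] powr_gt_zero powr_powr) (simp add: algebra_simps)
    also have "real n powr (- \<sigma>) / real n = real n powr (- 1 - \<sigma>)"
      using n by (simp add: powr_diff powr_minus field_simps)
    finally show ?thesis using True by (simp add: euler_factor_def M_def y_def)
  qed (simp add: euler_factor_def M_def A)
  ultimately show ?thesis by blast
qed

lemma regular_part_limit:
  assumes "Re z > 0" "real (Suc K) * Re z > 1"
  shows "(\<lambda>N. \<Prod>n<N. euler_factor K n z) \<longlonglongrightarrow> regular_part K z"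
    and "(\<And>n. euler_factor K n z \<noteq> 0) \<Longrightarrow> regular_part K z \<noteq> 0"
proof -
  obtain M where M: "summable M" "\<And>n. norm (euler_factor K n z - 1) \<le> M n"
    using euler_factor_majorant[OF assms] by blast
  have "summable (\<lambda>n. norm (euler_factor K n z - 1))"
    by (rule summable_comparison_test'[OF M(1), of 0]) (use M(2) in auto)
  then have conv: "convergent_prod (\<lambda>n. euler_factor K n z)"
    by (intro abs_convergent_prod_imp_convergent_prod summable_imp_abs_convergent_prod)
  then have "(\<lambda>N. \<Prod>n\<le>N. euler_factor K n z) \<longlonglongrightarrow> prodinf (\<lambda>n. euler_factor K n z)"
    by (rule convergent_prod_LIMSEQ)
  then have lim: "(\<lambda>N. \<Prod>n<N. euler_factor K n z) \<longlonglongrightarrow> prodinf (\<lambda>n. euler_factor K n z)"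
    by (simp add: LIMSEQ_lessThan_iff_atMost)
  then have eq: "regular_part K z = prodinf (\<lambda>n. euler_factor K n z)"
    unfolding regular_part_def by (rule limI)
  show "(\<lambda>N. \<Prod>n<N. euler_factor K n z) \<longlonglongrightarrow> regular_part K z" using lim eq by simp
  show "regular_part K z \<noteq> 0" if "\<And>n. euler_factor K n z \<noteq> 0"
    unfolding eq using conv that by (rule prodinf_nonzero)
qed

lemma regular_part_holomorphic: "regular_part K holomorphic_on {z. Re z > 1 / real (Suc K)}"
proof (rule holomorphic_uniform_sequence[where f = "\<lambda>N z. \<Prod>n<N. euler_factor K n z"])
  have pos: "Re z > 0" if "Re z > 1 / real (Suc K)" for z
    using that by (rule less_trans[rotated]) simp
  show "open {z. Re z > 1 / real (Suc K)}" by (rule open_halfspace_Re_gt)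
  show "(\<lambda>z. \<Prod>n<N. euler_factor K n z) holomorphic_on {z. Re z > 1 / real (Suc K)}" for N
    by (intro holomorphic_intros holomorphic_on_subset[OF euler_factor_holomorphic]) (use pos in auto)
  fix z assume "z \<in> {z. Re z > 1 / real (Suc K)}"
  then have z: "Re z > 1 / real (Suc K)" by simp
  define e where "e = (Re z - 1 / real (Suc K)) / 2"
  define \<sigma> where "\<sigma> = Re z - e"
  have e: "e > 0" using z by (simp add: e_def)
  have "\<sigma> > 1 / real (Suc K)" 
  proof -
    have "x - (x - a) / 2 > a" if "x > a" for x a :: real using that by (simp add: field_simps)
    then show ?thesis using z unfolding \<sigma>_def e_def by blast
  qed
  then have \<sigma>: "\<sigma> > 0" "real (Suc K) * \<sigma> > 1"
    by (auto intro: less_trans[rotated]) (simp add: field_simps)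
  have re: "Re w \<ge> \<sigma>" if "w \<in> cball z e" for w
    using that abs_Re_le_cmod[of "z - w"] by (simp add: dist_norm \<sigma>_def)
  obtain M where M: "summable M" "\<And>n z. Re z \<ge> \<sigma> \<Longrightarrow> norm (euler_factor K n z - 1) \<le> M n"
    using euler_factor_majorant[OF \<sigma>] by blast
  have "uniformly_convergent_on (cball z e) (\<lambda>N w. \<Prod>n<N. euler_factor K n w)"
  proof (rule uniformly_convergent_on_prod')
    have "cball z e \<subseteq> {z. Re z > 0}" using re \<sigma>(1) by force
    then show "continuous_on (cball z e) (\<lambda>w. euler_factor K n w)" for n
      by (intro holomorphic_on_imp_continuous_on holomorphic_on_subset[OF euler_factor_holomorphic])
    show "uniformly_convergent_on (cball z e) (\<lambda>N w. \<Sum>n<N. norm (euler_factor K n w - 1))"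
      by (rule Weierstrass_m_test'[OF _ M(1)]) (use M(2) re in auto)
  qed auto
  then have "uniform_limit (cball z e) (\<lambda>N w. \<Prod>n<N. euler_factor K n w) (regular_part K) sequentially"
    unfolding regular_part_def[abs_def] using uniformly_convergent_uniform_limit_iff by blast
  moreover have "cball z e \<subseteq> {z. Re z > 1 / real (Suc K)}"
    using re \<open>\<sigma> > 1 / real (Suc K)\<close> by force
  ultimately show "\<exists>e>0. cball z e \<subseteq> {z. Re z > 1 / real (Suc K)} \<and>
      uniform_limit (cball z e) (\<lambda>N w. \<Prod>n<N. euler_factor K n w) (regular_part K) sequentially"
    using e by blast
qed

lemma regular_part_zero:
  assumes p: "prime p" and "local_factor p (of_nat p powr (- z)) = 0"
    and z: "Re z > 0" "real (Suc K) * Re z > 1"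
  shows "regular_part K z = 0"
proof -
  have "euler_factor K p z = 0" using assms(1,2) by (simp add: euler_factor_def corrected_factor_def)
  then have "(\<Prod>n<N. euler_factor K n z) = 0" if "N > p" for N
    using that by (intro prod_zero) auto
  then have "\<forall>\<^sub>F N in sequentially. (\<Prod>n<N. euler_factor K n z) = 0"
    by (rule eventually_mono[OF eventually_gt_at_top[of p]])
  then have "(\<lambda>N. \<Prod>n<N. euler_factor K n z) \<longlonglongrightarrow> 0" by (rule tendsto_eventually)
  with regular_part_limit(1)[OF z] show ?thesis using LIMSEQ_unique by blast
qed

text \<open>Far to the right every local factor is within distance one of \<open>1\<close>.\<close>

lemma regular_part_nonzero_somewhere:
  "\<exists>z. Re z > 1 / real (Suc K) \<and> regular_part K z \<noteq> 0"
proof -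
  obtain A where A: "A \<ge> 0" "\<And>p y. prime p \<Longrightarrow> norm y \<le> 1 / 2 \<Longrightarrow>
      norm (corrected_factor K p y - 1) \<le> A * (norm y ^ Suc K + norm y / real p)"
    using corrected_factor_bound[of "1 / 2" K] by auto
  obtain n where n: "(1 / 2 :: real) ^ n < 1 / (2 * A + 2)"
    using real_arch_pow_inv[of "1 / (2 * A + 2)" "1 / 2"] A(1) by auto
  define z :: complex where "z = of_nat (n + 2)"
  have z: "Re z > 0" "Re z > 1 / real (Suc K)"
    by (auto simp: z_def intro: le_less_trans[of _ 1])
  have "euler_factor K p z \<noteq> 0" for p
  proof (cases "prime p")
    case True
    define y :: complex where "y = of_nat p powr (- z)"
    have p2: "real p \<ge> 2" using prime_ge_2_nat[OF True] by simp
    have "norm y = real p powr (- real (n + 2))" unfolding y_def norm_prime_powr[OF True] by (simp add: z_def)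
    also have "\<dots> \<le> 2 powr (- real (n + 2))" using p2 by (intro powr_mono2') auto
    also have "\<dots> = (1 / 2) ^ (n + 2)" by (simp only: powr_minus powr_realpow zero_less_numeral) (simp add: field_simps)
    finally have ny: "norm y \<le> (1 / 2) ^ (n + 2)" .
    have "(1 / 2 :: real) ^ (n + 2) \<le> (1 / 2) ^ n" by (intro power_decreasing) auto
    then have y2: "norm y < 1 / (2 * A + 2)" using ny n by linarith
    have "(1 / 2 :: real) ^ (n + 2) \<le> 1 / 2" using power_decreasing[of 1 "n + 2" "1 / 2 :: real"] by simp
    then have y1: "norm y \<le> 1 / 2" using ny by linarith
    have "norm (corrected_factor K p y - 1) \<le> A * (norm y ^ Suc K + norm y / real p)"
      by (rule A(2)[OF True y1])
    also have "\<dots> \<le> A * (norm y + norm y)"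
    proof (intro mult_left_mono add_mono)
      show "norm y ^ Suc K \<le> norm y" using y1 by (simp add: mult_left_le power_le_one)
      show "norm y / real p \<le> norm y" using p2 by (simp add: divide_le_eq mult_le_cancel_left1)
    qed (use A in auto)
    also have "\<dots> \<le> (2 * A) * (1 / (2 * A + 2))" using A(1) y2 mult_left_mono[of "norm y" "1 / (2 * A + 2)" "2 * A"] by simp
    also have "\<dots> < 1" using A(1) by (simp add: field_simps)
    finally have "corrected_factor K p y \<noteq> 0" by auto
    then show ?thesis using True by (simp add: euler_factor_def y_def)
  qed (simp add: euler_factor_def)
  then have "regular_part K z \<noteq> 0" using z by (intro regular_part_limit(2)) (auto simp: field_simps)
  then show ?thesis using z by blast
qed

text \<open>The corrections divided out of the local factors are restored globally as powers of \<open>\<zeta>(k z)\<close>.\<close>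

definition continuation_level :: "nat \<Rightarrow> complex \<Rightarrow> complex" where
  "continuation_level K z = (\<Prod>k=1..K. zeta (of_nat k * z) powi c k) * regular_part K z"

text \<open>In the common domain \<open>\<zeta>((K + 1) z)\<close> is given by its Euler product, so the two levels agree at every
  point and not only up to a discrete set.\<close>

lemma continuation_level_Suc:
  assumes z: "Re z > 0" "real (Suc K) * Re z > 1"
  shows "continuation_level (Suc K) z = continuation_level K z"
proof -
  define s where "s = of_nat (Suc K) * z"
  have s: "Re s > 1" using z by (simp add: s_def)
  have z': "real (Suc (Suc K)) * Re z > 1" using z by (simp add: algebra_simps)
  have fac: "euler_factor (Suc K) n z = euler_factor K n z * (if prime n then 1 - of_nat n powr (- s) else 1) powi c (Suc K)" for n
  proof (cases "prime n")
    case True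
    have "(of_nat n powr (- z)) ^ Suc K = (of_nat n powr (- s) :: complex)"
      using prime_gt_0_nat[OF True] by (subst powr_power) (auto simp: s_def)
    then show ?thesis using True by (simp add: euler_factor_def corrected_factor_def mult.assoc del: power_Suc)
  qed (simp add: euler_factor_def)
  have "(\<lambda>N. (\<Prod>n<N. euler_factor K n z) * (\<Prod>n<N. if prime n then 1 - of_nat n powr (- s) else 1) powi c (Suc K))
      \<longlonglongrightarrow> regular_part K z * (1 / zeta s) powi c (Suc K)"
    using zeta_euler_product(1)[OF s]
    by (intro tendsto_intros regular_part_limit z zeta_euler_product_lessThan s) auto
  also have "(\<lambda>N. (\<Prod>n<N. euler_factor K n z) * (\<Prod>n<N. if prime n then 1 - of_nat n powr (- s) else 1) powi c (Suc K))
      = (\<lambda>N. \<Prod>n<N. euler_factor (Suc K) n z)"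
    by (simp add: fac prod.distrib prod_powi fun_eq_iff)
  finally have "regular_part (Suc K) z = regular_part K z * (1 / zeta s) powi c (Suc K)"
    using regular_part_limit(1)[OF z(1) z'] LIMSEQ_unique by blast
  moreover have "(\<Prod>k=1..Suc K. zeta (of_nat k * z) powi c k)
      = (\<Prod>k=1..K. zeta (of_nat k * z) powi c k) * zeta s powi c (Suc K)"
    by (simp add: s_def)
  ultimately show ?thesis
    using zeta_euler_product(1)[OF s]
    unfolding continuation_level_def by (simp add: power_int_divide_distrib del: prod.cl_ivl_Suc)
qed

lemma continuation_level_eq:
  assumes "Re z > 0" "real (Suc K) * Re z > 1" "K \<le> K'"
  shows "continuation_level K' z = continuation_level K z"
  using assms(3)
proof (induction K' rule: dec_induct)
  case (step n)
  have "real (Suc K) * Re z \<le> real (Suc n) * Re z" using step assms by (intro mult_right_mono) auto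
  then have "real (Suc n) * Re z > 1" using assms(2) by linarith
  then have "continuation_level (Suc n) z = continuation_level n z"
    using assms(1) by (intro continuation_level_Suc) auto
  then show ?case using step by simp
qed simp

text \<open>The level is chosen pointwise; any admissible level gives the same value.\<close>

definition continuation :: "complex \<Rightarrow> complex" where
  "continuation z = continuation_level (nat \<lceil>1 / Re z\<rceil>) z"

lemma continuation_eq_level:
  assumes z: "Re z > 0" "real (Suc K) * Re z > 1"
  shows "continuation z = continuation_level K z"
proof -
  define K0 where "K0 = nat \<lceil>1 / Re z\<rceil>"
  have "1 / Re z \<le> real K0" using z unfolding K0_def by linarith
  then have "real (Suc K0) * Re z > 1" using z by (simp add: field_simps)
  then show ?thesis
    unfolding continuation_def K0_def[symmetric]
    using continuation_level_eq[OF z(1), of K K0] continuation_level_eq[OF z(1), of K0 K] z by (metis nle_le)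
qed

text \<open>At level \<open>0\<close> there is no correction.\<close>

lemma continuation_eq_product:
  assumes "Re z > 1"
  shows "(\<lambda>N. \<Prod>n<N. if prime n then local_factor n (of_nat n powr (- z)) else 1) \<longlonglongrightarrow> continuation z"
proof -
  have "(\<lambda>N. \<Prod>n<N. euler_factor 0 n z) \<longlonglongrightarrow> regular_part 0 z"
    using assms by (intro regular_part_limit) auto
  moreover have "continuation z = regular_part 0 z"
    using assms continuation_eq_level[of z 0] by (simp add: continuation_level_def)
  ultimately show ?thesis by (simp add: euler_factor_def[abs_def] corrected_factor_def cong: if_cong)
qed

lemma continuation_eventually_level:
  assumes z: "Re z > 1 / real (Suc K)"
  shows "\<forall>\<^sub>F w in nhds z. continuation w = continuation_level K w"
proof -
  have "\<forall>\<^sub>F w in nhds z. w \<in> {w. Re w > 1 / real (Suc K)}"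
    using z by (intro eventually_nhds_in_open open_halfspace_Re_gt) auto
  then show ?thesis
  proof eventually_elim
    case (elim w)
    then have "Re w > 0" by (auto intro: less_trans[rotated])
    then show ?case using elim by (intro continuation_eq_level) (auto simp: field_simps)
  qed
qed

lemma exists_level: "Re z > 0 \<Longrightarrow> \<exists>K. Re z > 1 / real (Suc K)"
  using reals_Archimedean[of "Re z"] by (auto simp: inverse_eq_divide)

lemma zeta_scaled_meromorphic: "k \<ge> 1 \<Longrightarrow> (\<lambda>z. zeta (of_nat k * z)) meromorphic_on {z. Re z > 0}"
proof (rule meromorphic_on_compose[OF zeta_meromorphic, where f = "\<lambda>z. of_nat k * z"])
  assume k: "k \<ge> 1"
  show "(\<lambda>z. of_nat k * z) analytic_on {z. Re z > 0}" by (intro analytic_intros)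
  show "(\<lambda>z. of_nat k * z) ` {z. Re z > 0} \<subseteq> {s. Re s > - 1}"
  proof safe
    fix z assume "Re z > 0"
    then have "0 \<le> real k * Re z" by simp
    then show "Re (of_nat k * z) > - 1" by simp
  qed
qed

lemma continuation_meromorphic: "continuation meromorphic_on {z. Re z > 0}"
proof (subst meromorphic_on_meromorphic_at, intro ballI)
  fix z assume "z \<in> {z. Re z > 0}"
  then obtain K where z: "Re z > 0" "Re z > 1 / real (Suc K)" using exists_level by blast
  have "continuation_level K meromorphic_on {z}"
    unfolding continuation_level_def[abs_def]
  proof (intro meromorphic_intros)
    show "(\<lambda>z. zeta (of_nat k * z)) meromorphic_on {z}" if "k \<in> {1..K}" for k
      by (rule meromorphic_on_subset[OF zeta_scaled_meromorphic]) (use that z in auto)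
    show "regular_part K meromorphic_on {z}"
      by (rule meromorphic_on_subset[OF analytic_on_imp_meromorphic_on[of _ "{z. Re z > 1 / real (Suc K)}"]])
         (use regular_part_holomorphic z in \<open>auto simp: analytic_on_open open_halfspace_Re_gt\<close>)
  qed
  moreover have "\<forall>\<^sub>F w in at z. continuation w = continuation_level K w"
    using continuation_eventually_level[OF z(2)] by (auto simp: eventually_nhds_conv_at)
  ultimately show "continuation meromorphic_on {z}"
    using meromorphic_on_cong[of "{z}" continuation "continuation_level K"] by auto
qed

end

section \<open>Exponents of the zeta factors\<close>

definition integral_fps :: "complex fps \<Rightarrow> bool" where
  "integral_fps A \<longleftrightarrow> (\<forall>n. fps_nth A n \<in> \<int>)"

lemma integral_fps_mult: "integral_fps A \<Longrightarrow> integral_fps B \<Longrightarrow> integral_fps (A * B)"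
  by (auto simp: integral_fps_def fps_mult_nth)

lemma integral_fps_power: "integral_fps A \<Longrightarrow> integral_fps (A ^ n)"
proof (induction n)
  case 0
  show ?case by (auto simp: integral_fps_def fps_one_nth)
qed (auto intro: integral_fps_mult)

text \<open>The recursion for the coefficients of the inverse divides only by the constant term \<open>1\<close>.\<close>

lemma integral_fps_inverse:
  assumes A: "integral_fps A" "fps_nth A 0 = 1"
  shows "integral_fps (inverse A)"
proof -
  define B where "B = inverse A"
  have AB: "A * B = 1" unfolding B_def using A by (intro inverse_mult_eq_1') simp
  have "fps_nth B n \<in> \<int>" for n
  proof (induction n rule: less_induct)
    case (less n)
    have "fps_nth (A * B) n = fps_nth B n + (\<Sum>i=1..n. fps_nth A i * fps_nth B (n - i))"
      unfolding fps_mult_nth by (subst sum.atLeast_Suc_atMost) (auto simp: A(2))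
    then have "fps_nth B n = fps_nth 1 n - (\<Sum>i=1..n. fps_nth A i * fps_nth B (n - i))"
      using AB by (simp add: algebra_simps)
    also have "\<dots> \<in> \<int>"
      using A(1) less by (intro Ints_diff Ints_sum Ints_mult) (auto simp: integral_fps_def fps_one_nth)
    finally show ?case .
  qed
  then show ?thesis by (simp add: integral_fps_def B_def)
qed

text \<open>Multiplication by a series \<open>1 + O(X ^ k)\<close> leaves the coefficients below \<open>k\<close> unchanged.\<close>

definition fps_gap :: "nat \<Rightarrow> complex fps \<Rightarrow> bool" where
  "fps_gap k A \<longleftrightarrow> fps_nth A 0 = 1 \<and> (\<forall>i. 0 < i \<longrightarrow> i < k \<longrightarrow> fps_nth A i = 0)"

lemma fps_gap_mult_nth:
  assumes "fps_gap k A"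
  shows "j < k \<Longrightarrow> fps_nth (A * B) j = fps_nth B j"
    and "k \<ge> 1 \<Longrightarrow> fps_nth (A * B) k = fps_nth B k + fps_nth A k * fps_nth B 0"
proof -
  have split: "fps_nth (A * B) n = fps_nth B n + (\<Sum>i=1..n. fps_nth A i * fps_nth B (n - i))" for n
    unfolding fps_mult_nth using assms by (subst sum.atLeast_Suc_atMost) (auto simp: fps_gap_def)
  show "fps_nth (A * B) j = fps_nth B j" if "j < k"
    unfolding split using assms that by (auto simp: fps_gap_def intro!: sum.neutral)
  show "fps_nth (A * B) k = fps_nth B k + fps_nth A k * fps_nth B 0" if "k \<ge> 1"
  proof -
    have "(\<Sum>i=1..k. fps_nth A i * fps_nth B (k - i)) = (\<Sum>i\<in>{k}. fps_nth A i * fps_nth B (k - i))"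
      using assms that by (intro sum.mono_neutral_right) (auto simp: fps_gap_def)
    then show ?thesis unfolding split by simp
  qed
qed

text \<open>The expansion of \<open>(1 - y ^ k) powi n\<close>.\<close>

definition power_factor :: "nat \<Rightarrow> int \<Rightarrow> complex fps" where
  "power_factor k n = (if n \<ge> 0 then (1 - fps_X ^ k) ^ nat n else inverse (1 - fps_X ^ k) ^ nat (- n))"

lemma power_factor_expansion:
  assumes "k \<ge> 1"
  shows "(\<lambda>y. (1 - y ^ k) powi n) has_fps_expansion power_factor k n"
proof (cases "n \<ge> 0")
  case True
  then show ?thesis unfolding power_factor_def by (auto intro!: fps_expansion_intros simp: power_int_def)
next
  case False
  have "(\<lambda>y::complex. inverse (1 - y ^ k) ^ nat (- n)) has_fps_expansion inverse (1 - fps_X ^ k) ^ nat (- n)"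
    using assms by (intro fps_expansion_intros) auto
  then show ?thesis using False unfolding power_factor_def by (simp add: power_int_def)
qed

lemma power_factor_gap:
  assumes k: "k \<ge> 1"
  shows "integral_fps (power_factor k n)" "fps_gap k (power_factor k n)"
    "fps_nth (power_factor k n) k = - of_int n"
proof -
  define A :: "complex fps" where "A = 1 - fps_X ^ k"
  have A0: "fps_nth A 0 = 1" using k by (simp add: A_def)
  have iA: "integral_fps A" by (auto simp: integral_fps_def A_def fps_one_nth)
  have pow: "fps_gap k (B ^ m) \<and> fps_nth (B ^ m) k = of_nat m * fps_nth B k" if B: "fps_gap k B" for B m
  proof (induction m)
    case 0
    show ?case using k by (auto simp: fps_gap_def fps_one_nth)
  next
    case (Suc m)
    have "fps_gap k (B ^ Suc m)"
      using Suc fps_gap_mult_nth(1)[OF B, of _ "B ^ m"] k B by (auto simp: fps_gap_def)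
    moreover have "fps_nth (B ^ Suc m) k = of_nat (Suc m) * fps_nth B k"
      using Suc fps_gap_mult_nth(2)[OF B k, of "B ^ m"] by (simp add: fps_gap_def algebra_simps)
    ultimately show ?case ..
  qed
  have gA: "fps_gap k A" "fps_nth A k = - 1" using k by (auto simp: fps_gap_def A_def fps_one_nth)
  have AB: "A * inverse A = 1" using A0 by (intro inverse_mult_eq_1') simp
  have "fps_nth (inverse A) j = fps_nth 1 j" if "j < k" for j
    using fps_gap_mult_nth(1)[OF gA(1) that, of "inverse A"] unfolding AB by simp
  then have gB: "fps_gap k (inverse A)"
    unfolding fps_gap_def using k by (simp only: fps_one_nth) auto
  have Bk: "fps_nth (inverse A) k = 1"
    using fps_gap_mult_nth(2)[OF gA(1) k, of "inverse A"] gA gB k unfolding AB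
    by (auto simp: fps_gap_def fps_one_nth)
  show "integral_fps (power_factor k n)"
    unfolding power_factor_def A_def[symmetric]
    using iA A0 by (auto intro: integral_fps_power integral_fps_inverse)
  show "fps_gap k (power_factor k n)"
    unfolding power_factor_def A_def[symmetric] using pow[OF gA(1)] pow[OF gB] by auto
  show "fps_nth (power_factor k n) k = - of_int n"
    unfolding power_factor_def A_def[symmetric]
    using pow[OF gA(1), of "nat n"] pow[OF gB, of "nat (- n)"] gA(2) Bk by auto
qed

text \<open>At each step the coefficient of order \<open>K + 1\<close>, which is an integer, is cancelled by a power of
  \<open>1 - X ^ (K + 1)\<close>. The floor only converts that integer from the complex numbers.\<close>

primrec exponent_series :: "nat \<Rightarrow> nat \<Rightarrow> complex fps" where
  "exponent_series u 0 = 1 + of_nat u * fps_X"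
| "exponent_series u (Suc K) =
     exponent_series u K * power_factor (Suc K) \<lfloor>Re (fps_nth (exponent_series u K) (Suc K))\<rfloor>"

definition zeta_exponent :: "nat \<Rightarrow> nat \<Rightarrow> int" where
  "zeta_exponent u k = \<lfloor>Re (fps_nth (exponent_series u (k - 1)) k)\<rfloor>"

lemma exponent_series_gap:
  "integral_fps (exponent_series u K) \<and> fps_gap (Suc K) (exponent_series u K)"
proof (induction K)
  case 0
  have "integral_fps (1 + of_nat u * fps_X)"
    unfolding integral_fps_def by (auto simp: fps_one_nth fps_of_nat[symmetric] fps_X_def)
  then show ?case by (simp add: fps_gap_def)
next
  case (Suc K)
  define A where "A = exponent_series u K"
  define n where "n = \<lfloor>Re (fps_nth A (Suc K))\<rfloor>"
  have A: "integral_fps A" "fps_gap (Suc K) A" using Suc by (auto simp: A_def)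
  have n: "of_int n = fps_nth A (Suc K)"
    using A(1) by (auto simp: integral_fps_def n_def elim!: Ints_cases allE[of _ "Suc K"])
  note V = power_factor_gap[of "Suc K" n]
  have E: "exponent_series u (Suc K) = A * power_factor (Suc K) n" by (simp add: A_def n_def)
  have "fps_nth (A * power_factor (Suc K) n) i = 0" if "0 < i" "i < Suc (Suc K)" for i
  proof (cases "i = Suc K")
    case True
    then show ?thesis
      using fps_gap_mult_nth(2)[OF A(2), of "power_factor (Suc K) n"] V(2,3) n by (simp add: fps_gap_def)
  next
    case False
    then show ?thesis
      using fps_gap_mult_nth(1)[OF A(2), of i "power_factor (Suc K) n"] V(2) that by (simp add: fps_gap_def)
  qed
  moreover have "fps_nth (A * power_factor (Suc K) n) 0 = 1"
    using fps_gap_mult_nth(1)[OF A(2), of 0 "power_factor (Suc K) n"] V(2) by (simp add: fps_gap_def)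
  ultimately show ?case unfolding E using A(1) V(1) by (auto simp: fps_gap_def intro: integral_fps_mult)
qed

lemma exponent_series_expansion:
  "(\<lambda>y. (1 + of_nat u * y) * (\<Prod>k=1..K. (1 - y ^ k) powi zeta_exponent u k)) has_fps_expansion exponent_series u K"
proof (induction K)
  case 0
  have "(\<lambda>y::complex. 1 + of_nat u * y) has_fps_expansion 1 + fps_const (of_nat u) * fps_X"
    by (intro fps_expansion_intros)
  then show ?case by (simp add: fps_of_nat)
next
  case (Suc K)
  have "(\<lambda>y. ((1 + of_nat u * y) * (\<Prod>k=1..K. (1 - y ^ k) powi zeta_exponent u k)) * (1 - y ^ Suc K) powi zeta_exponent u (Suc K))
     has_fps_expansion exponent_series u K * power_factor (Suc K) (zeta_exponent u (Suc K))"
    by (intro has_fps_expansion_mult Suc power_factor_expansion) simp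
  then show ?case by (simp add: zeta_exponent_def mult.assoc)
qed

text \<open>The series has integer coefficients and no terms of orders \<open>1, \<dots>, K\<close>; the remaining tail is bounded by
  its sum of absolute values at a radius below one.\<close>

lemma zeta_exponent_correction:
  assumes r: "0 < r" "r < 1"
  shows "\<exists>B. \<forall>y::complex. norm y \<le> r \<longrightarrow>
    norm ((1 + of_nat u * y) * (\<Prod>k=1..K. (1 - y ^ k) powi zeta_exponent u k) - 1) \<le> B * norm y ^ Suc K"
proof -
  define H where "H = (\<lambda>y::complex. (1 + of_nat u * y) * (\<Prod>k=1..K. (1 - y ^ k) powi zeta_exponent u k))"
  define a where "a = (\<lambda>n. fps_nth (exponent_series u K) n)"
  have "H holomorphic_on ball 0 1"
    unfolding H_def by (intro holomorphic_intros) (use one_minus_power_nonzero in auto)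
  then have "H holomorphic_on eball 0 1" by (simp add: one_ereal_def)
  then have H: "(\<lambda>n. a n * y ^ n) sums H y" if "norm y < 1" for y
    unfolding a_def using that exponent_series_expansion[of u K]
    by (intro has_fps_expansion_imp_sums_complex[where r = 1]) (auto simp: H_def one_ereal_def)
  have a0: "a 0 = 1" "\<And>n. 0 < n \<Longrightarrow> n < Suc K \<Longrightarrow> a n = 0"
    using exponent_series_gap[of u K] by (auto simp: a_def fps_gap_def)
  define r' where "r' = (r + 1) / 2"
  have r': "r < r'" "r' < 1" using r by (auto simp: r'_def)
  have "summable (\<lambda>n. a n * of_real r' ^ n)" using H[of "of_real r'"] r r' by (auto simp: sums_iff)
  then have "summable (\<lambda>n. norm (a n * of_real r ^ n))"
    by (rule powser_insidea) (use r r' in auto)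
  then have S: "summable (\<lambda>n. norm (a n) * r ^ n)" using r by (simp add: norm_mult norm_power)
  then have S1: "summable (\<lambda>n. norm (a (n + Suc K)) * r ^ n * r ^ Suc K)"
    using summable_ignore_initial_segment[OF S, of "Suc K"] by (simp add: power_add mult_ac)
  then have S2: "summable (\<lambda>n. norm (a (n + Suc K)) * r ^ n)"
    using r summable_mult_D[of "r ^ Suc K"] by (simp add: mult.commute[of _ "r * r ^ K"])
  define B where "B = (\<Sum>n. norm (a (n + Suc K)) * r ^ n)"
  have "norm (H y - 1) \<le> B * norm y ^ Suc K" if y: "norm y \<le> r" for y
  proof -
    have "(\<Sum>n<Suc K. a n * y ^ n) = 1"
      by (subst sum.lessThan_Suc_shift) (simp add: a0)
    then have "(\<lambda>n. a (n + Suc K) * y ^ (n + Suc K)) sums (H y - 1)"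
      using sums_split_initial_segment[OF H[of y], of "Suc K"] y r by simp
    moreover have "(\<lambda>n. norm (a (n + Suc K)) * r ^ n * norm y ^ Suc K) sums (B * norm y ^ Suc K)"
      unfolding B_def by (intro sums_mult2 summable_sums S2)
    moreover have "norm (a (n + Suc K) * y ^ (n + Suc K)) \<le> norm (a (n + Suc K)) * r ^ n * norm y ^ Suc K" for n
      unfolding norm_mult norm_power power_add mult.assoc[symmetric] using y
      by (intro mult_right_mono mult_left_mono power_mono) auto
    ultimately show ?thesis by (rule norm_sums_le)
  qed
  then show ?thesis unfolding H_def by blast
qed

text \<open>For \<open>u = 1\<close> the factorisation \<open>1 + y = (1 - y\<^sup>2) / (1 - y)\<close> is finite.\<close>

lemma zeta_exponent_1:
  shows "zeta_exponent 1 1 = 1" "zeta_exponent 1 2 = - 1" "k \<ge> 3 \<Longrightarrow> zeta_exponent 1 k = 0"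
proof -
  define X :: "complex fps" where "X = fps_X"
  have e0: "exponent_series 1 0 = 1 + X" by (simp add: X_def)
  show z1: "zeta_exponent 1 1 = 1" by (simp add: zeta_exponent_def)
  have e1: "exponent_series 1 1 = 1 - X ^ 2"
    using z1 by (simp add: zeta_exponent_def power_factor_def e0) (simp add: X_def algebra_simps power2_eq_square)
  show z2: "zeta_exponent 1 2 = - 1"
    using e1 by (simp add: zeta_exponent_def X_def fps_one_nth floor_eq_iff)
  have e2: "exponent_series 1 2 = 1"
  proof -
    have "exponent_series 1 2 = exponent_series 1 1 * power_factor 2 (- 1)"
      using z2 by (simp add: zeta_exponent_def numeral_2_eq_2)
    also have "\<dots> = (1 - X ^ 2) * inverse (1 - X ^ 2)" unfolding e1 by (simp add: power_factor_def X_def)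
    also have "\<dots> = 1" by (intro inverse_mult_eq_1') (simp add: X_def)
    finally show ?thesis .
  qed
  have e: "exponent_series 1 (K + 2) = 1" for K
  proof (induction K)
    case 0
    show ?case using e2 by (simp add: numeral_2_eq_2)
  next
    case (Suc K)
    have "exponent_series 1 (Suc K + 2) = exponent_series 1 (Suc (K + 2))" by simp
    then show ?case unfolding exponent_series.simps(2) Suc by (simp add: power_factor_def fps_one_nth)
  qed
  assume "k \<ge> 3"
  then obtain K where "k = 3 + K" using le_Suc_ex by blast
  then have K: "k - 1 = K + 2" "k \<noteq> 0" by simp_all
  then show "zeta_exponent 1 k = 0" unfolding zeta_exponent_def K(1) e by (simp add: fps_one_nth)
qed

section \<open>The boundary of near-linear Euler products\<close>

lemma prime_powers_eq:
  assumes "prime p" "prime q" "p ^ m = q ^ n" "m > 0"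
  shows "p = (q::nat)"
proof -
  have "p dvd q ^ n" using assms by (metis dvd_power)
  then have "p dvd q" using assms(1) prime_dvd_power by blast
  then show ?thesis using assms primes_dvd_imp_eq by blast
qed

text \<open>A solution \<open>z\<close> of \<open>p powr (- z) = y\<close> for \<open>y < 0\<close>. The solutions form a vertical progression with step
  \<open>2 \<pi> / ln p\<close>; the one next to height \<open>t\<close> is taken.\<close>

definition root_point :: "real \<Rightarrow> nat \<Rightarrow> real \<Rightarrow> complex" where
  "root_point t p y = Complex (- ln (- y) / ln (real p))
     (pi * (2 * of_int \<lfloor>t * ln (real p) / (2 * pi)\<rfloor> + 1) / ln (real p))"

lemma root_point_powr:
  assumes "prime p" "y < 0"
  shows "of_nat p powr (- root_point t p y) = of_real y"
proof -
  define L where "L = ln (real p)"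
  define j where "j = \<lfloor>t * L / (2 * pi)\<rfloor>"
  have L: "L > 0" using prime_gt_1_nat[OF assms(1)] by (simp add: L_def)
  have "- root_point t p y * of_real L = of_real (ln (- y)) - \<i> * of_real (pi * (2 * of_int j + 1))"
    using L by (simp add: root_point_def complex_eq_iff L_def[symmetric] j_def)
  moreover have "ln (of_nat p :: complex) = of_real L"
    using prime_gt_0_nat[OF assms(1)] by (simp add: L_def Ln_of_nat)
  ultimately have "of_nat p powr (- root_point t p y) = exp (of_real (ln (- y)) - \<i> * of_real (pi * (2 * of_int j + 1)))"
    using prime_gt_0_nat[OF assms(1)] by (simp add: powr_def)
  also have "\<dots> = of_real (- y) / exp (\<i> * of_real (pi * (2 * of_int j + 1)))"
    using assms(2) by (simp add: exp_diff exp_of_real[symmetric] del: exp_of_real) (simp add: exp_of_real)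
  also have "exp (\<i> * of_real (pi * (2 * of_int j + 1))) = -1"
    using exp_integer_2pi_plus1[of "of_int j"] by (simp add: mult_ac)
  finally show ?thesis by simp
qed

text \<open>On the real axis \<open>p powr (- z)\<close> is positive.\<close>

lemma root_point_Im_nonzero:
  assumes "prime p"
  shows "Im (root_point t p y) \<noteq> 0"
proof -
  define n where "n = 2 * \<lfloor>t * ln (real p) / (2 * pi)\<rfloor> + 1"
  have "n \<noteq> 0" unfolding n_def by presburger
  then have "real_of_int n \<noteq> 0" by simp
  moreover have "Im (root_point t p y) = pi * real_of_int n / ln (real p)"
    by (simp add: root_point_def n_def)
  ultimately show ?thesis using prime_gt_1_nat[OF assms] by simp
qed

text \<open>Equal imaginary parts give \<open>a ln q = b ln p\<close> with odd integers \<open>a\<close> and \<open>b\<close>, which unique factorisation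
  excludes for \<open>p \<noteq> q\<close>.\<close>

lemma root_point_inj:
  assumes p: "prime p" "prime q" and eq: "root_point t p x = root_point t q y"
  shows "p = q"
proof -
  define a where "a = 2 * \<lfloor>t * ln (real p) / (2 * pi)\<rfloor> + 1"
  define b where "b = 2 * \<lfloor>t * ln (real q) / (2 * pi)\<rfloor> + 1"
  have pos: "ln (real p) > 0" "ln (real q) > 0" 
    using prime_gt_1_nat[OF p(1)] prime_gt_1_nat[OF p(2)] by simp_all
  have "pi * of_int a / ln (real p) = pi * of_int b / ln (real q)"
    using eq by (simp add: root_point_def a_def b_def)
  then have "of_int a * ln (real q) = of_int b * ln (real p)"
    using pos by (simp add: field_simps)
  then have "\<bar>of_int a * ln (real q)\<bar> = \<bar>of_int b * ln (real p)\<bar>" by simp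
  then have "real (nat \<bar>a\<bar>) * ln (real q) = real (nat \<bar>b\<bar>) * ln (real p)"
    using pos by (simp add: abs_mult)
  then have "ln (real q ^ nat \<bar>a\<bar>) = ln (real p ^ nat \<bar>b\<bar>)"
    using p by (simp add: ln_realpow prime_gt_0_nat)
  then have "real q ^ nat \<bar>a\<bar> = real p ^ nat \<bar>b\<bar>"
    using p by (subst (asm) ln_inj_iff) (auto simp: prime_gt_0_nat)
  then have "p ^ nat \<bar>b\<bar> = q ^ nat \<bar>a\<bar>" by (metis of_nat_eq_iff of_nat_power)
  moreover have "b \<noteq> 0" unfolding b_def by presburger
  ultimately show ?thesis using p by (intro prime_powers_eq[of p q "nat \<bar>b\<bar>"]) auto
qed

lemma root_point_close:
  assumes p: "prime p" and z0: "Re z0 = 0" and y: "-1 < y" "y \<le> - \<eta>" "\<eta> > 0"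
  shows "norm (root_point (Im z0) p y - z0) \<le> (pi - ln \<eta>) / ln (real p)"
proof -
  define L where "L = ln (real p)"
  have L: "L > 0" using prime_gt_1_nat[OF p] by (simp add: L_def)
  define x where "x = Im z0 * L / (2 * pi)"
  have "\<bar>Re (root_point (Im z0) p y - z0)\<bar> \<le> - ln \<eta> / L"
  proof -
    have "ln (- y) \<le> 0" using y by simp
    moreover have "ln \<eta> \<le> ln (- y)" using y by simp
    ultimately show ?thesis using L z0 by (simp add: root_point_def L_def[symmetric] abs_div divide_right_mono)
  qed
  moreover have "\<bar>Im (root_point (Im z0) p y - z0)\<bar> \<le> pi / L"
  proof -
    have "Im (root_point (Im z0) p y - z0) = (2 * pi / L) * (of_int \<lfloor>x\<rfloor> + 1 / 2 - x)"
      using L by (simp add: root_point_def L_def[symmetric] x_def) (simp add: field_simps)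
    moreover have "\<bar>of_int \<lfloor>x\<rfloor> + 1 / 2 - x\<bar> \<le> 1 / 2" by linarith
    ultimately have "\<bar>Im (root_point (Im z0) p y - z0)\<bar> \<le> (2 * pi / L) * (1 / 2)"
      using L by (simp only: abs_mult) (intro mult_mono; simp)
    then show ?thesis by simp
  qed
  ultimately show ?thesis using cmod_le[of "root_point (Im z0) p y - z0"] unfolding L_def[symmetric]
    by (simp add: diff_divide_distrib)
qed

lemma meromorphic_zero_dichotomy:
  assumes "f meromorphic_on U" "z \<in> U"
  shows "eventually (\<lambda>w. f w = 0) (at z) \<or> eventually (\<lambda>w. f analytic_on {w} \<and> f w \<noteq> 0) (at z)"
proof (cases "frequently (\<lambda>w. f w = 0) (at z)")
  case True
  then show ?thesis
    using assms not_essential_frequently_0_imp_eventually_0[of f z] meromorphic_on_subset[of f U "{z}"]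
    by (auto simp: meromorphic_at_iff)
next
  case False
  have "eventually (\<lambda>w. f analytic_on {w}) (at z)"
    using meromorphic_on_imp_not_islimpt_singularities[OF assms]
    by (simp add: islimpt_conv_frequently_at frequently_def)
  moreover have "eventually (\<lambda>w. f w \<noteq> 0) (at z)" using False by (simp add: frequently_def)
  ultimately have "eventually (\<lambda>w. f analytic_on {w} \<and> f w \<noteq> 0) (at z)" by (rule eventually_conj)
  then show ?thesis ..
qed

lemma zeta_zero_pairs_summable:
  assumes a: "a > 0"
  shows "(\<lambda>(k, s). exp (- a * real k) * exp (- a * norm s)) summable_on (UNIV \<times> zeta_zeros)"
proof (rule summable_on_SigmaI)
  have Z: "(\<lambda>s. exp (- a * norm s)) summable_on zeta_zeros" by (rule zeta_zeros_exp_summable[OF a])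
  show "((\<lambda>s. case (k, s) of (k, s) \<Rightarrow> exp (- a * real k) * exp (- a * norm s)) has_sum
      (exp (- a * real k) * infsum (\<lambda>s. exp (- a * norm s)) zeta_zeros)) zeta_zeros" for k :: nat
    unfolding prod.case by (intro has_sum_cmult_right has_sum_infsum Z)
  have "summable (\<lambda>k. exp (- a) ^ k)" using a by (intro summable_geometric) simp
  then have "summable (\<lambda>k. norm (exp (- a * real k)))"
    by (simp add: exp_of_nat_mult[symmetric] mult.commute)
  then have "(\<lambda>k. exp (- a * real k)) summable_on UNIV"
    by (rule norm_summable_imp_summable_on)
  then show "(\<lambda>k. exp (- a * real k) * infsum (\<lambda>s. exp (- a * norm s)) zeta_zeros) summable_on UNIV"
    by (rule summable_on_cmult_left)
qed auto

text \<open>There are too many primes to attach to each of them its own pair of an index \<open>k\<close> and a zero \<open>\<rho>\<close> of zeta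
  with \<open>k\<close> and \<open>norm \<rho>\<close> of order \<open>ln p\<close>: the sum of the reciprocals of the primes would be bounded by a
  convergent double sum over \<open>k\<close> and \<open>\<rho>\<close>.\<close>

lemma sparse_prime_assignment_False:
  fixes k :: "nat \<Rightarrow> nat" and \<rho> :: "nat \<Rightarrow> complex"
  assumes a: "a > 0"
    and inj: "inj_on (\<lambda>p. (k p, \<rho> p)) {p. prime p \<and> p \<ge> n0}"
    and zero: "\<And>p. prime p \<Longrightarrow> p \<ge> n0 \<Longrightarrow> \<rho> p \<in> zeta_zeros"
    and bound: "\<And>p. prime p \<Longrightarrow> p \<ge> n0 \<Longrightarrow> 1 / real p \<le> exp (- a * real (k p)) * exp (- a * norm (\<rho> p))"
  shows False
proof -
  define S where "S = {p. prime p \<and> p \<ge> n0}"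
  define g where "g = (\<lambda>(k, s). exp (- a * real k) * exp (- a * norm (s :: complex)))"
  have "g summable_on (\<lambda>p. (k p, \<rho> p)) ` S"
    by (rule summable_on_subset_banach[OF zeta_zero_pairs_summable[OF a, folded g_def]])
       (use zero in \<open>auto simp: S_def\<close>)
  then have "(g \<circ> (\<lambda>p. (k p, \<rho> p))) summable_on S"
    using inj by (subst (asm) summable_on_reindex) (auto simp: S_def)
  then have "(\<lambda>p. 1 / real p) summable_on S"
    by (rule summable_on_comparison_test) (use bound in \<open>auto simp: S_def g_def\<close>)
  then have "(\<lambda>p. if p \<in> S then 1 / real p else 0) summable_on UNIV"
    by (rule summable_on_cong_neutral[THEN iffD1, rotated -1]) auto
  then have sum: "summable (\<lambda>p. if p \<in> S then 1 / real p else 0)"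
    by (rule summable_on_imp_summable)
  have ev: "\<forall>\<^sub>F p in sequentially. (if p \<in> S then 1 / real p else 0) = (if prime p then 1 / real p else 0)"
    using eventually_ge_at_top[of n0] by eventually_elim (auto simp: S_def)
  have "summable (\<lambda>p::nat. if prime p then 1 / real p else 0)"
    using sum summable_cong[OF ev] by simp
  with prime_reciprocals_diverge show False by blast
qed

context near_linear_euler_product
begin

text \<open>On the domain of absolute convergence there is a point with nonzero value.\<close>

lemma continuation_nonzero_cosparse: "\<forall>\<^sub>\<approx>z\<in>{z. Re z > 0}. continuation z \<noteq> 0"
proof -
  have "connected {z. Re z > 0}" by (intro convex_connected convex_halfspace_Re_gt)
  then consider "\<forall>\<^sub>\<approx>z\<in>{z. Re z > 0}. continuation z = 0" | "\<forall>\<^sub>\<approx>z\<in>{z. Re z > 0}. continuation z \<noteq> 0"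
    using meromorphic_imp_constant_or_avoid[OF continuation_meromorphic open_halfspace_Re_gt] by blast
  then show ?thesis
  proof cases
    case 1
    obtain z where z: "Re z > 1" "regular_part 0 z \<noteq> 0" using regular_part_nonzero_somewhere[of 0] by auto
    have "isCont (regular_part 0) z"
      using regular_part_holomorphic[of 0] z(1)
      by (intro continuous_on_interior[OF holomorphic_on_imp_continuous_on])
         (auto simp: interior_open open_halfspace_Re_gt)
    then have "\<forall>\<^sub>F w in nhds z. regular_part 0 w \<noteq> 0"
      using z(2) by (intro tendsto_imp_eventually_ne) (auto simp: isCont_def tendsto_at_iff_tendsto_nhds)
    moreover have "\<forall>\<^sub>F w in nhds z. continuation w = regular_part 0 w"
      using continuation_eventually_level[of 0 z] z(1) by (simp add: continuation_level_def)
    ultimately have "\<forall>\<^sub>F w in at z. continuation w \<noteq> 0"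
      unfolding eventually_nhds_conv_at by (auto elim: eventually_elim2)
    moreover have "\<forall>\<^sub>F w in at z. continuation w = 0"
      using eventually_cosparse_imp_eventually_at[OF 1, of z] z(1) by (simp add: at_within_open[OF _ open_halfspace_Re_gt])
    ultimately have "\<forall>\<^sub>F w in at z. False" by eventually_elim simp
    then show ?thesis by simp
  qed
qed

text \<open>A root of a local factor is a zero of the regular part of every level. If no \<open>\<zeta>(k z)\<close> with nonzero
  exponent vanishes there, all other factors are continuous and the product tends to \<open>0\<close>. Since \<open>\<zeta>\<close> has
  no zeros to the right of \<open>1\<close>, only \<open>k\<close> with \<open>k Re z \<le> 1\<close> can do the cancelling.\<close>

lemma continuation_zero_cancelled:
  assumes p: "prime p" "local_factor p (of_nat p powr (- z)) = 0"
    and z: "Re z > 0" "Im z \<noteq> 0"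
    and R: "isCont R z"
    and G: "isCont G z" "G z \<noteq> 0" "\<forall>\<^sub>F w in at z. G w = R w * continuation w"
  shows "\<exists>k\<ge>1. c k \<noteq> 0 \<and> real k * Re z \<le> 1 \<and> of_nat k * z \<in> zeta_zeros"
proof (rule ccontr)
  assume neg: "\<not> ?thesis"
  have ne1: "of_nat k * z \<noteq> 1" for k
    using z(2) by (cases "k = 0") (auto simp: complex_eq_iff)
  obtain K where K: "Re z > 1 / real (Suc K)" using exists_level z(1) by blast
  have zk: "zeta (of_nat k * z) \<noteq> 0" if k: "k \<ge> 1" "c k \<noteq> 0" for k
  proof (cases "real k * Re z > 1")
    case True
    then show ?thesis by (intro zeta_euler_product(1)) simp
  next
    case False
    then have "real k * Re z \<le> 1" by simp
    then have "of_nat k * z \<notin> zeta_zeros" using neg k by blast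
    moreover have "0 \<le> real k * Re z" using z(1) by simp
    ultimately have "zeta_reg (of_nat k * z) \<noteq> 0" using False by (auto simp: zeta_zeros_def)
    then show ?thesis using ne1 by (simp add: zeta_def)
  qed
  have cz: "isCont (\<lambda>w. zeta (of_nat k * w) powi c k) z" if "k \<ge> 1" for k
  proof (cases "c k = 0")
    case False
    have "0 \<le> real k * Re z" using z(1) by simp
    then have in_dom: "of_nat k * z \<in> {s. Re s > - 1} - {1}" using ne1 by simp
    have "isCont zeta (of_nat k * z)"
      using zeta_holomorphic in_dom
      by (intro continuous_on_interior[OF holomorphic_on_imp_continuous_on])
         (auto simp: interior_open open_halfspace_Re_gt open_Diff)
    moreover have "isCont (\<lambda>w. of_nat k * w :: complex) z" by (intro continuous_intros)
    ultimately have "isCont (\<lambda>w. zeta (of_nat k * w)) z"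
      using isCont_o2[where f = "\<lambda>w. of_nat k * w" and g = zeta] by blast
    then show ?thesis using zk[OF that False] by (intro continuous_intros) auto
  qed simp
  have "isCont (regular_part K) z"
    using regular_part_holomorphic[of K] K
    by (intro continuous_on_interior[OF holomorphic_on_imp_continuous_on])
       (auto simp: interior_open open_halfspace_Re_gt)
  moreover have "isCont (\<lambda>w. \<Prod>k=1..K. zeta (of_nat k * w) powi c k) z"
    unfolding isCont_def by (intro tendsto_prod cz[unfolded isCont_def]) simp
  ultimately have "isCont (\<lambda>w. R w * continuation_level K w) z"
    unfolding continuation_level_def by (intro isCont_mult R)
  moreover have "regular_part K z = 0"
    using K z(1) by (intro regular_part_zero[OF p]) (auto simp: field_simps)
  ultimately have lim: "((\<lambda>w. R w * continuation_level K w) \<longlongrightarrow> 0) (at z)"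
    by (simp add: isCont_def continuation_level_def)
  have "\<forall>\<^sub>F w in at z. continuation w = continuation_level K w"
    using continuation_eventually_level[OF K] by (auto simp: eventually_nhds_conv_at)
  with G(3) have "\<forall>\<^sub>F w in at z. R w * continuation_level K w = G w"
    by eventually_elim simp
  with lim have "(G \<longlongrightarrow> 0) (at z)" by (rule Lim_transform_eventually)
  then show False using G(1,2) tendsto_unique[of "at z" G] by (auto simp: isCont_def)
qed

text \<open>The points \<open>root_point (Im z0) p (y p)\<close> tend to \<open>z0\<close> from the right. A meromorphic function near \<open>z0\<close> that
  does not vanish identically has no zeros in a punctured neighbourhood, so at all but finitely many of these points
  the zero of the local factor must be cancelled by a zero \<open>\<rho> = k z\<close> of zeta. The points for distinct
  primes are distinct and \<open>k\<close> is of order \<open>ln p\<close>, and that is impossible because the zeros of zeta are too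
  sparse.\<close>

theorem natural_boundary:
  assumes \<eta>: "\<eta> > 0" and L: "L > 0"
    and roots: "\<And>p. prime p \<Longrightarrow> p \<ge> n0 \<Longrightarrow> -1 < y p \<and> y p \<le> - \<eta> \<and> local_factor p (of_real (y p)) = 0
        \<and> (\<forall>k\<ge>1. c k \<noteq> 0 \<longrightarrow> real k * (- ln (- y p)) \<le> ln (real p) \<longrightarrow> real k \<le> L * ln (real p))"
    and R: "\<And>z. Re z > 0 \<Longrightarrow> Im z \<noteq> 0 \<Longrightarrow> isCont R z" "\<forall>\<^sub>\<approx>z\<in>{z. Re z > 0}. R z \<noteq> 0"
    and G: "open U" "z0 \<in> U" "Re z0 = 0" "G meromorphic_on U"
      and near: "\<And>z. z \<in> U \<Longrightarrow> Re z > 0 \<Longrightarrow> \<forall>\<^sub>F w in at z. G w = R w * continuation w"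
  shows False
proof -
  consider "\<forall>\<^sub>F w in at z0. G w = 0" | "\<forall>\<^sub>F w in at z0. G analytic_on {w} \<and> G w \<noteq> 0"
    using meromorphic_zero_dichotomy[OF G(4,2)] by blast
  then show False
  proof cases
    case 1
    then obtain r where r: "r > 0" "\<And>w. w \<noteq> z0 \<Longrightarrow> dist w z0 < r \<Longrightarrow> G w = 0"
      by (auto simp: eventually_at)
    obtain r' where r': "r' > 0" "ball z0 r' \<subseteq> U" using G(1,2) openE by blast
    define e where "e = min r r' / 2"
    have e: "e > 0" "e < r" "e < r'" using r r' by (auto simp: e_def)
    define w where "w = z0 + of_real e"
    have w: "w \<in> U" "Re w > 0" "dist w z0 < r"
      using e r'(2) G(3) by (auto simp: w_def dist_norm subset_iff)
    have "\<forall>\<^sub>F v in at w. G v = 0"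
    proof -
      have "\<forall>\<^sub>F v in nhds w. v \<in> ball z0 r - {z0}"
        using w e by (intro eventually_nhds_in_open) (auto simp: dist_commute w_def)
      then have "\<forall>\<^sub>F v in nhds w. G v = 0" by eventually_elim (auto simp: dist_commute intro: r(2))
      then show ?thesis by (simp add: eventually_nhds_conv_at)
    qed
    moreover have "\<forall>\<^sub>F v in at w. continuation v \<noteq> 0" "\<forall>\<^sub>F v in at w. R v \<noteq> 0"
      using eventually_cosparse_imp_eventually_at[OF continuation_nonzero_cosparse, of w]
        eventually_cosparse_imp_eventually_at[OF R(2), of w] w(2)
      by (simp_all add: at_within_open[OF _ open_halfspace_Re_gt])
    moreover note near[OF w(1,2)]
    ultimately have "\<forall>\<^sub>F v in at w. False" by eventually_elim simp
    then show False by simp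
  next
    case 2
    then obtain r where r: "r > 0" "\<And>w. w \<noteq> z0 \<Longrightarrow> dist w z0 < r \<Longrightarrow> G analytic_on {w} \<and> G w \<noteq> 0"
      by (auto simp: eventually_at)
    obtain r' where r': "r' > 0" "ball z0 r' \<subseteq> U" using G(1,2) openE by blast
    define e where "e = min r r'"
    have e: "e > 0" "e \<le> r" "e \<le> r'" using r r' by (auto simp: e_def)
    define z where "z = (\<lambda>p. root_point (Im z0) p (y p))"
    have "((\<lambda>p. (pi - ln \<eta>) / ln (real p)) \<longlongrightarrow> 0) sequentially"
      by (intro tendsto_divide_0[OF tendsto_const] filterlim_at_top_imp_at_infinity
          filterlim_compose[OF ln_at_top filterlim_real_sequentially])
    then have "\<forall>\<^sub>F p in sequentially. (pi - ln \<eta>) / ln (real p) < e"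
      using e(1) by (rule order_tendstoD)
    then obtain n1 where n1: "\<And>p. p \<ge> n1 \<Longrightarrow> (pi - ln \<eta>) / ln (real p) < e"
      by (auto simp: eventually_sequentially)
    define n2 where "n2 = max n0 n1"
    define M where "M = norm z0 + e"
    have M: "M \<ge> 0" using e by (simp add: M_def)
    \<comment> \<open>Chosen so that \<open>k \<le> L ln p\<close> and \<open>norm z \<le> M\<close> give \<open>a (k + norm (k z)) \<le> ln p\<close>.\<close>
    define a where "a = 1 / (2 * L * (1 + M))"
    have a: "a > 0" using L M by (simp add: a_def)
    have ex: "\<exists>k\<ge>1. of_nat k * z p \<in> zeta_zeros \<and> real k \<le> L * ln (real p) \<and> norm (z p) \<le> M"
      if p: "prime p" "p \<ge> n2" for p
    proof -
      have y: "-1 < y p" "y p \<le> - \<eta>" "local_factor p (of_real (y p)) = 0"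
        using roots[OF p(1)] p(2) by (auto simp: n2_def)
      have lnp: "ln (real p) > 0" using prime_gt_1_nat[OF p(1)] by simp
      have "norm (z p - z0) \<le> (pi - ln \<eta>) / ln (real p)"
        unfolding z_def using root_point_close[OF p(1) G(3) y(1,2) \<eta>] .
      also have "\<dots> < e" using n1[of p] p(2) by (simp add: n2_def)
      finally have close: "norm (z p - z0) < e" .
      have rez: "Re (z p) = - ln (- y p) / ln (real p)" by (simp add: z_def root_point_def)
      have "Re (z p) > 0" unfolding rez using y \<eta> lnp by (intro divide_pos_pos) auto
      have nz0: "z p \<noteq> z0" using \<open>Re (z p) > 0\<close> G(3) by auto
      have "z p \<in> U" using close r'(2) e(3) by (auto simp: dist_norm norm_minus_commute subset_iff)
      have Gz: "G analytic_on {z p}" "G (z p) \<noteq> 0"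
        using r(2)[OF nz0] close e(2) by (auto simp: dist_norm)
      have Im: "Im (z p) \<noteq> 0" unfolding z_def by (rule root_point_Im_nonzero[OF p(1)])
      have "\<exists>k\<ge>1. c k \<noteq> 0 \<and> real k * Re (z p) \<le> 1 \<and> of_nat k * z p \<in> zeta_zeros"
      proof (rule continuation_zero_cancelled[OF p(1), where R = R and G = G])
        have "of_nat p powr (- z p) = of_real (y p)"
          unfolding z_def using y \<eta> by (intro root_point_powr p) simp
        then show "local_factor p (of_nat p powr (- z p)) = 0" using y(3) by simp
        show "isCont G (z p)" using Gz(1) analytic_at_imp_isCont by blast
      qed (use Gz near \<open>z p \<in> U\<close> \<open>Re (z p) > 0\<close> Im R(1) in auto)
      then obtain k where k: "k \<ge> 1" "c k \<noteq> 0" "real k * Re (z p) \<le> 1" "of_nat k * z p \<in> zeta_zeros" by blast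
      have "real k * (- ln (- y p)) \<le> ln (real p)" using k(3) lnp unfolding rez by (simp add: field_simps)
      then have "real k \<le> L * ln (real p)" using roots[OF p(1)] p(2) k(1,2) by (auto simp: n2_def)
      moreover have "norm (z p) \<le> M" using close norm_triangle_sub[of "z p" z0] by (simp add: M_def)
      ultimately show ?thesis using k by blast
    qed
    then obtain k where k: "\<And>p. prime p \<Longrightarrow> p \<ge> n2 \<Longrightarrow> k p \<ge> 1 \<and> of_nat (k p) * z p \<in> zeta_zeros
        \<and> real (k p) \<le> L * ln (real p) \<and> norm (z p) \<le> M"
      by metis
    show False
    proof (rule sparse_prime_assignment_False[OF a, of k "\<lambda>p. of_nat (k p) * z p" n2])
      show "inj_on (\<lambda>p. (k p, of_nat (k p) * z p)) {p. prime p \<and> n2 \<le> p}"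
      proof (rule inj_onI)
        fix p q assume pq: "p \<in> {p. prime p \<and> n2 \<le> p}" "q \<in> {p. prime p \<and> n2 \<le> p}"
          and eq: "(k p, of_nat (k p) * z p) = (k q, of_nat (k q) * z q)"
        have "k q \<noteq> 0" using k[of q] pq by auto
        then have "z p = z q" using eq by auto
        then show "p = q" using pq unfolding z_def by (intro root_point_inj) auto
      qed
    next
      fix p assume p: "prime p" "p \<ge> n2"
      note kp = k[OF p]
      have lnp: "ln (real p) > 0" using prime_gt_1_nat[OF p(1)] by simp
      have "real (k p) * norm (z p) \<le> (L * ln (real p)) * M"
        using kp L lnp by (intro mult_mono) auto
      then have "real (k p) + real (k p) * norm (z p) \<le> L * ln (real p) * (1 + M)"
        using kp by (simp add: algebra_simps)
      also have "\<dots> \<le> 2 * L * (1 + M) * ln (real p)"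
        using L M lnp by (simp add: mult_right_mono)
      finally have "a * (real (k p) + real (k p) * norm (z p)) \<le> a * (2 * L * (1 + M) * ln (real p))"
        using a by (intro mult_left_mono) auto
      also have "a * (2 * L * (1 + M) * ln (real p)) = ln (real p)"
        using L M unfolding a_def by simp
      finally have "exp (- ln (real p)) \<le> exp (- (a * (real (k p) + real (k p) * norm (z p))))" by simp
      also have "- (a * (real (k p) + real (k p) * norm (z p))) = - a * real (k p) + - a * norm (of_nat (k p) * z p)"
        by (simp add: norm_mult distrib_left)
      also have "exp (- ln (real p)) = 1 / real p"
        using prime_gt_0_nat[OF p(1)] by (simp add: exp_minus inverse_eq_divide)
      finally show "1 / real p \<le> exp (- a * real (k p)) * exp (- a * norm (of_nat (k p) * z p))"
        by (simp only: exp_add)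
    qed (use k in auto)
  qed
qed

end

section \<open>Subgroups of a product with the integers\<close>

text \<open>Maps with the same fibres have images of the same size, also when both are infinite.\<close>

lemma card_image_eq_same_kernel:
  assumes "\<And>x y. x \<in> S \<Longrightarrow> y \<in> S \<Longrightarrow> f x = f y \<longleftrightarrow> g x = g y"
  shows "card (f ` S) = card (g ` S)"
proof (rule bij_betw_same_card)
  define k where "k = (\<lambda>a. g (inv_into S f a))"
  have k: "k (f x) = g x" if "x \<in> S" for x
  proof -
    have "f (inv_into S f (f x)) = f x" using that by (intro f_inv_into_f) auto
    then show ?thesis unfolding k_def using assms that inv_into_into[of "f x" f S] by blast
  qed
  show "bij_betw k (f ` S) (g ` S)"
    unfolding bij_betw_def using k assms by (auto intro!: inj_onI simp: image_image)
qed

lemma (in group) coset_eq_iff: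
  assumes "subgroup H G" "x \<in> carrier G" "y \<in> carrier G"
  shows "H #> x = H #> y \<longleftrightarrow> x \<otimes> inv y \<in> H"
  using subgroup.rcos_module[OF assms(1) is_group assms(3,2)] repr_independence[OF _ assms(3,1), of x]
    rcos_self[OF assms(2,1)] by auto

lemma (in group) card_rcosets_eq:
  assumes "subgroup H G" and "\<And>x y. x \<in> carrier G \<Longrightarrow> y \<in> carrier G \<Longrightarrow> f x = f y \<longleftrightarrow> x \<otimes> inv y \<in> H"
  shows "card (rcosets H) = card (f ` carrier G)"
proof -
  have "rcosets H = (\<lambda>x. H #> x) ` carrier G" by (auto simp: RCOSETS_def)
  then show ?thesis using coset_eq_iff[OF assms(1)] assms(2) by (simp add: card_image_eq_same_kernel)
qed

definition subgroups_of_index :: "('a, 'b) monoid_scheme \<Rightarrow> nat \<Rightarrow> 'a set set" where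
  "subgroups_of_index G n = {H. subgroup H G \<and> card (rcosets\<^bsub>G\<^esub> H) = n}"

lemma iso_image_subgroups_of_index:
  assumes G: "group G" and G': "group G'" and h: "h \<in> iso G G'" and H: "H \<in> subgroups_of_index G n"
  shows "h ` H \<in> subgroups_of_index G' n"
proof -
  interpret G: group G by fact
  interpret G': group G' by fact
  interpret h: group_hom G G' h by unfold_locales (use h in \<open>auto simp: iso_def\<close>)
  have sH: "subgroup H G" using H by (simp add: subgroups_of_index_def)
  have Hc: "H \<subseteq> carrier G" using sH by (rule subgroup.subset)
  have inj: "inj_on h (carrier G)" and im: "h ` carrier G = carrier G'"
    using h by (auto simp: iso_def bij_betw_def)
  have sub: "subgroup (h ` H) G'" using sH by (rule h.subgroup_img_is_subgroup)
  define g where "g = (\<lambda>y. H #>\<^bsub>G\<^esub> (inv_into (carrier G) h y))"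
  have inv: "inv_into (carrier G) h (h x) = x" if "x \<in> carrier G" for x using inj that by simp
  have "card (rcosets\<^bsub>G'\<^esub> (h ` H)) = card (g ` carrier G')"
  proof (rule G'.card_rcosets_eq[OF sub])
    fix x' y' assume "x' \<in> carrier G'" "y' \<in> carrier G'"
    then obtain x y where x: "x \<in> carrier G" "x' = h x" and y: "y \<in> carrier G" "y' = h y" using im by blast
    have "x' \<otimes>\<^bsub>G'\<^esub> inv\<^bsub>G'\<^esub> y' = h (x \<otimes>\<^bsub>G\<^esub> inv\<^bsub>G\<^esub> y)" using x y by simp
    also have "\<dots> \<in> h ` H \<longleftrightarrow> x \<otimes>\<^bsub>G\<^esub> inv\<^bsub>G\<^esub> y \<in> H"
      using inj Hc x y by (intro inj_on_image_mem_iff) auto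
    also have "\<dots> \<longleftrightarrow> g x' = g y'" using G.coset_eq_iff[OF sH x(1) y(1)] by (simp add: g_def x y inv)
    finally show "g x' = g y' \<longleftrightarrow> x' \<otimes>\<^bsub>G'\<^esub> inv\<^bsub>G'\<^esub> y' \<in> h ` H" by simp
  qed
  also have "g ` carrier G' = rcosets\<^bsub>G\<^esub> H"
    unfolding im[symmetric] image_image by (auto simp: g_def inv RCOSETS_def)
  finally show ?thesis using H sub by (simp add: subgroups_of_index_def)
qed

lemma iso_bij_subgroups_of_index:
  assumes G: "group G" and G': "group G'" and h: "h \<in> iso G G'"
  shows "bij_betw (\<lambda>H. h ` H) (subgroups_of_index G n) (subgroups_of_index G' n)"
proof -
  interpret G: group G by fact
  define k where "k = inv_into (carrier G) h"
  have k: "k \<in> iso G' G" unfolding k_def using h by (rule G.iso_set_sym)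
  have inj: "inj_on h (carrier G)" and im: "h ` carrier G = carrier G'"
    using h by (auto simp: iso_def bij_betw_def)
  have c: "H \<subseteq> carrier G" if "H \<in> subgroups_of_index G n" for H
    using that subgroup.subset by (auto simp: subgroups_of_index_def)
  have c': "H \<subseteq> carrier G'" if "H \<in> subgroups_of_index G' n" for H
    using that subgroup.subset by (auto simp: subgroups_of_index_def)
  show ?thesis
  proof (rule bij_betw_byWitness[where f' = "\<lambda>H. k ` H"])
    show "\<forall>H\<in>subgroups_of_index G n. k ` h ` H = H"
    proof
      fix H assume "H \<in> subgroups_of_index G n"
      from c[OF this] show "k ` h ` H = H" unfolding k_def using inj by (simp add: inv_into_image_cancel)
    qed
    show "\<forall>H\<in>subgroups_of_index G' n. h ` k ` H = H"
    proof
      fix H assume "H \<in> subgroups_of_index G' n"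
      from c'[OF this] show "h ` k ` H = H" unfolding k_def using im by (simp add: image_inv_into_cancel)
    qed
    show "(\<lambda>H. h ` H) ` subgroups_of_index G n \<subseteq> subgroups_of_index G' n"
      using iso_image_subgroups_of_index[OF G G' h] by blast
    show "(\<lambda>H. k ` H) ` subgroups_of_index G' n \<subseteq> subgroups_of_index G n"
      using iso_image_subgroups_of_index[OF G' G k] by blast
  qed
qed

text \<open>For \<open>C\<close> a coset of \<open>H\<close>, the subgroup of \<open>G \<times> \<int>\<close> that meets \<open>G \<times> {0}\<close> in \<open>H\<close>, projects onto \<open>e \<int>\<close> and contains
  \<open>(v, e)\<close> for \<open>v\<close> in \<open>C\<close>.\<close>

definition slope_subgroup :: "('a, 'b) monoid_scheme \<Rightarrow> 'a set \<Rightarrow> 'a set \<Rightarrow> int \<Rightarrow> ('a \<times> int) set" where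
  "slope_subgroup G H C e = {(x, a). x \<in> carrier G \<and> e dvd a \<and> H #>\<^bsub>G\<^esub> x = C [^]\<^bsub>G Mod H\<^esub> (a div e)}"

text \<open>Products of cosets are kept as products in the quotient group, where the group laws apply.\<close>

declare mult_FactGroup [simp del]

locale abelian_with_subgroup = comm_group G for G (structure) +
  fixes H
  assumes sub: "subgroup H G"
begin

sublocale normal H G using sub by (rule subgroup_imp_normal)

abbreviation "Q \<equiv> G Mod H"
abbreviation "P \<equiv> G \<times>\<times> integer_group"

lemma Q_group: "group Q" by (rule factorgroup_is_group)

lemma P_group: "group P" by (intro DirProd_group is_group group_integer_group)

lemma carrier_Q: "carrier Q = rcosets H" by (simp add: FactGroup_def)

lemma coset_hom: "x \<in> carrier G \<Longrightarrow> y \<in> carrier G \<Longrightarrow> H #> (x \<otimes> y) = (H #> x) \<otimes>\<^bsub>Q\<^esub> (H #> y)"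
  using r_coset_hom_Mod by (auto simp: hom_def)

lemma coset_in_Q: "x \<in> carrier G \<Longrightarrow> H #> x \<in> carrier Q"
  by (simp add: carrier_Q rcosetsI subset)

lemma coset_inv: assumes "x \<in> carrier G" shows "H #> (inv x) = inv\<^bsub>Q\<^esub> (H #> x)"
proof -
  interpret h: group_hom G Q "\<lambda>x. H #> x"
    using Q_group is_group r_coset_hom_Mod by (auto simp: group_hom_def group_hom_axioms_def)
  show ?thesis using assms by simp
qed

lemma one_Q: "\<one>\<^bsub>Q\<^esub> = H" by (simp add: FactGroup_def)

lemma mem_iff: "x \<in> carrier G \<Longrightarrow> x \<in> H \<longleftrightarrow> H #> x = H"
  using coset_join1[OF _ _ sub] coset_join2[OF _ sub] by blast

lemma slope_subgroup_elem:
  assumes "p \<in> slope_subgroup G H C e" "e > 0"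
  shows "\<exists>x a. p = (x, a * e) \<and> x \<in> carrier G \<and> H #> x = C [^]\<^bsub>Q\<^esub> a"
proof -
  obtain x b where p: "p = (x, b)" "x \<in> carrier G" "e dvd b" "H #> x = C [^]\<^bsub>Q\<^esub> (b div e)"
    using assms(1) by (auto simp: slope_subgroup_def)
  then show ?thesis by (intro exI[of _ x] exI[of _ "b div e"]) simp
qed

lemma slope_subgroup_is_subgroup:
  assumes C: "C \<in> carrier Q" and e: "e > 0"
  shows "subgroup (slope_subgroup G H C e) P"
proof -
  interpret Q: group Q by (rule Q_group)
  interpret P: group P by (rule P_group)
  show ?thesis
  proof (rule P.subgroupI)
    show "slope_subgroup G H C e \<subseteq> carrier P" by (auto simp: slope_subgroup_def)
    have "(\<one>, 0) \<in> slope_subgroup G H C e"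
      using mem_iff[of \<one>] by (simp add: slope_subgroup_def one_Q)
    then show "slope_subgroup G H C e \<noteq> {}" by blast
  next
    fix p assume "p \<in> slope_subgroup G H C e"
    then obtain x a where p: "p = (x, a * e)" "x \<in> carrier G" "H #> x = C [^]\<^bsub>Q\<^esub> a"
      using slope_subgroup_elem e by blast
    have "inv\<^bsub>P\<^esub> p = (inv x, - (a * e))"
      using p by (simp add: inv_DirProd[OF is_group group_integer_group])
    moreover have "- (a * e) div e = - a" using e by (simp flip: mult_minus_left)
    ultimately show "inv\<^bsub>P\<^esub> p \<in> slope_subgroup G H C e"
      using p C by (simp add: slope_subgroup_def coset_inv Q.int_pow_neg)
  next
    fix p q assume "p \<in> slope_subgroup G H C e" "q \<in> slope_subgroup G H C e"
    then obtain x a y b where p: "p = (x, a * e)" "x \<in> carrier G" "H #> x = C [^]\<^bsub>Q\<^esub> a"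
      and q: "q = (y, b * e)" "y \<in> carrier G" "H #> y = C [^]\<^bsub>Q\<^esub> b"
      using slope_subgroup_elem e by meson
    have "p \<otimes>\<^bsub>P\<^esub> q = (x \<otimes> y, (a + b) * e)" using p q by (simp add: algebra_simps)
    then show "p \<otimes>\<^bsub>P\<^esub> q \<in> slope_subgroup G H C e"
      using p q C e by (simp add: slope_subgroup_def coset_hom Q.int_pow_mult)
  qed
qed

text \<open>A coset of the slope subgroup is determined by the second component modulo \<open>e\<close> together with the coset of
  \<open>H\<close> reached after moving the second component into \<open>{0..<e}\<close> along \<open>C\<close>.\<close>

lemma slope_subgroup_index:
  assumes C: "C \<in> carrier Q" and e: "e > 0"
  shows "card (rcosets\<^bsub>P\<^esub> (slope_subgroup G H C e)) = card (rcosets H) * nat e"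
proof -
  interpret Q: group Q by (rule Q_group)
  interpret P: group P by (rule P_group)
  define f where "f = (\<lambda>(x, a). ((H #> x) \<otimes>\<^bsub>Q\<^esub> C [^]\<^bsub>Q\<^esub> (- (a div e)), a mod e))"
  have "card (rcosets\<^bsub>P\<^esub> (slope_subgroup G H C e)) = card (f ` carrier P)"
  proof (rule P.card_rcosets_eq[OF slope_subgroup_is_subgroup[OF C e]])
    fix p q assume "p \<in> carrier P" "q \<in> carrier P"
    then obtain x a y b where p: "p = (x, a)" "x \<in> carrier G" and q: "q = (y, b)" "y \<in> carrier G"
      by (cases p, cases q) auto
    define X where "X = H #> x"
    define Y where "Y = H #> y"
    have XY: "X \<in> carrier Q" "Y \<in> carrier Q" using p q by (auto simp: X_def Y_def coset_in_Q)
    have pq: "p \<otimes>\<^bsub>P\<^esub> inv\<^bsub>P\<^esub> q = (x \<otimes> inv y, a - b)"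
      using p q by (simp add: inv_DirProd[OF is_group group_integer_group])
    have "p \<otimes>\<^bsub>P\<^esub> inv\<^bsub>P\<^esub> q \<in> slope_subgroup G H C e \<longleftrightarrow>
        e dvd a - b \<and> X \<otimes>\<^bsub>Q\<^esub> inv\<^bsub>Q\<^esub> Y = C [^]\<^bsub>Q\<^esub> ((a - b) div e)"
      unfolding pq using p q by (simp add: slope_subgroup_def coset_hom coset_inv X_def Y_def)
    also have "\<dots> \<longleftrightarrow> a mod e = b mod e \<and> X \<otimes>\<^bsub>Q\<^esub> C [^]\<^bsub>Q\<^esub> (- (a div e)) = Y \<otimes>\<^bsub>Q\<^esub> C [^]\<^bsub>Q\<^esub> (- (b div e))"
    proof (cases "e dvd a - b")
      case True
      then have mod: "a mod e = b mod e" by (simp add: mod_eq_dvd_iff)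
      have "a - b = (a div e - b div e) * e"
        using mod div_mult_mod_eq[of a e] div_mult_mod_eq[of b e] unfolding left_diff_distrib by linarith
      then have div: "(a - b) div e = a div e - b div e" using e by simp
      define m where "m = a div e"
      define n where "n = b div e"
      have CC: "C [^]\<^bsub>Q\<^esub> k \<in> carrier Q" for k :: int using C by simp
      have comm: "u \<otimes>\<^bsub>Q\<^esub> v = v \<otimes>\<^bsub>Q\<^esub> u" if "u \<in> carrier Q" "v \<in> carrier Q" for u v
        using abelian_FactGroup[OF sub] that by (rule comm_groupE(4))
      have "X \<otimes>\<^bsub>Q\<^esub> inv\<^bsub>Q\<^esub> Y = C [^]\<^bsub>Q\<^esub> (m - n) \<longleftrightarrow> X = C [^]\<^bsub>Q\<^esub> (m - n) \<otimes>\<^bsub>Q\<^esub> Y"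
        using XY CC by (metis Q.inv_solve_right Q.inv_closed)
      also have "\<dots> \<longleftrightarrow> X \<otimes>\<^bsub>Q\<^esub> C [^]\<^bsub>Q\<^esub> (- m) = (C [^]\<^bsub>Q\<^esub> (m - n) \<otimes>\<^bsub>Q\<^esub> Y) \<otimes>\<^bsub>Q\<^esub> C [^]\<^bsub>Q\<^esub> (- m)"
        using XY CC by (simp add: Q.right_cancel)
      also have "(C [^]\<^bsub>Q\<^esub> (m - n) \<otimes>\<^bsub>Q\<^esub> Y) \<otimes>\<^bsub>Q\<^esub> C [^]\<^bsub>Q\<^esub> (- m) = Y \<otimes>\<^bsub>Q\<^esub> C [^]\<^bsub>Q\<^esub> (- n)"
      proof -
        have "(C [^]\<^bsub>Q\<^esub> (m - n) \<otimes>\<^bsub>Q\<^esub> Y) \<otimes>\<^bsub>Q\<^esub> C [^]\<^bsub>Q\<^esub> (- m) = Y \<otimes>\<^bsub>Q\<^esub> (C [^]\<^bsub>Q\<^esub> (m - n) \<otimes>\<^bsub>Q\<^esub> C [^]\<^bsub>Q\<^esub> (- m))"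
          using comm[OF CC[of "m - n"] XY(2)] XY CC by (simp add: Q.m_assoc)
        also have "C [^]\<^bsub>Q\<^esub> (m - n) \<otimes>\<^bsub>Q\<^esub> C [^]\<^bsub>Q\<^esub> (- m) = C [^]\<^bsub>Q\<^esub> (- n)"
          using Q.int_pow_mult[OF C, of "m - n" "- m"] by simp
        finally show ?thesis .
      qed
      finally show ?thesis using True mod div by (simp add: m_def n_def)
    next
      case False
      then show ?thesis by (simp add: mod_eq_dvd_iff)
    qed
    also have "\<dots> \<longleftrightarrow> f p = f q" by (auto simp: f_def p q X_def Y_def)
    finally show "f p = f q \<longleftrightarrow> p \<otimes>\<^bsub>P\<^esub> inv\<^bsub>P\<^esub> q \<in> slope_subgroup G H C e" by simp
  qed
  also have "f ` carrier P = carrier Q \<times> {0..<e}"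
  proof (intro equalityI subsetI)
    fix v assume "v \<in> f ` carrier P"
    then obtain x a where "v = f (x, a)" "x \<in> carrier G" by (auto simp: image_iff)
    then show "v \<in> carrier Q \<times> {0..<e}" using C e by (simp add: f_def coset_in_Q)
  next
    fix v assume "v \<in> carrier Q \<times> {0..<e}"
    then obtain D a where v: "v = (D, a)" "D \<in> carrier Q" "0 \<le> a" "a < e" by auto
    then obtain x where x: "x \<in> carrier G" "D = H #> x" by (auto simp: carrier_Q RCOSETS_def)
    have "f (x, a) = v" using v x C Q.r_one[OF coset_in_Q[OF x(1)]] by (simp add: f_def coset_in_Q)
    moreover have "(x, a) \<in> carrier P" using x by simp
    ultimately show "v \<in> f ` carrier P" by (metis imageI)
  qed
  also have "card (carrier Q \<times> {0..<e}) = card (rcosets H) * nat e"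
    by (simp add: card_cartesian_product carrier_Q)
  finally show ?thesis .
qed

lemma slope_subgroup_fibres:
  assumes C: "C \<in> carrier Q" and e: "e > 0"
  shows "{x \<in> carrier G. (x, 0) \<in> slope_subgroup G H C e} = H"
    and "{x \<in> carrier G. (x, e) \<in> slope_subgroup G H C e} = C"
proof -
  interpret Q: group Q by (rule Q_group)
  show "{x \<in> carrier G. (x, 0) \<in> slope_subgroup G H C e} = H"
    using mem_iff subset by (auto simp: slope_subgroup_def one_Q)
  obtain v where v: "v \<in> carrier G" "C = H #> v" using C by (auto simp: carrier_Q RCOSETS_def)
  have "x \<in> C \<longleftrightarrow> H #> x = C" if "x \<in> carrier G" for x
    using repr_independence[OF _ v(1) sub, of x] rcos_self[OF that sub] v(2) by auto
  moreover have "C \<subseteq> carrier G" using v by (simp add: r_coset_subset_G subset)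
  ultimately show "{x \<in> carrier G. (x, e) \<in> slope_subgroup G H C e} = C"
    using e C by (auto simp: slope_subgroup_def)
qed

end

text \<open>Take \<open>H\<close> to be the intersection with \<open>G \<times> {0}\<close>, and \<open>(v, e)\<close> an element with least positive second
  component. One exists since otherwise the elements \<open>(\<one>, a)\<close> would lie in infinitely many cosets.\<close>

lemma (in comm_group) finite_index_subgroup_is_slope:
  assumes M: "subgroup M (G \<times>\<times> integer_group)" and fin: "card (rcosets\<^bsub>G \<times>\<times> integer_group\<^esub> M) \<ge> 1"
  shows "\<exists>H C e. subgroup H G \<and> C \<in> rcosets H \<and> e > 0 \<and> M = slope_subgroup G H C e"
proof -
  define P where "P = G \<times>\<times> integer_group"
  interpret P: group P unfolding P_def by (intro DirProd_group is_group group_integer_group)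
  have M: "subgroup M P" using M by (simp add: P_def)
  interpret M: subgroup M P by fact
  have mult: "(x, a) \<otimes>\<^bsub>P\<^esub> (y, b) = (x \<otimes> y, a + b)" for x a y b by (simp add: P_def)
  have one: "\<one>\<^bsub>P\<^esub> = (\<one>, 0)" by (simp add: P_def)
  have inv: "inv\<^bsub>P\<^esub> (x, a) = (inv x, - a)" if "x \<in> carrier G" for x a
    using that by (simp add: P_def inv_DirProd[OF is_group group_integer_group])
  have MG: "x \<in> carrier G" if "(x, a) \<in> M" for x a using M.subset that by (auto simp: P_def)
  have Mm: "(x \<otimes> y, a + b) \<in> M" if "(x, a) \<in> M" "(y, b) \<in> M" for x a y b
    using M.m_closed[OF that] by (simp add: mult)
  have Mi: "(inv x, - a) \<in> M" if "(x, a) \<in> M" for x a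
    using M.m_inv_closed[OF that] inv[OF MG[OF that]] by simp
  define H where "H = {x. (x, 0) \<in> M}"
  have H: "subgroup H G"
  proof (rule subgroupI)
    show "H \<subseteq> carrier G" using MG by (auto simp: H_def)
    show "H \<noteq> {}" using M.one_closed by (auto simp: H_def one)
    show "inv a \<in> H" if "a \<in> H" for a using that Mi[of a 0] by (simp add: H_def)
    show "a \<otimes> b \<in> H" if "a \<in> H" "b \<in> H" for a b using that Mm[of a 0 b 0] by (simp add: H_def)
  qed
  interpret HG: abelian_with_subgroup G H
    by (intro abelian_with_subgroup.intro comm_group_axioms abelian_with_subgroup_axioms.intro H)
  interpret Q: group "G Mod H" by (rule HG.Q_group)
  have "\<exists>e>0. \<exists>v. (v, e) \<in> M"
  proof (rule ccontr)
    assume "\<not> ?thesis"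
    then have nz: "a = 0" if "(x, a) \<in> M" for x a
      using Mi[OF that] that by (metis linorder_neqE_linordered_idom neg_0_less_iff_less)
    have "inj (\<lambda>a::int. M #>\<^bsub>P\<^esub> (\<one>, a))"
    proof (rule injI)
      fix a b :: int assume "M #>\<^bsub>P\<^esub> (\<one>, a) = M #>\<^bsub>P\<^esub> (\<one>, b)"
      then have "(\<one>, a) \<otimes>\<^bsub>P\<^esub> inv\<^bsub>P\<^esub> (\<one>, b) \<in> M"
        using P.coset_eq_iff[OF M, of "(\<one>, a)" "(\<one>, b)"] by (simp add: P_def)
      then have "(\<one>, a - b) \<in> M" by (simp add: inv mult)
      from nz[OF this] show "a = b" by simp
    qed
    then have "infinite (range (\<lambda>a::int. M #>\<^bsub>P\<^esub> (\<one>, a)))" using infinite_UNIV_int by (metis finite_imageD)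
    moreover have "range (\<lambda>a::int. M #>\<^bsub>P\<^esub> (\<one>, a)) \<subseteq> rcosets\<^bsub>P\<^esub> M"
      by (auto simp: RCOSETS_def P_def)
    ultimately have "infinite (rcosets\<^bsub>P\<^esub> M)" using finite_subset by blast
    then show False using fin by (simp add: P_def)
  qed
  then obtain e0 v0 where "e0 > 0" "(v0, e0) \<in> M" by blast
  then have ex: "\<exists>n::nat. n > 0 \<and> (\<exists>v. (v, int n) \<in> M)" by (intro exI[of _ "nat e0"]) auto
  define n where "n = (LEAST n::nat. n > 0 \<and> (\<exists>v. (v, int n) \<in> M))"
  have n: "n > 0" "\<exists>v. (v, int n) \<in> M" using LeastI_ex[OF ex] by (auto simp: n_def)
  have min: "n \<le> k" if "k > 0" "(w, int k) \<in> M" for k w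
    unfolding n_def using that by (intro Least_le) auto
  define e where "e = int n"
  have e: "e > 0" using n by (simp add: e_def)
  obtain v where v: "(v, e) \<in> M" using n by (auto simp: e_def)
  have vG: "v \<in> carrier G" using MG v by blast
  have pow: "(v [^] k, k * e) \<in> M" for k :: int
  proof -
    have nat: "(v [^] m, int m * e) \<in> M" for m :: nat
    proof (induction m)
      case 0
      show ?case using M.one_closed by (simp add: one)
    next
      case (Suc m)
      show ?case using Mm[OF Suc v] by (simp add: algebra_simps)
    qed
    show ?thesis
    proof (cases k rule: int_cases2)
      case (nonneg m)
      then show ?thesis using nat[of m] by (simp add: int_pow_int)
    next
      case (nonpos m)
      then show ?thesis using Mi[OF nat[of m]] vG by (simp add: int_pow_neg int_pow_int)
    qed
  qed
  define C where "C = H #> v"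
  have C: "C \<in> rcosets H" unfolding C_def using vG HG.coset_in_Q by (simp add: HG.carrier_Q)
  interpret h: group_hom G "G Mod H" "\<lambda>x. H #> x"
    using HG.Q_group is_group HG.r_coset_hom_Mod by (auto simp: group_hom_def group_hom_axioms_def)
  have Cpow: "C [^]\<^bsub>G Mod H\<^esub> k = H #> (v [^] k)" for k :: int
    unfolding C_def using vG by (simp add: h.hom_int_pow)
  have key: "(x, k * e) \<in> M \<longleftrightarrow> H #> x = C [^]\<^bsub>G Mod H\<^esub> k" if x: "x \<in> carrier G" for x k
  proof -
    have "H #> x = C [^]\<^bsub>G Mod H\<^esub> k \<longleftrightarrow> x \<otimes> inv (v [^] k) \<in> H"
      unfolding Cpow using x vG by (intro coset_eq_iff[OF H]) auto
    also have "\<dots> \<longleftrightarrow> (x \<otimes> inv (v [^] k), 0) \<in> M" by (simp add: H_def)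
    also have "\<dots> \<longleftrightarrow> (x, k * e) \<in> M"
    proof
      assume "(x \<otimes> inv (v [^] k), 0) \<in> M"
      from Mm[OF this pow[of k]] show "(x, k * e) \<in> M" using x vG by (simp add: m_assoc)
    next
      assume "(x, k * e) \<in> M"
      from Mm[OF this Mi[OF pow[of k]]] show "(x \<otimes> inv (v [^] k), 0) \<in> M" by simp
    qed
    finally show ?thesis by simp
  qed
  have dvd: "e dvd a" if a: "(x, a) \<in> M" for x a
  proof -
    have "(x \<otimes> inv (v [^] (a div e)), a + - (a div e * e)) \<in> M" by (rule Mm[OF a Mi[OF pow]])
    moreover have "a + - (a div e * e) = a mod e" by (simp add: minus_div_mult_eq_mod)
    ultimately have "(x \<otimes> inv (v [^] (a div e)), int (nat (a mod e))) \<in> M" using e by simp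
    then have "nat (a mod e) = 0 \<or> n \<le> nat (a mod e)" using min by blast
    moreover have "0 \<le> a mod e" "a mod e < e" using e by simp_all
    ultimately have "a mod e = 0" unfolding e_def by linarith
    then show ?thesis by (rule mod_0_imp_dvd)
  qed
  have "p \<in> M \<longleftrightarrow> p \<in> slope_subgroup G H C e" for p
  proof -
    obtain x a where p: "p = (x, a)" by (cases p)
    show ?thesis
    proof (cases "x \<in> carrier G \<and> e dvd a")
      case True
      then have "a = a div e * e" by simp
      then show ?thesis using key[of x "a div e"] True by (simp add: slope_subgroup_def p)
    next
      case False
      then show ?thesis using dvd MG by (auto simp: slope_subgroup_def p)
    qed
  qed
  then have "M = slope_subgroup G H C e" by blast
  then show ?thesis using H C e by blast
qed

text \<open>A subgroup of index \<open>n\<close> amounts to a subgroup \<open>H\<close> of \<open>G\<close> of index \<open>d\<close> dividing \<open>n\<close>, for which \<open>e = n / d\<close> is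
  forced, and one of the \<open>d\<close> cosets of \<open>H\<close>.\<close>

lemma (in comm_group) card_subgroups_of_index_times_int:
  assumes n: "n \<ge> 1" and fin: "\<And>d. d \<ge> 1 \<Longrightarrow> finite (subgroups_of_index G d)"
  shows "finite (subgroups_of_index (G \<times>\<times> integer_group) n)"
    and "card (subgroups_of_index (G \<times>\<times> integer_group) n) = (\<Sum>d | d dvd n. d * card (subgroups_of_index G d))"
proof -
  define T where "T = (SIGMA d:{d. d dvd n}. SIGMA H:subgroups_of_index G d. rcosets H)"
  define F where "F = (\<lambda>(d, H, C). slope_subgroup G H C (int (n div d)))"
  have dn: "d \<ge> 1" "n div d \<ge> 1" if "d dvd n" for d
    using that n by (auto simp: Suc_le_eq dvd_imp_le dvd_div_eq_0_iff intro: Nat.gr0I elim: dvdE)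
  have awl: "abelian_with_subgroup G H" if "subgroup H G" for H
    using that by (intro abelian_with_subgroup.intro comm_group_axioms abelian_with_subgroup_axioms.intro)
  have bij: "bij_betw F T (subgroups_of_index (G \<times>\<times> integer_group) n)"
    unfolding bij_betw_def
  proof
    show "inj_on F T"
    proof (rule inj_onI)
      fix s t assume st: "s \<in> T" "t \<in> T" "F s = F t"
      obtain d H C where s: "s = (d, H, C)" by (cases s)
      obtain d' H' C' where t: "t = (d', H', C')" by (cases t)
      have S: "d dvd n" "subgroup H G" "card (rcosets H) = d" "C \<in> rcosets H"
        using st(1) by (auto simp: T_def s subgroups_of_index_def)
      have S': "d' dvd n" "subgroup H' G" "card (rcosets H') = d'" "C' \<in> rcosets H'"
        using st(2) by (auto simp: T_def t subgroups_of_index_def)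
      interpret A: abelian_with_subgroup G H by (rule awl[OF S(2)])
      interpret A': abelian_with_subgroup G H' by (rule awl[OF S'(2)])
      have e: "int (n div d) > 0" "int (n div d') > 0" using dn(2)[OF S(1)] dn(2)[OF S'(1)] by linarith+
      have eq: "slope_subgroup G H C (int (n div d)) = slope_subgroup G H' C' (int (n div d'))"
        using st(3) by (simp add: F_def s t)
      have HH: "H = H'"
        using A.slope_subgroup_fibres(1)[of C "int (n div d)"] A'.slope_subgroup_fibres(1)[of C' "int (n div d')"]
          S S' e eq by (simp add: A.carrier_Q A'.carrier_Q)
      then have dd: "d = d'" using S S' by simp
      have "C = C'"
        using A.slope_subgroup_fibres(2)[of C "int (n div d)"] A'.slope_subgroup_fibres(2)[of C' "int (n div d')"]
          S S' e eq dd by (simp add: A.carrier_Q A'.carrier_Q)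
      with HH dd show "s = t" by (simp add: s t)
    qed
    show "F ` T = subgroups_of_index (G \<times>\<times> integer_group) n"
    proof (intro equalityI subsetI)
      fix M assume "M \<in> F ` T"
      then obtain d H C where M: "M = slope_subgroup G H C (int (n div d))" "d dvd n" "subgroup H G" "card (rcosets H) = d" "C \<in> rcosets H"
        by (auto simp: T_def F_def subgroups_of_index_def)
      interpret A: abelian_with_subgroup G H by (rule awl[OF M(3)])
      have e: "int (n div d) > 0" using dn(2)[OF M(2)] by linarith
      show "M \<in> subgroups_of_index (G \<times>\<times> integer_group) n"
        using A.slope_subgroup_is_subgroup[of C, OF _ e] A.slope_subgroup_index[of C, OF _ e] M
        by (simp add: subgroups_of_index_def A.carrier_Q)
    next
      fix M assume M: "M \<in> subgroups_of_index (G \<times>\<times> integer_group) n"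
      then obtain H C e where HCe: "subgroup H G" "C \<in> rcosets H" "e > 0" "M = slope_subgroup G H C e"
        using finite_index_subgroup_is_slope[of M] n by (auto simp: subgroups_of_index_def)
      interpret A: abelian_with_subgroup G H by (rule awl[OF HCe(1)])
      have ind: "card (rcosets H) * nat e = n"
        using A.slope_subgroup_index[of C e] HCe M by (simp add: subgroups_of_index_def A.carrier_Q)
      then have "card (rcosets H) dvd n" by auto
      moreover have "n div card (rcosets H) = nat e" using ind n by (metis mult_0 nonzero_mult_div_cancel_left not_one_le_zero)
      ultimately have "(card (rcosets H), H, C) \<in> T" "F (card (rcosets H), H, C) = M"
        using HCe by (auto simp: T_def F_def subgroups_of_index_def)
      then show "M \<in> F ` T" by (metis imageI)
    qed
  qed
  have fd: "finite {d. d dvd n}" using n by simp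
  have fr: "finite (rcosets H)" if "d dvd n" "H \<in> subgroups_of_index G d" for d H
    using that dn[of d] by (intro card_ge_0_finite) (auto simp: subgroups_of_index_def)
  have "finite T" unfolding T_def using fd fin dn fr by (intro finite_SigmaI) auto
  then show "finite (subgroups_of_index (G \<times>\<times> integer_group) n)" using bij bij_betw_finite by blast
  have "card (subgroups_of_index (G \<times>\<times> integer_group) n) = card T" using bij bij_betw_same_card by metis
  also have "card T = (\<Sum>d | d dvd n. card (SIGMA H:subgroups_of_index G d. rcosets H))"
    unfolding T_def using fd fin dn fr by (intro card_SigmaI) (auto intro!: finite_SigmaI)
  also have "\<dots> = (\<Sum>d | d dvd n. d * card (subgroups_of_index G d))"
  proof (rule sum.cong[OF refl])
    fix d assume d: "d \<in> {d. d dvd n}"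
    have "card (SIGMA H:subgroups_of_index G d. rcosets H) = (\<Sum>H\<in>subgroups_of_index G d. card (rcosets H))"
      using d fin dn fr by (intro card_SigmaI) auto
    also have "\<dots> = (\<Sum>H\<in>subgroups_of_index G d. d)" by (intro sum.cong) (auto simp: subgroups_of_index_def)
    finally show "card (SIGMA H:subgroups_of_index G d. rcosets H) = d * card (subgroups_of_index G d)" by simp
  qed
  finally show "card (subgroups_of_index (G \<times>\<times> integer_group) n) = (\<Sum>d | d dvd n. d * card (subgroups_of_index G d))" .
qed

section \<open>Closed orbits and fixed points\<close>

text \<open>The number of subgroups of index \<open>n\<close> in \<open>\<int> ^ r\<close>, by splitting off one coordinate.\<close>

primrec lattice_count :: "nat \<Rightarrow> nat \<Rightarrow> nat" where
  "lattice_count 0 n = (if n = 1 then 1 else 0)"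
| "lattice_count (Suc r) n = (\<Sum>d | d dvd n. d * lattice_count r d)"

lemma int_lattice_comm_group: "comm_group (int_lattice r)"
  unfolding int_lattice_def
  by (rule group.group_comm_groupI) (auto simp: fun_eq_iff)

lemma int_lattice_split_iso:
  "(\<lambda>f. (restrict f {..<r}, f r)) \<in> iso (int_lattice (Suc r)) (int_lattice r \<times>\<times> integer_group)"
proof (rule isoI)
  show "(\<lambda>f. (restrict f {..<r}, f r)) \<in> hom (int_lattice (Suc r)) (int_lattice r \<times>\<times> integer_group)"
    by (rule homI) (auto simp: int_lattice_def fun_eq_iff)
  show "bij_betw (\<lambda>f. (restrict f {..<r}, f r)) (carrier (int_lattice (Suc r))) (carrier (int_lattice r \<times>\<times> integer_group))"
  proof (rule bij_betw_byWitness[where f' = "\<lambda>(x, a). \<lambda>i\<in>{..<Suc r}. if i < r then x i else a"])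
    show "\<forall>f\<in>carrier (int_lattice (Suc r)).
        (case (restrict f {..<r}, f r) of (x, a) \<Rightarrow> \<lambda>i\<in>{..<Suc r}. if i < r then x i else a) = f"
      by (auto simp: int_lattice_def fun_eq_iff PiE_def extensional_def less_Suc_eq)
    show "\<forall>p\<in>carrier (int_lattice r \<times>\<times> integer_group).
        (\<lambda>f. (restrict f {..<r}, f r)) (case p of (x, a) \<Rightarrow> \<lambda>i\<in>{..<Suc r}. if i < r then x i else a) = p"
      by (auto simp: int_lattice_def fun_eq_iff PiE_def extensional_def)
  qed (auto simp: int_lattice_def)
qed

lemma subgroups_of_trivial_group:
  assumes "group G" "carrier G = {\<one>\<^bsub>G\<^esub>}"
  shows "subgroups_of_index G n = (if n = 1 then {carrier G} else {})"
proof -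
  interpret group G by fact
  have "rcosets\<^bsub>G\<^esub> (carrier G) = {carrier G}"
    using assms(2) by (auto simp: RCOSETS_def r_coset_def)
  moreover have "subgroup H G \<longleftrightarrow> H = carrier G" for H
  proof
    assume "subgroup H G"
    then show "H = carrier G" using assms(2) subgroup.subset[of H G] subgroup.one_closed[of H G] by auto
  qed (simp add: subgroup_self)
  ultimately show ?thesis by (auto simp: subgroups_of_index_def)
qed

lemma card_subgroups_int_lattice:
  "n \<ge> 1 \<Longrightarrow> finite (subgroups_of_index (int_lattice r) n)
     \<and> card (subgroups_of_index (int_lattice r) n) = lattice_count r n"
proof (induction r arbitrary: n)
  case 0
  have "carrier (int_lattice 0) = {\<one>\<^bsub>int_lattice 0\<^esub>}" by (auto simp: int_lattice_def)
  then show ?case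
    using subgroups_of_trivial_group[OF comm_group.axioms(2)[OF int_lattice_comm_group]] by simp
next
  case (Suc r)
  interpret L: comm_group "int_lattice r" by (rule int_lattice_comm_group)
  have P: "group (int_lattice r \<times>\<times> integer_group)" by (intro DirProd_group L.is_group group_integer_group)
  have bij: "bij_betw (\<lambda>H. (\<lambda>f. (restrict f {..<r}, f r)) ` H)
      (subgroups_of_index (int_lattice (Suc r)) n) (subgroups_of_index (int_lattice r \<times>\<times> integer_group) n)"
    using int_lattice_comm_group P int_lattice_split_iso
    by (intro iso_bij_subgroups_of_index) (auto simp: comm_group_def)
  have "finite (subgroups_of_index (int_lattice r \<times>\<times> integer_group) n)"
    using Suc by (intro L.card_subgroups_of_index_times_int) auto
  moreover have "card (subgroups_of_index (int_lattice r \<times>\<times> integer_group) n)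
      = (\<Sum>d | d dvd n. d * card (subgroups_of_index (int_lattice r) d))"
    using Suc by (intro L.card_subgroups_of_index_times_int) auto
  moreover have "\<dots> = (\<Sum>d | d dvd n. d * lattice_count r d)"
    using Suc by (intro sum.cong) (auto intro!: Nat.gr0I simp: Suc_le_eq)
  ultimately show ?case
    using bij_betw_finite[OF bij] bij_betw_same_card[OF bij] by simp
qed

lemma index_subgroup_count_eq: "n \<ge> 1 \<Longrightarrow> index_subgroup_count r n = lattice_count r n"
  using card_subgroups_int_lattice[of n r] by (simp add: index_subgroup_count_def subgroups_of_index_def)

definition fixed_points :: "'a set \<Rightarrow> ('a \<Rightarrow> 'a) \<Rightarrow> nat \<Rightarrow> 'a set" where
  "fixed_points X T n = {x \<in> X. (T ^^ n) x = x}"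

lemma funpow_in: "T \<in> X \<rightarrow> X \<Longrightarrow> x \<in> X \<Longrightarrow> (T ^^ k) x \<in> X"
  by (induction k) auto

lemma funpow_period_dvd: "(T ^^ d) x = x \<Longrightarrow> d dvd n \<Longrightarrow> (T ^^ n) x = x"
  using funpow_mod_eq[where f = T and x = x and m = n and n = d] by simp

text \<open>Hence two closed orbits that share a point are equal, whatever their lengths.\<close>

lemma closed_orbit_eq_forward_orbit:
  assumes A: "A \<in> closed_orbits X T d" and d: "d \<ge> 1" and y: "y \<in> A"
  shows "A = range (\<lambda>j. (T ^^ j) y)" and "(T ^^ d) y = y"
proof -
  obtain x where x: "A = {(T ^^ k) x |k. k \<le> d}" "(T ^^ d) x = x"
    using A by (auto simp: closed_orbits_def)
  have AA: "A = range (\<lambda>j. (T ^^ j) x)"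
  proof (intro equalityI subsetI)
    fix z assume "z \<in> range (\<lambda>j. (T ^^ j) x)"
    then obtain j where "z = (T ^^ j) x" by auto
    then have "z = (T ^^ (j mod d)) x" using funpow_mod_eq[OF x(2), of j] by simp
    moreover have "j mod d \<le> d" using d by (simp add: less_imp_le)
    ultimately show "z \<in> A" unfolding x(1) by blast
  qed (auto simp: x(1))
  obtain k where k: "y = (T ^^ k) x" using y x(1) by auto
  have "(T ^^ d) y = (T ^^ (k + d)) x" unfolding k by (simp add: funpow_add[symmetric, THEN fun_cong, unfolded comp_def] add.commute)
  also have "\<dots> = y" unfolding k by (simp add: funpow_add x(2))
  finally show "(T ^^ d) y = y" .
  show "A = range (\<lambda>j. (T ^^ j) y)"
  proof (intro equalityI subsetI)
    fix z assume "z \<in> A"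
    then obtain i where i: "z = (T ^^ i) x" by (auto simp: AA)
    have "1 * k \<le> d * k" using d by (intro mult_le_mono1)
    then have "i + d * k = (i + d * k - k) + k" by linarith
    then have "(T ^^ (i + d * k)) x = (T ^^ (i + d * k - k)) y"
      by (metis comp_apply funpow_add k)
    moreover have "(T ^^ (i + d * k)) x = z"
      using funpow_period_dvd[OF x(2), of "d * k"] by (simp add: funpow_add i)
    ultimately show "z \<in> range (\<lambda>j. (T ^^ j) y)" by (metis rangeI)
  next
    fix z assume "z \<in> range (\<lambda>j. (T ^^ j) y)"
    then obtain j where "z = (T ^^ j) y" by auto
    then have "z = (T ^^ (j + k)) x" by (simp add: k funpow_add)
    then show "z \<in> A" by (auto simp: AA)
  qed
qed

lemma fixed_point_in_closed_orbit:
  assumes x: "x \<in> fixed_points X T n" and n: "n \<ge> 1"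
  shows "\<exists>d A. d dvd n \<and> A \<in> closed_orbits X T d \<and> x \<in> A"
proof -
  have x: "x \<in> X" "(T ^^ n) x = x" using x by (auto simp: fixed_points_def)
  define d where "d = (LEAST d. d \<ge> 1 \<and> (T ^^ d) x = x)"
  have d: "d \<ge> 1" "(T ^^ d) x = x"
    using LeastI[of "\<lambda>d. d \<ge> 1 \<and> (T ^^ d) x = x" n] n x by (auto simp: d_def)
  have min: "(T ^^ k) x \<noteq> x" if "1 \<le> k" "k < d" for k
    using not_less_Least[of k "\<lambda>d. d \<ge> 1 \<and> (T ^^ d) x = x"] that by (auto simp: d_def)
  have "d dvd n"
  proof (rule ccontr)
    assume "\<not> d dvd n"
    then have "1 \<le> n mod d" "n mod d < d" using d by (auto simp: dvd_eq_mod_eq_0 Suc_le_eq)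
    then show False using min[of "n mod d"] funpow_mod_eq[OF d(2), of n] x(2) by simp
  qed
  define A where "A = {(T ^^ k) x |k. k \<le> d}"
  have "A = (\<lambda>k. (T ^^ k) x) ` {..<d}"
  proof (intro equalityI subsetI)
    fix z assume "z \<in> A"
    then obtain k where "k \<le> d" "z = (T ^^ k) x" by (auto simp: A_def)
    then have "z = (T ^^ (k mod d)) x" "k mod d < d" using funpow_mod_eq[OF d(2), of k] d(1) by auto
    then show "z \<in> (\<lambda>k. (T ^^ k) x) ` {..<d}" by blast
  qed (auto simp: A_def intro: less_imp_le)
  moreover have "inj_on (\<lambda>k. (T ^^ k) x) {..<d}"
  proof (rule linorder_inj_onI)
    fix i j assume ij: "i < j" "i \<in> {..<d}" "j \<in> {..<d}"
    show "(T ^^ i) x \<noteq> (T ^^ j) x"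
    proof
      assume eq: "(T ^^ i) x = (T ^^ j) x"
      have "(T ^^ (d - j + i)) x = (T ^^ (d - j)) ((T ^^ i) x)" by (simp add: funpow_add)
      also have "\<dots> = (T ^^ (d - j + j)) x" unfolding eq by (simp add: funpow_add)
      also have "\<dots> = x" using ij d by simp
      finally have "(T ^^ (d - j + i)) x = x" .
      moreover have "1 \<le> d - j + i" "d - j + i < d" using ij by auto
      ultimately show False using min by blast
    qed
  qed auto
  ultimately have "card A = d" by (simp add: card_image)
  then have "A \<in> closed_orbits X T d" using x d by (auto simp: closed_orbits_def A_def)
  moreover have "x \<in> A" unfolding A_def using d by (auto intro: exI[of _ 0])
  ultimately show ?thesis using \<open>d dvd n\<close> by blast
qed

lemma closed_orbit_subset_fixed_points:
  assumes T: "T \<in> X \<rightarrow> X" and d: "d \<ge> 1" "d dvd n" and A: "A \<in> closed_orbits X T d"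
  shows "A \<subseteq> fixed_points X T n"
proof
  fix y assume y: "y \<in> A"
  obtain x where x: "x \<in> X" "A = {(T ^^ k) x |k. k \<le> d}" using A by (auto simp: closed_orbits_def)
  have "y \<in> X" using y x funpow_in[OF T x(1)] by auto
  moreover have "(T ^^ n) y = y"
    using closed_orbit_eq_forward_orbit(2)[OF A d(1) y] d(2) by (rule funpow_period_dvd)
  ultimately show "y \<in> fixed_points X T n" by (simp add: fixed_points_def)
qed

lemma fixed_points_eq_Union:
  assumes T: "T \<in> X \<rightarrow> X" and n: "n \<ge> 1"
  shows "fixed_points X T n = \<Union> (\<Union>d\<in>{d. d dvd n}. closed_orbits X T d)"
proof (intro equalityI subsetI)
  fix x assume "x \<in> fixed_points X T n"
  from fixed_point_in_closed_orbit[OF this n]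
  show "x \<in> \<Union> (\<Union>d\<in>{d. d dvd n}. closed_orbits X T d)" by auto
next
  fix x assume "x \<in> \<Union> (\<Union>d\<in>{d. d dvd n}. closed_orbits X T d)"
  then obtain d A where "d dvd n" "A \<in> closed_orbits X T d" "x \<in> A" by blast
  moreover have "d \<ge> 1" using \<open>d dvd n\<close> n by (auto intro!: Nat.gr0I simp: Suc_le_eq)
  ultimately show "x \<in> fixed_points X T n" using closed_orbit_subset_fixed_points[OF T] by blast
qed

text \<open>The points fixed by the \<open>n\<close>-th iterate are partitioned by the closed orbits whose lengths divide \<open>n\<close>.\<close>

theorem card_fixed_points:
  assumes T: "T \<in> X \<rightarrow> X" and n: "n \<ge> 1"
    and fin: "\<And>d. d \<ge> 1 \<Longrightarrow> finite (closed_orbits X T d)"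
  shows "finite (fixed_points X T n)"
    and "card (fixed_points X T n) = (\<Sum>d | d dvd n. d * orbit_count X T d)"
proof -
  define Orb where "Orb = (\<Union>d\<in>{d. d dvd n}. closed_orbits X T d)"
  have d1: "d \<ge> 1" if "d dvd n" for d using that n by (auto intro!: Nat.gr0I simp: Suc_le_eq)
  have fd: "finite {d. d dvd n}" using n by simp
  have fO: "finite Orb" unfolding Orb_def using fd fin d1 by (intro finite_UN_I) auto
  have cA: "card A = d" if "A \<in> closed_orbits X T d" for A d using that by (auto simp: closed_orbits_def)
  have fA: "finite A" if "A \<in> Orb" for A
  proof -
    obtain d where d: "d dvd n" "A \<in> closed_orbits X T d" using \<open>A \<in> Orb\<close> by (auto simp: Orb_def)
    then have "card A > 0" using cA[OF d(2)] d1[OF d(1)] by simp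
    then show ?thesis by (rule card_ge_0_finite)
  qed
  have disj: "pairwise disjnt Orb"
  proof (rule pairwiseI)
    fix A B assume AB: "A \<in> Orb" "B \<in> Orb" "A \<noteq> B"
    show "disjnt A B"
    proof (rule ccontr)
      assume "\<not> disjnt A B"
      then obtain y where y: "y \<in> A" "y \<in> B" by (auto simp: disjnt_def)
      obtain d where d: "d dvd n" "A \<in> closed_orbits X T d" using AB(1) by (auto simp: Orb_def)
      obtain d' where d': "d' dvd n" "B \<in> closed_orbits X T d'" using AB(2) by (auto simp: Orb_def)
      have "A = B"
        using closed_orbit_eq_forward_orbit(1)[OF d(2) d1[OF d(1)] y(1)]
          closed_orbit_eq_forward_orbit(1)[OF d'(2) d1[OF d'(1)] y(2)] by simp
      then show False using AB(3) by simp
    qed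
  qed
  have U: "fixed_points X T n = \<Union> Orb" unfolding Orb_def by (rule fixed_points_eq_Union[OF T n])
  show "finite (fixed_points X T n)" unfolding U using fO fA by blast
  have "card (\<Union> Orb) = (\<Sum>A\<in>Orb. card A)" using disj fA by (rule card_Union_disjoint)
  also have "\<dots> = (\<Sum>d | d dvd n. \<Sum>A\<in>closed_orbits X T d. card A)"
    unfolding Orb_def
  proof (rule sum.UNION_disjoint)
    show "finite {d. d dvd n}" by (rule fd)
    show "\<forall>d\<in>{d. d dvd n}. finite (closed_orbits X T d)" using fin d1 by blast
    show "\<forall>i\<in>{d. d dvd n}. \<forall>j\<in>{d. d dvd n}. i \<noteq> j \<longrightarrow> closed_orbits X T i \<inter> closed_orbits X T j = {}"
      using cA by blast
  qed
  also have "\<dots> = (\<Sum>d | d dvd n. d * orbit_count X T d)"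
    using cA by (intro sum.cong) (auto simp: orbit_count_def mult.commute)
  finally show "card (fixed_points X T n) = (\<Sum>d | d dvd n. d * orbit_count X T d)" unfolding U .
qed

lemma finite_closed_orbits:
  assumes "T \<in> X \<rightarrow> X" "d \<ge> 1" "finite (fixed_points X T d)"
  shows "finite (closed_orbits X T d)"
  using closed_orbit_subset_fixed_points[OF assms(1,2) dvd_refl] assms(3)
  by (intro finite_subset[of "closed_orbits X T d" "Pow (fixed_points X T d)"]) auto

lemma product_map_closed:
  assumes "\<forall>i<length l. T (l ! i) \<in> X (l ! i) \<rightarrow> X (l ! i)"
  shows "product_map T l \<in> product_space X l \<rightarrow> product_space X l"
proof (rule funcsetI)
  fix f assume f: "f \<in> product_space X l"
  have "T (l ! i) (f i) \<in> X (l ! i)" if "i < length l" for i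
  proof -
    have "T (l ! i) \<in> X (l ! i) \<rightarrow> X (l ! i)" using assms that by blast
    moreover have "f i \<in> X (l ! i)" using f that by (auto simp: product_space_def)
    ultimately show ?thesis by (rule funcset_mem)
  qed
  then show "product_map T l f \<in> product_space X l"
    unfolding product_map_def product_space_def restrict_PiE_iff by blast
qed

lemma product_map_funpow:
  assumes "\<forall>i<length l. T (l ! i) \<in> X (l ! i) \<rightarrow> X (l ! i)" "f \<in> product_space X l"
  shows "(product_map T l ^^ n) f = (\<lambda>i\<in>{..<length l}. (T (l ! i) ^^ n) (f i))"
proof (induction n)
  case 0
  show ?case using assms(2) by (auto simp: product_space_def PiE_def extensional_def fun_eq_iff)
qed (auto simp: product_map_def fun_eq_iff)

lemma fixed_points_product:
  assumes "\<forall>i<length l. T (l ! i) \<in> X (l ! i) \<rightarrow> X (l ! i)"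
  shows "fixed_points (product_space X l) (product_map T l) n
       = (\<Pi>\<^sub>E i\<in>{..<length l}. fixed_points (X (l ! i)) (T (l ! i)) n)"
proof (intro equalityI subsetI)
  fix f assume "f \<in> fixed_points (product_space X l) (product_map T l) n"
  then have f: "f \<in> product_space X l" "(product_map T l ^^ n) f = f" by (auto simp: fixed_points_def)
  then have eq: "(\<lambda>i\<in>{..<length l}. (T (l ! i) ^^ n) (f i)) = f" using product_map_funpow[where T = T and X = X and l = l, OF assms f(1)] by simp
  have "(T (l ! i) ^^ n) (f i) = f i" if "i < length l" for i
    using fun_cong[OF eq, of i] that by simp
  then show "f \<in> (\<Pi>\<^sub>E i\<in>{..<length l}. fixed_points (X (l ! i)) (T (l ! i)) n)"
    using f(1) by (auto simp: product_space_def fixed_points_def PiE_def)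
next
  fix f assume f: "f \<in> (\<Pi>\<^sub>E i\<in>{..<length l}. fixed_points (X (l ! i)) (T (l ! i)) n)"
  then have fp: "f \<in> product_space X l" by (auto simp: product_space_def fixed_points_def PiE_def)
  moreover have "(product_map T l ^^ n) f = f"
    unfolding product_map_funpow[where T = T and X = X and l = l, OF assms fp]
    using f by (auto simp: fixed_points_def PiE_def extensional_def fun_eq_iff)
  ultimately show "f \<in> fixed_points (product_space X l) (product_map T l) n" by (simp add: fixed_points_def)
qed

text \<open>The relation between closed orbits and fixed points is the same as the recursion of \<open>lattice_count\<close>. So the
  system with \<open>lattice_count r n\<close> closed orbits has \<open>lattice_count (Suc r) n\<close> points fixed by the \<open>n\<close>-th
  iterate.\<close>

definition fixed_point_count :: "nat list \<Rightarrow> nat \<Rightarrow> nat" where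
  "fixed_point_count l n = (\<Prod>r\<leftarrow>l. lattice_count (Suc r) n)"

text \<open>Fixed points of a product are tuples of fixed points. Closed orbits of the product are then recovered from
  the fixed points by the same divisor sum.\<close>

theorem product_orbit_divisor_sum:
  assumes T: "\<And>r. r \<ge> 1 \<Longrightarrow> realizes_lattice_count r (X r) (T r)"
    and l: "\<forall>k\<in>set l. k \<ge> 1" and n: "n \<ge> 1"
  shows "(\<Sum>d | d dvd n. d * orbit_count (product_space X l) (product_map T l) d) = fixed_point_count l n"
proof -
  have TT: "T r \<in> X r \<rightarrow> X r" "\<And>d. d \<ge> 1 \<Longrightarrow> finite (closed_orbits (X r) (T r) d)"
      "\<And>d. d \<ge> 1 \<Longrightarrow> orbit_count (X r) (T r) d = lattice_count r d" if "r \<ge> 1" for r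
    using T[OF that] by (auto simp: realizes_lattice_count_def index_subgroup_count_eq)
  have l': "l ! i \<ge> 1" if "i < length l" for i using l that by simp
  have cl: "\<forall>i<length l. T (l ! i) \<in> X (l ! i) \<rightarrow> X (l ! i)" using TT(1) l' by blast
  have fin1: "finite (fixed_points (X r) (T r) d)" if "r \<ge> 1" "d \<ge> 1" for r d
    using card_fixed_points(1)[OF TT(1)[OF that(1)] that(2)] TT(2)[OF that(1)] by blast
  have count1: "card (fixed_points (X r) (T r) n) = lattice_count (Suc r) n" if "r \<ge> 1" for r
  proof -
    have "card (fixed_points (X r) (T r) n) = (\<Sum>d | d dvd n. d * orbit_count (X r) (T r) d)"
      using card_fixed_points(2)[OF TT(1)[OF that] n] TT(2)[OF that] by blast
    also have "\<dots> = (\<Sum>d | d dvd n. d * lattice_count r d)"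
      using n TT(3)[OF that] by (intro sum.cong) (auto intro!: Nat.gr0I simp: Suc_le_eq)
    finally show ?thesis by simp
  qed
  have fin: "finite (fixed_points (product_space X l) (product_map T l) d)" if "d \<ge> 1" for d
    unfolding fixed_points_product[where T = T and X = X and l = l, OF cl] using fin1 l' that by (intro finite_PiE) auto
  have "(\<Sum>d | d dvd n. d * orbit_count (product_space X l) (product_map T l) d)
      = card (fixed_points (product_space X l) (product_map T l) n)"
    using product_map_closed[where T = T and X = X and l = l, OF cl] n finite_closed_orbits[OF product_map_closed[where T = T and X = X and l = l, OF cl]] fin
    by (intro card_fixed_points(2)[symmetric]) auto
  also have "\<dots> = (\<Prod>i<length l. lattice_count (Suc (l ! i)) n)"
    unfolding fixed_points_product[where T = T and X = X and l = l, OF cl] using count1 l' by (simp add: card_PiE)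
  also have "\<dots> = fixed_point_count l n"
    unfolding fixed_point_count_def by (simp add: prod.list_conv_set_nth atLeast0LessThan)
  finally show ?thesis .
qed

section \<open>The Dirichlet series of the product system\<close>

lemma divisors_coprime_bij:
  assumes "coprime m (n::nat)" "m > 0" "n > 0"
  shows "bij_betw (\<lambda>(a, b). a * b) ({d. d dvd m} \<times> {d. d dvd n}) {d. d dvd m * n}"
  unfolding bij_betw_def
proof
  show "inj_on (\<lambda>(a, b). a * b) ({d. d dvd m} \<times> {d. d dvd n})"
  proof (rule inj_onI, clarify)
    fix a b a' b' assume dvd: "a dvd m" "b dvd n" "a' dvd m" "b' dvd n" and eq: "a * b = a' * b'"
    have "coprime a b'" "coprime a' b" using dvd assms(1) by (auto intro: coprime_divisors)
    moreover have "a dvd a' * b'" using eq by (metis dvd_triv_left)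
    moreover have "a' dvd a * b" using eq by (metis dvd_triv_left)
    ultimately have "a dvd a'" "a' dvd a" by (simp_all add: coprime_dvd_mult_left_iff)
    then have "a = a'" by (rule dvd_antisym)
    moreover have "a > 0" using dvd(1) assms(2) by (rule dvd_pos_nat[rotated])
    ultimately show "a = a' \<and> b = b'" using eq by simp
  qed
  show "(\<lambda>(a, b). a * b) ` ({d. d dvd m} \<times> {d. d dvd n}) = {d. d dvd m * n}"
  proof (intro equalityI subsetI)
    fix d assume "d \<in> {d. d dvd m * n}"
    then obtain a b where "d = a * b" "a dvd m" "b dvd n" using division_decomp[of d m n] by blast
    then show "d \<in> (\<lambda>(a, b). a * b) ` ({d. d dvd m} \<times> {d. d dvd n})" by auto
  qed (auto intro: mult_dvd_mono)
qed

lemma lattice_count_mult: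
  "coprime m n \<Longrightarrow> m > 0 \<Longrightarrow> n > 0 \<Longrightarrow> lattice_count r (m * n) = lattice_count r m * lattice_count r n"
proof (induction r arbitrary: m n)
  case (Suc r)
  have "lattice_count (Suc r) (m * n) = (\<Sum>(a, b)\<in>{d. d dvd m} \<times> {d. d dvd n}. (a * b) * lattice_count r (a * b))"
    unfolding lattice_count.simps
    by (subst sum.reindex_bij_betw[OF divisors_coprime_bij[OF Suc.prems], symmetric]) (simp add: case_prod_unfold)
  also have "\<dots> = (\<Sum>(a, b)\<in>{d. d dvd m} \<times> {d. d dvd n}. (a * lattice_count r a) * (b * lattice_count r b))"
  proof (rule sum.cong[OF refl])
    fix x assume "x \<in> {d. d dvd m} \<times> {d. d dvd n}"
    then obtain a b where x: "x = (a, b)" and ab: "a dvd m" "b dvd n" by auto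
    have "coprime a b" using ab Suc.prems(1) by (rule coprime_divisors)
    moreover have "a > 0" "b > 0" using ab Suc.prems by (auto intro: dvd_pos_nat)
    ultimately show "(case x of (a, b) \<Rightarrow> a * b * lattice_count r (a * b))
        = (case x of (a, b) \<Rightarrow> a * lattice_count r a * (b * lattice_count r b))"
      using Suc.IH by (simp add: x)
  qed
  also have "\<dots> = lattice_count (Suc r) m * lattice_count (Suc r) n"
    by (simp add: sum_product sum.cartesian_product)
  finally show ?case .
qed auto

text \<open>Both sides are \<open>(\<Prod>i=1..r+1. 1 - q ^ (k + i)) / (\<Prod>j=1..r. 1 - q ^ j)\<close>.\<close>

lemma gauss_block_step:
  assumes q: "q > 1"
  shows "(1 - q ^ Suc k) * gauss_prod q (rev [1..<Suc r]) (Suc k) = (1 - q ^ (Suc k + r)) * gauss_prod q (rev [1..<Suc r]) k"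
proof (induction r)
  case (Suc r)
  define g where "g = gauss_prod q (rev [1..<Suc r])"
  have e: "rev [1..<Suc (Suc r)] = Suc r # rev [1..<Suc r]" by simp
  have "(1 - q ^ Suc k) * gauss_prod q (rev [1..<Suc (Suc r)]) (Suc k)
     = (1 - q ^ (Suc k + Suc r)) / (1 - q ^ Suc r) * ((1 - q ^ Suc k) * g (Suc k))"
    unfolding e gauss_prod_simps g_def by (simp only: mult_ac)
  also have "\<dots> = (1 - q ^ (Suc k + Suc r)) / (1 - q ^ Suc r) * ((1 - q ^ (Suc k + r)) * g k)"
    using Suc unfolding g_def by (simp only:)
  also have "\<dots> = (1 - q ^ (Suc k + Suc r)) * gauss_prod q (rev [1..<Suc (Suc r)]) k"
    unfolding e gauss_prod_simps g_def by simp
  finally show ?case .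
qed simp

text \<open>The Gaussian binomial coefficients satisfy the same recursion in \<open>r\<close>, a \<open>q\<close>-analogue of the hockey-stick
  identity.\<close>

lemma lattice_count_prime_power:
  assumes p: "prime p"
  shows "real (lattice_count (Suc r) (p ^ k)) = gauss_prod (real p) (rev [1..<Suc r]) k"
proof (induction r arbitrary: k)
  case 0
  have "{d. d dvd p ^ k} = (\<lambda>i. p ^ i) ` {..k}" using p divides_primepow_nat[of p _ k] by auto
  moreover have "(\<Sum>d | d dvd p ^ k. d * (if d = 1 then 1 else 0)) = (\<Sum>d\<in>{1}. d)"
    using p by (intro sum.mono_neutral_cong_right) (auto simp: prime_gt_0_nat)
  ultimately show ?case by simp
next
  case (Suc r)
  define q where "q = real p"
  have q: "q > 1" using prime_gt_1_nat[OF p] by (simp add: q_def)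
  define g where "g = gauss_prod q (rev [1..<Suc r])"
  define g' where "g' = gauss_prod q (rev [1..<Suc (Suc r)])"
  have g': "g' k = (1 - q ^ (k + Suc r)) / (1 - q ^ Suc r) * g k" for k
  proof -
    have "rev [1..<Suc (Suc r)] = Suc r # rev [1..<Suc r]" by simp
    then show ?thesis unfolding g'_def g_def by (simp only: gauss_prod_simps)
  qed
  have nz: "1 - q ^ Suc r \<noteq> 0" using less_imp_neq[OF one_less_power[OF q, of "Suc r"]] by simp
  have step: "(1 - q ^ Suc k) * g (Suc k) = (1 - q ^ (Suc k + r)) * g k" for k
    unfolding g_def by (rule gauss_block_step[OF q])
  have sum: "(\<Sum>j\<le>k. q ^ j * g j) = g' k" for k
  proof (induction k)
    case 0
    have "g 0 = 1" "g' 0 = 1"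
    proof -
      have "gauss_prod q (rev [1..<Suc s]) 0 = 1" for s
      proof (induction s)
        case (Suc s)
        have "rev [1..<Suc (Suc s)] = Suc s # rev [1..<Suc s]" by simp
        moreover have "1 - q ^ Suc s \<noteq> 0" using less_imp_neq[OF one_less_power[OF q, of "Suc s"]] by simp
        ultimately show ?case using Suc by simp
      qed simp
      then show "g 0 = 1" "g' 0 = 1" by (simp_all only: g_def g'_def)
    qed
    then show ?case by simp
  next
    case (Suc k)
    have gk: "g' k = (1 - q ^ Suc k) * g (Suc k) / (1 - q ^ Suc r)" unfolding g' step by simp
    have "q ^ Suc k * g (Suc k) + g' k = ((1 - q ^ Suc r) * q ^ Suc k + (1 - q ^ Suc k)) * g (Suc k) / (1 - q ^ Suc r)"
    proof -
      have "q ^ Suc k * g (Suc k) = ((1 - q ^ Suc r) * q ^ Suc k) * g (Suc k) / (1 - q ^ Suc r)"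
        using nz by (simp del: power_Suc)
      then show ?thesis using gk by (simp only: add_divide_distrib distrib_right)
    qed
    also have "(1 - q ^ Suc r) * q ^ Suc k + (1 - q ^ Suc k) = 1 - q ^ (Suc k + Suc r)"
      by (simp add: algebra_simps power_add)
    finally have "q ^ Suc k * g (Suc k) + g' k = g' (Suc k)" unfolding g' by simp
    then show ?case using Suc by simp
  qed
  have "real (lattice_count (Suc (Suc r)) (p ^ k)) = (\<Sum>d | d dvd p ^ k. real d * real (lattice_count (Suc r) d))"
    by (simp only: lattice_count.simps(2)[of "Suc r"] of_nat_sum of_nat_mult)
  also have "{d. d dvd p ^ k} = (\<lambda>i. p ^ i) ` {..k}" using p divides_primepow_nat[of p _ k] by auto
  also have "(\<Sum>d\<in>(\<lambda>i. p ^ i) ` {..k}. real d * real (lattice_count (Suc r) d)) = (\<Sum>j\<le>k. q ^ j * g j)"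
    using prime_gt_1_nat[OF p] Suc.IH
    by (subst sum.reindex) (auto intro!: inj_onI sum.cong simp: q_def g_def simp del: lattice_count.simps upt_Suc)
  finally show ?case using sum by (simp add: q_def g'_def del: upt_Suc)
qed

lemma fixed_point_count_mult:
  "coprime m n \<Longrightarrow> m > 0 \<Longrightarrow> n > 0 \<Longrightarrow> fixed_point_count l (m * n) = fixed_point_count l m * fixed_point_count l n"
  unfolding fixed_point_count_def
  by (induction l) (simp_all add: lattice_count_mult mult_ac del: lattice_count.simps)

lemma fixed_point_count_1: "fixed_point_count l 1 = 1"
proof -
  have "lattice_count r 1 = 1" for r by (induction r) auto
  then show ?thesis unfolding fixed_point_count_def by (induction l) (simp_all del: lattice_count.simps)
qed

lemma fixed_point_count_prime_power:
  assumes "prime p"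
  shows "real (fixed_point_count l (p ^ k)) = gauss_prod (real p) (partition_steps l) k"
  unfolding fixed_point_count_def gauss_prod_partition_steps
  by (induction l) (simp_all add: lattice_count_prime_power[OF assms] del: lattice_count.simps upt_Suc)

lemma gauss_prod_bounds:
  assumes q: "q \<ge> 2" and js: "\<forall>j\<in>set js. j \<ge> 1"
  shows "0 \<le> gauss_prod q js k" "gauss_prod q js k \<le> (2 * q ^ k) ^ length js"
proof -
  have "0 \<le> gauss_prod q js k \<and> gauss_prod q js k \<le> (2 * q ^ k) ^ length js" using js
  proof (induction js)
    case (Cons j js)
    have qj: "q ^ j \<ge> 2" using q Cons.prems power_increasing[of 1 j q] by simp
    have qk: "q ^ k \<ge> 1" using q by simp
    have "(1 - q ^ (k + j)) / (1 - q ^ j) = (q ^ k * q ^ j - 1) / (q ^ j - 1)"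
      by (metis minus_diff_eq minus_divide_divide power_add)
    moreover have "0 \<le> (q ^ k * q ^ j - 1) / (q ^ j - 1)"
      using qj qk mult_mono[of 1 "q ^ k" 1 "q ^ j"] by (intro divide_nonneg_nonneg) auto
    moreover have "(q ^ k * q ^ j - 1) / (q ^ j - 1) \<le> 2 * q ^ k"
    proof -
      have "q ^ k * 2 \<le> q ^ k * q ^ j" using qj qk by (intro mult_left_mono) auto
      then show ?thesis using qj by (simp add: divide_le_eq algebra_simps)
    qed
    ultimately have f: "0 \<le> (1 - q ^ (k + j)) / (1 - q ^ j)" "(1 - q ^ (k + j)) / (1 - q ^ j) \<le> 2 * q ^ k" by simp_all
    have IH: "0 \<le> gauss_prod q js k" "gauss_prod q js k \<le> (2 * q ^ k) ^ length js" using Cons by auto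
    have "0 \<le> 2 * q ^ k" using qk by simp
    then show ?case unfolding gauss_prod_simps length_Cons power_Suc using f IH by (intro conjI mult_mono mult_nonneg_nonneg) auto
  qed simp
  then show "0 \<le> gauss_prod q js k" "gauss_prod q js k \<le> (2 * q ^ k) ^ length js" by auto
qed

lemma partition_near_linear:
  assumes l: "\<forall>r\<in>set l. r \<ge> 1" "l \<noteq> []"
  shows "\<exists>C. near_linear_euler_product (length l - 1) (sum_list l) (\<lambda>p. local_coeff (real p) l) C (zeta_exponent (length l - 1))"
proof -
  have N: "sum_list l \<ge> 1" using l by (cases l) auto
  obtain C1 where C1: "C1 \<ge> 0" "\<And>q. q \<ge> 2 \<Longrightarrow> \<bar>local_coeff q l 1 - (real (length l) - 1)\<bar> \<le> C1 / q"
    using local_coeff_1_bound[OF l] by blast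
  obtain C2 where C2: "C2 \<ge> 0" "\<And>q k. q \<ge> 2 \<Longrightarrow> k \<ge> 2 \<Longrightarrow> \<bar>local_coeff q l k\<bar> \<le> C2 / q"
    using local_coeff_higher_bound[OF N] by blast
  have len: "real (length l - 1) = real (length l) - 1" using l(2) by (cases l) auto
  have "near_linear_euler_product (length l - 1) (sum_list l) (\<lambda>p. local_coeff (real p) l) (C1 + C2) (zeta_exponent (length l - 1))"
  proof
    show "sum_list l \<ge> 1" "C1 + C2 \<ge> 0" using N C1 C2 by auto
    fix p :: nat assume p: "prime p"
    have p2: "real p \<ge> 2" using prime_ge_2_nat[OF p] by simp
    show "local_coeff (real p) l 0 = 1" by simp
    show "\<bar>local_coeff (real p) l 1 - real (length l - 1)\<bar> \<le> (C1 + C2) / real p"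
      using C1(2)[OF p2] C2(1) p2 unfolding len add_divide_distrib by (simp add: add_increasing2)
    show "\<bar>local_coeff (real p) l k\<bar> \<le> (C1 + C2) / real p" if "k \<ge> 2" for k
      using C2(2)[OF p2 that] C1(1) p2 unfolding add_divide_distrib by (simp add: add_increasing)
  qed (rule zeta_exponent_correction)
  then show ?thesis by blast
qed

lemma continuation_lim_prime_product:
  assumes "near_linear_euler_product u d b C c" "Re z > 1"
  shows "(\<lambda>x. \<Prod>p | prime p \<and> p \<le> x. near_linear_euler_product.local_factor d b p (of_nat p powr (- z)))
     \<longlonglongrightarrow> near_linear_euler_product.continuation d b c z"
proof -
  interpret near_linear_euler_product u d b C c by fact
  have "(\<Prod>n<Suc x. if prime n then local_factor n (of_nat n powr (- z)) else 1)
      = (\<Prod>p | prime p \<and> p \<le> x. local_factor p (of_nat p powr (- z)))" for x :: nat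
    by (intro prod.mono_neutral_cong_right) auto
  then show ?thesis using LIMSEQ_Suc[OF continuation_eq_product[OF assms(2)]] by simp
qed

text \<open>At \<open>p\<close> the local sum is MacMahon's polynomial at \<open>p powr (- w)\<close> divided by the Euler factors of
  \<open>\<zeta>(w), \<dots>, \<zeta>(w - n)\<close>, where \<open>n\<close> is the size of the partition. In terms of \<open>z = w - n + 1\<close> the numerator is the
  near-linear local factor.\<close>

lemma fixed_point_dirichlet_series:
  fixes w :: complex
  assumes l: "\<forall>r\<in>set l. r \<ge> 1" "l \<noteq> []"
    and E: "near_linear_euler_product (length l - 1) (sum_list l) (\<lambda>p. local_coeff (real p) l) C c"
    and w: "Re w > real (sum_list l) + 1"
  defines "f \<equiv> (\<lambda>n. of_nat (fixed_point_count l n) * of_nat n powr (- w) :: complex)"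
  shows "(\<lambda>n. norm (f n)) summable_on {1..}"
    and "infsum f {1..} = near_linear_euler_product.continuation (sum_list l) (\<lambda>p. local_coeff (real p) l) c
        (w - of_nat (sum_list l) + 1) * (\<Prod>i\<le>sum_list l. zeta (w - of_nat i))"
proof -
  define N where "N = sum_list l"
  define js where "js = partition_steps l"
  have js: "length js = N" "\<forall>j\<in>set js. j \<ge> 1"
    using partition_steps_pos by (auto simp: js_def N_def length_partition_steps)
  have N1: "N \<ge> 1" using l by (cases l) (auto simp: N_def)
  define \<sigma> where "\<sigma> = Re w"
  have \<sigma>: "\<sigma> > real N + 1" using w by (simp add: \<sigma>_def N_def)
  define t where "t = (\<lambda>p::nat. of_nat p powr (- w) :: complex)"
  have f1: "f 1 = 1" by (simp add: f_def fixed_point_count_1[unfolded One_nat_def])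
  have f0: "f 0 = 0" by (simp add: f_def)
  have mult: "f (m * n) = f m * f n" if "coprime m n" for m n
  proof (cases "m = 0 \<or> n = 0")
    case True
    then show ?thesis using that f1 f0 by auto
  next
    case False
    then show ?thesis using that by (simp add: f_def fixed_point_count_mult powr_times_real)
  qed
  have t_pow: "of_nat (p ^ k) powr (- w) = t p ^ k" for p k
    by (induction k) (simp_all add: t_def powr_times_real)
  have fp: "f (p ^ k) = of_real (gauss_prod (real p) js k) * t p ^ k" if "prime p" for p k
    unfolding f_def t_pow js_def fixed_point_count_prime_power[OF that, symmetric] by simp
  \<comment> \<open>\<open>x p\<close> is the absolute value of \<open>p ^ N * p powr (- w)\<close>; up to a constant, the \<open>k\<close>-th term is at most \<open>x p ^ k\<close>.\<close>
  define x where "x = (\<lambda>p::nat. real p powr (real N - \<sigma>))"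
  have tx: "norm (t p) * real p ^ N = x p" if "prime p" for p
    using prime_gt_0_nat[OF that] norm_prime_powr[OF that, of w]
    by (simp add: t_def x_def \<sigma>_def powr_diff powr_realpow powr_minus field_simps)
  have x: "0 < x p" "x p \<le> 1 / 2" if "prime p" for p
  proof -
    have p2: "real p \<ge> 2" using prime_ge_2_nat[OF that] by simp
    show "0 < x p" using p2 by (simp add: x_def)
    have "x p \<le> real p powr (- 1)" unfolding x_def using p2 \<sigma> by (intro powr_mono) auto
    also have "\<dots> \<le> 1 / 2" using p2 by (simp add: powr_minus_divide)
    finally show "x p \<le> 1 / 2" .
  qed
  have nf: "norm (f (p ^ k)) \<le> 2 ^ N * x p ^ k" if p: "prime p" for p k
  proof -
    have p2: "real p \<ge> 2" using prime_ge_2_nat[OF p] by simp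
    have "norm (f (p ^ k)) = gauss_prod (real p) js k * norm (t p) ^ k"
      unfolding fp[OF p] using gauss_prod_bounds(1)[OF p2 js(2)] by (simp add: norm_mult norm_power)
    also have "\<dots> \<le> (2 * real p ^ k) ^ N * norm (t p) ^ k"
      using gauss_prod_bounds(2)[OF p2 js(2), of k] unfolding js(1) by (intro mult_right_mono) auto
    also have "\<dots> = 2 ^ N * (norm (t p) * real p ^ N) ^ k"
      by (simp add: power_mult_distrib power_mult[symmetric] mult.commute)
    finally show ?thesis unfolding tx[OF p] .
  qed
  have loc: "summable (\<lambda>k. norm (f (p ^ k)))" if p: "prime p" for p
  proof (rule summable_comparison_test')
    show "summable (\<lambda>k. 2 ^ N * x p ^ k)" using x[OF p] by (intro summable_mult summable_geometric) auto
    show "norm (norm (f (p ^ k))) \<le> 2 ^ N * x p ^ k" for k using nf[OF p] by simp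
  qed
  have sum: "summable (\<lambda>p. if prime p then \<Sum>k. norm (f (p ^ Suc k)) else 0)"
  proof (rule summable_comparison_test')
    show "summable (\<lambda>p. 2 ^ Suc N * x p)"
      unfolding x_def using \<sigma> by (intro summable_mult) (simp add: summable_real_powr_iff)
    fix p :: nat
    show "norm (if prime p then \<Sum>k. norm (f (p ^ Suc k)) else 0) \<le> 2 ^ Suc N * x p"
    proof (cases "prime p")
      case True
      have s: "summable (\<lambda>k. norm (f (p ^ Suc k)))" using loc[OF True] summable_Suc_iff[of "\<lambda>k. norm (f (p ^ k))"] by simp
      have "(\<lambda>k. 2 ^ N * x p * x p ^ k) sums (2 ^ N * x p * (1 / (1 - x p)))"
        using x[OF True] by (intro sums_mult geometric_sums) auto
      moreover have "norm (f (p ^ Suc k)) \<le> 2 ^ N * x p * x p ^ k" for k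
        using nf[OF True, of "Suc k"] by (simp add: mult_ac)
      ultimately have "(\<Sum>k. norm (f (p ^ Suc k))) \<le> 2 ^ N * x p * (1 / (1 - x p))"
        using s by (intro sums_le[OF _ summable_sums]) auto
      also have "\<dots> \<le> 2 ^ N * x p * 2"
        using x[OF True] by (intro mult_left_mono) (auto simp: field_simps)
      finally show ?thesis using True s by (simp add: suminf_nonneg)
    qed (simp add: x_def)
  qed
  note ep = euler_product[of f, OF f1 mult loc sum]
  show "(\<lambda>n. norm (f n)) summable_on {1..}" by (rule ep(1))
  interpret E: near_linear_euler_product "length l - 1" "sum_list l" "\<lambda>p. local_coeff (real p) l" C c by (rule E)
  define z where "z = w - of_nat N + 1"
  have z: "Re z > 1" using \<sigma> by (simp add: z_def \<sigma>_def)
  have local: "(\<Sum>k. f (p ^ k)) = E.local_factor p (of_nat p powr (- z)) / (\<Prod>i\<le>N. 1 - of_nat p powr (- (w - of_nat i)))"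
    if p: "prime p" for p
  proof -
    have p1: "real p > 1" "p > 0" using prime_gt_1_nat[OF p] by auto
    have "norm (t p) * real p ^ length js < 1" unfolding js(1) tx[OF p] using x[OF p] by simp
    from gauss_prod_sums[OF p1(1) js(2) this]
    have "(\<Sum>k. f (p ^ k)) = (\<Sum>k\<le>N. of_real (macmahon_coeff (real p) js k) * t p ^ k) / (\<Prod>i\<le>N. 1 - of_real (real p) ^ i * t p)"
      unfolding fp[OF p] js(1) by (simp add: sums_iff)
    also have "(\<Sum>k\<le>N. of_real (macmahon_coeff (real p) js k) * t p ^ k) = E.local_factor p (of_nat p powr (- z))"
    proof -
      have "of_nat p powr (- z) = of_nat p ^ (N - 1) * t p"
      proof -
        have "- z = of_nat (N - 1) + (- w)" using N1 by (simp add: z_def of_nat_diff)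
        then show ?thesis using p1 by (simp only: powr_add t_def) (simp add: powr_nat')
      qed
      then have "of_real (local_coeff (real p) l k) * (of_nat p powr (- z)) ^ k = of_real (macmahon_coeff (real p) js k) * t p ^ k" for k
        using p1 by (simp add: local_coeff_def N_def[symmetric] js_def[symmetric] power_mult_distrib power_mult)
      then show ?thesis unfolding E.local_factor_def N_def by simp
    qed
    also have "(\<Prod>i\<le>N. 1 - of_real (real p) ^ i * t p) = (\<Prod>i\<le>N. 1 - of_nat p powr (- (w - of_nat i)))"
    proof (intro prod.cong refl)
      fix i
      have "- (w - of_nat i) = of_nat i + (- w)" by simp
      then have "of_nat p powr (- (w - of_nat i)) = of_nat p ^ i * t p"
        using p1 by (simp only: powr_add t_def) (simp add: powr_nat')
      then show "1 - of_real (real p) ^ i * t p = 1 - of_nat p powr (- (w - of_nat i))" by simp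
    qed
    finally show ?thesis .
  qed
  have zi: "Re (w - of_nat i) > 1" if "i \<le> N" for i using that \<sigma> by (simp add: \<sigma>_def)
  have "(\<lambda>x. (\<Prod>p | prime p \<and> p \<le> x. E.local_factor p (of_nat p powr (- z)))
         / (\<Prod>i\<le>N. \<Prod>p | prime p \<and> p \<le> x. 1 - of_nat p powr (- (w - of_nat i))))
     \<longlonglongrightarrow> E.continuation z / (\<Prod>i\<le>N. 1 / zeta (w - of_nat i))"
    using zi zeta_euler_product(1)
    by (intro tendsto_divide tendsto_prod continuation_lim_prime_product[OF E z] zeta_euler_product(2)) auto
  moreover have "(\<Prod>p | prime p \<and> p \<le> x. \<Sum>k. f (p ^ k)) = (\<Prod>p | prime p \<and> p \<le> x. E.local_factor p (of_nat p powr (- z)))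
         / (\<Prod>i\<le>N. \<Prod>p | prime p \<and> p \<le> x. 1 - of_nat p powr (- (w - of_nat i)))" for x
    by (subst prod.swap, subst prod_dividef[symmetric]) (intro prod.cong refl, simp add: local)
  ultimately have "(\<lambda>x. \<Prod>p | prime p \<and> p \<le> x. \<Sum>k. f (p ^ k)) \<longlonglongrightarrow> E.continuation z / (\<Prod>i\<le>N. 1 / zeta (w - of_nat i))"
    by simp
  then have "infsum f {1..} = E.continuation z / (\<Prod>i\<le>N. 1 / zeta (w - of_nat i))"
    using ep(2) LIMSEQ_unique by blast
  then show "infsum f {1..} = E.continuation (w - of_nat (sum_list l) + 1) * (\<Prod>i\<le>sum_list l. zeta (w - of_nat i))"
    by (simp add: prod_dividef z_def N_def)
qed

text \<open>Rearrangement of the absolutely convergent double series over pairs \<open>(d, m)\<close> by their product.\<close>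

lemma dirichlet_divisor_sum:
  fixes a :: "nat \<Rightarrow> nat" and w :: complex
  assumes F: "\<And>n. n \<ge> 1 \<Longrightarrow> (\<Sum>d | d dvd n. a d) = F n"
    and w: "Re w > 1"
    and sF: "(\<lambda>n. norm (of_nat (F n) * of_nat n powr (- w) :: complex)) summable_on {1..}"
  shows "(\<lambda>n. norm (of_nat (a n) * of_nat n powr (- w) :: complex)) summable_on {1..}"
    and "infsum (\<lambda>n. of_nat (a n) * of_nat n powr (- w)) {1..} * zeta w
       = infsum (\<lambda>n. of_nat (F n) * of_nat n powr (- w)) {1..}"
proof -
  define A :: "nat \<Rightarrow> complex" where "A = (\<lambda>n. of_nat (a n) * of_nat n powr (- w))"
  define Z :: "nat \<Rightarrow> complex" where "Z = (\<lambda>n. of_nat n powr (- w))"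
  have aF: "a n \<le> F n" if "n \<ge> 1" for n
    using F[OF that] that by (subst F[OF that, symmetric], intro member_le_sum) auto
  have sA: "(\<lambda>n. norm (A n)) summable_on {1..}"
  proof (rule summable_on_comparison_test[OF sF])
    fix n :: nat assume "n \<in> {1..}"
    then show "norm (A n) \<le> norm (of_nat (F n) * of_nat n powr (- w) :: complex)"
      using aF[of n] by (simp add: A_def norm_mult mult_right_mono)
  qed auto
  then show "(\<lambda>n. norm (of_nat (a n) * of_nat n powr (- w) :: complex)) summable_on {1..}" by (simp add: A_def)
  have bS: "bij_betw Suc UNIV {1..}" by (auto simp: bij_betw_def image_iff gr0_conv_Suc Suc_le_eq)
  have sZ: "(\<lambda>n. norm (Z n)) summable_on {1..}"
  proof -
    have "(\<lambda>n. norm (Z (Suc n))) summable_on UNIV"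
      using nat_powr_summable[OF w] by (intro norm_summable_imp_summable_on) (simp add: Z_def)
    then show ?thesis using summable_on_reindex_bij_betw[OF bS, of "\<lambda>n. norm (Z n)"] by simp
  qed
  have "(Z has_sum zeta w) {1..}"
  proof -
    have "(Z has_sum infsum Z {1..}) {1..}" using abs_summable_summable[OF sZ] by simp
    moreover have "infsum Z {1..} = zeta w"
      using infsum_nat_from_1[OF sZ] zeta_sums[OF w] sums_unique2 by (fastforce simp: Z_def)
    ultimately show ?thesis by simp
  qed
  define P where "P = (\<lambda>(d, m). A d * Z m)"
  have sP: "(\<lambda>x. norm (P x)) summable_on ({1..} \<times> {1..})"
  proof (rule summable_on_SigmaI)
    show "((\<lambda>m. norm (P (d, m))) has_sum (norm (A d) * infsum (\<lambda>m. norm (Z m)) {1..})) {1..}" for d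
      unfolding P_def prod.case norm_mult by (intro has_sum_cmult_right has_sum_infsum sZ)
    show "(\<lambda>d. norm (A d) * infsum (\<lambda>m. norm (Z m)) {1..}) summable_on {1..}"
      by (rule summable_on_cmult_left[OF sA])
  qed auto
  have hP: "(P has_sum (infsum A {1..} * zeta w)) ({1..} \<times> {1..})"
  proof (rule has_sum_SigmaI)
    show "((\<lambda>m. P (d, m)) has_sum (A d * zeta w)) {1..}" for d
      unfolding P_def prod.case by (intro has_sum_cmult_right \<open>(Z has_sum zeta w) {1..}\<close>)
    show "((\<lambda>d. A d * zeta w) has_sum (infsum A {1..} * zeta w)) {1..}"
      using abs_summable_summable[OF sA] by (intro has_sum_cmult_left has_sum_infsum)
    show "P summable_on {1..} \<times> {1..}" by (rule abs_summable_summable[OF sP])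
  qed
  define Q where "Q = (\<lambda>(n, d). A d * Z (n div d))"
  have bij: "bij_betw (\<lambda>(d :: nat, m :: nat). (d * m, d)) ({1..} \<times> {1..}) (SIGMA n:{1..}. {d. d dvd n})"
    by (rule bij_betw_byWitness[where f' = "\<lambda>(n, d). (d, n div d)"])
       (auto simp: Suc_le_eq dvd_imp_le div_greater_zero_iff intro: dvd_pos_nat)
  have "((\<lambda>x. Q (case x of (d, m) \<Rightarrow> (d * m, d))) has_sum (infsum A {1..} * zeta w)) ({1..} \<times> {1..})"
    using hP by (rule has_sum_cong[THEN iffD1, rotated]) (auto simp: P_def Q_def)
  then have hQ: "(Q has_sum (infsum A {1..} * zeta w)) (SIGMA n:{1..}. {d. d dvd n})"
    using has_sum_reindex_bij_betw[OF bij, of Q] by simp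
  have inner: "((\<lambda>d. Q (n, d)) has_sum (of_nat (F n) * of_nat n powr (- w))) {d. d dvd n}" if n: "n \<in> {1..}" for n
  proof -
    have "(\<Sum>d | d dvd n. Q (n, d)) = (\<Sum>d | d dvd n. of_nat (a d) * of_nat n powr (- w))"
    proof (rule sum.cong[OF refl])
      fix d assume "d \<in> {d. d dvd n}"
      then obtain m where m: "n = d * m" by (auto elim: dvdE)
      have "d > 0" using n m by (auto intro: Nat.gr0I)
      then have "n div d = m" by (simp add: m)
      then show "Q (n, d) = of_nat (a d) * of_nat n powr (- w)"
        by (simp add: Q_def A_def Z_def) (simp add: m powr_times_real)
    qed
    also have "\<dots> = of_nat (\<Sum>d | d dvd n. a d) * of_nat n powr (- w)" by (simp add: sum_distrib_right)
    also have "\<dots> = of_nat (F n) * of_nat n powr (- w)" using F n by simp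
    finally show ?thesis using n by (intro has_sum_finiteI) auto
  qed
  have "((\<lambda>n. of_nat (F n) * of_nat n powr (- w)) has_sum (infsum A {1..} * zeta w)) {1..}"
    using hQ inner by (rule has_sum_SigmaD)
  then show "infsum (\<lambda>n. of_nat (a n) * of_nat n powr (- w)) {1..} * zeta w
       = infsum (\<lambda>n. of_nat (F n) * of_nat n powr (- w)) {1..}"
    by (simp add: A_def infsumI)
qed

section \<open>Roots of the local factors and the orbit series\<close>

context near_linear_euler_product
begin

lemma local_factor_of_real: "local_factor p (of_real y) = of_real (\<Sum>k\<le>d. b p k * y ^ k)"
  by (simp add: local_factor_def)

text \<open>The intermediate value theorem on \<open>[a, 0]\<close>. A root close to \<open>0\<close> is impossible since the factor is \<open>1\<close> there and
  varies at a rate bounded independently of \<open>p\<close>.\<close>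

lemma real_root_exists:
  assumes p: "prime p" and a: "-1 \<le> a" "a < 0" and neg: "(\<Sum>k\<le>d. b p k * a ^ k) < 0"
  shows "\<exists>y. a < y \<and> y \<le> - 1 / (real u + real d * C + 1) \<and> local_factor p (of_real y) = 0"
proof -
  define g where "g = (\<lambda>y. \<Sum>k\<le>d. b p k * y ^ k)"
  have g0: "g 0 = 1"
    unfolding g_def using b0[OF p] by (simp add: power_0_left if_distrib[of "\<lambda>x. _ * x"] cong: if_cong)
  have "continuous_on {a..0} g" unfolding g_def by (intro continuous_intros)
  then obtain y where y: "a \<le> y" "y \<le> 0" "g y = 0"
    using IVT'[of g a 0 0] neg a g0 by (auto simp: g_def)
  have ya: "a < y" using y neg by (cases "a = y") (auto simp: g_def)
  have y0: "y < 0" using y g0 by (cases "y = 0") auto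
  have p1: "real p \<ge> 1" using prime_ge_1_nat[OF p] by simp
  have "local_factor p (of_real y) = 0" using y(3) by (simp add: local_factor_of_real g_def)
  have "norm (local_factor p (of_real y) - (1 + of_nat u * of_real y)) \<le> real d * C * (norm (of_real y :: complex) / real p)"
    using y a by (intro local_factor_near_linear p) simp
  also have "local_factor p (of_real y) - (1 + of_nat u * of_real y) = of_real (- (1 + real u * y))"
    using \<open>local_factor p (of_real y) = 0\<close> by simp
  finally have "\<bar>1 + real u * y\<bar> \<le> real d * C * (- y / real p)" using y0 by (simp only: norm_of_real abs_minus_cancel)
  also have "\<dots> \<le> real d * C * (- y)"
  proof (rule mult_left_mono)
    have "- y / real p \<le> - y / 1" using y0 p1 by (intro divide_left_mono) auto
    then show "- y / real p \<le> - y" by simp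
  qed (use C in simp)
  finally have "1 \<le> (real u + real d * C) * (- y)" by (simp add: algebra_simps)
  also have "\<dots> \<le> (real u + real d * C + 1) * (- y)" using y0 by (intro mult_right_mono) auto
  finally have le: "1 \<le> - y * (real u + real d * C + 1)" by (simp only: mult.commute)
  have "real u + real d * C + 1 > 0" using C by (intro add_nonneg_pos) auto
  with le have "1 / (real u + real d * C + 1) \<le> - y" by (simp only: pos_divide_le_eq)
  then have "y \<le> - 1 / (real u + real d * C + 1)" by simp
  then show ?thesis using ya \<open>local_factor p (of_real y) = 0\<close> by blast
qed

lemma real_value_near_linear:
  assumes p: "prime p" and y: "\<bar>y\<bar> \<le> 1"
  shows "(\<Sum>k\<le>d. b p k * y ^ k) \<le> 1 + real u * y + real d * C / real p"
proof -
  have "norm (local_factor p (of_real y) - (1 + of_nat u * of_real y)) \<le> real d * C * (norm (of_real y :: complex) / real p)"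
    using y by (intro local_factor_near_linear p) simp
  also have "local_factor p (of_real y) - (1 + of_nat u * of_real y)
      = of_real ((\<Sum>k\<le>d. b p k * y ^ k) - (1 + real u * y))"
    by (simp add: local_factor_of_real)
  finally have "\<bar>(\<Sum>k\<le>d. b p k * y ^ k) - (1 + real u * y)\<bar> \<le> real d * C * (\<bar>y\<bar> / real p)"
    by (simp only: norm_of_real)
  also have "\<dots> \<le> real d * C * (1 / real p)"
    using y C by (intro mult_left_mono divide_right_mono) auto
  finally show ?thesis by simp
qed

end

text \<open>The linear part vanishes at \<open>-1\<close>, so the sign is decided by the next order: the linear coefficient
  contributes at most \<open>- 1 / p\<close> and all others only \<open>O(1 / p\<^sup>2)\<close>.\<close>

lemma two_parts_value_at_minus_one:
  assumes ab: "b \<le> a" "b \<ge> 1" "a \<ge> 2"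
  shows "\<exists>n0. \<forall>p\<ge>n0. prime p \<longrightarrow> (\<Sum>k\<le>a + b. local_coeff (real p) [a, b] k * (-1) ^ k) < 0"
proof -
  obtain C where C: "C \<ge> 0" "\<And>q k. q \<ge> 2 \<Longrightarrow> k \<ge> 2 \<Longrightarrow> \<bar>local_coeff q [a, b] k\<bar> \<le> C / q\<^sup>2"
    using local_coeff_two_parts_bound[OF ab(1,2)] by blast
  have "(\<Sum>k\<le>a + b. local_coeff (real p) [a, b] k * (-1) ^ k) < 0"
    if p: "prime p" "p \<ge> nat \<lceil>real (a + b) * C\<rceil> + 1" for p
  proof -
    have q: "real p \<ge> 2" using prime_ge_2_nat[OF p(1)] by simp
    have big: "real p > real (a + b) * C" using p(2) by linarith
    have "(\<Sum>k\<le>a + b. local_coeff (real p) [a, b] k * (-1) ^ k)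
       = 1 - local_coeff (real p) [a, b] 1 + (\<Sum>k\<in>{2..a + b}. local_coeff (real p) [a, b] k * (-1) ^ k)"
    proof -
      have "{..a + b} = insert 0 (insert 1 {2..a + b})" using ab by auto
      then show ?thesis by simp
    qed
    also have "(\<Sum>k\<in>{2..a + b}. local_coeff (real p) [a, b] k * (-1) ^ k) \<le> (\<Sum>k\<in>{2..a + b}. C / (real p)\<^sup>2)"
    proof (rule sum_mono)
      fix k assume "k \<in> {2..a + b}"
      then have "\<bar>local_coeff (real p) [a, b] k * (-1) ^ k\<bar> \<le> C / (real p)\<^sup>2" using C(2)[OF q, of k] by (simp add: abs_mult)
      then show "local_coeff (real p) [a, b] k * (-1) ^ k \<le> C / (real p)\<^sup>2" by (rule abs_le_D1)
    qed
    also have "(\<Sum>k\<in>{2..a + b}. C / (real p)\<^sup>2) \<le> real (a + b) * (C / (real p)\<^sup>2)"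
      unfolding sum_constant using C(1) by (intro mult_right_mono) auto
    also have "real (a + b) * (C / (real p)\<^sup>2) < 1 / real p"
    proof -
      have "(real (a + b) * C) / (real p * real p) < real p / (real p * real p)"
        using big q by (intro divide_strict_right_mono) auto
      then show ?thesis using q by (simp add: power2_eq_square)
    qed
    finally show ?thesis using local_coeff_two_parts_1[OF q ab(3,2)] by simp
  qed
  then show ?thesis by blast
qed

text \<open>For more than two parts the value at \<open>- 3 / 4\<close> is eventually negative, so the root stays away from the unit
  circle and \<open>k\<close> is bounded by a multiple of \<open>ln p\<close>. For two parts the root may approach the circle, but then
  the exponent vanishes for \<open>k \<ge> 3\<close>.\<close>

lemma partition_roots:
  assumes l: "\<forall>r\<in>set l. r \<ge> 1" "sorted_wrt (\<ge>) l" "l \<noteq> [1, 1]" "length l \<ge> 2"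
    and E: "near_linear_euler_product (length l - 1) (sum_list l) (\<lambda>p. local_coeff (real p) l) C (zeta_exponent (length l - 1))"
  shows "\<exists>\<eta> L n0 y. \<eta> > 0 \<and> L > 0 \<and> (\<forall>p\<ge>n0. prime p \<longrightarrow> -1 < y p \<and> y p \<le> - \<eta>
      \<and> near_linear_euler_product.local_factor (sum_list l) (\<lambda>p. local_coeff (real p) l) p (of_real (y p)) = 0
      \<and> (\<forall>k\<ge>1. zeta_exponent (length l - 1) k \<noteq> 0 \<longrightarrow> real k * (- ln (- y p)) \<le> ln (real p) \<longrightarrow> real k \<le> L * ln (real p)))"
proof -
  interpret E: near_linear_euler_product "length l - 1" "sum_list l" "\<lambda>p. local_coeff (real p) l" C "zeta_exponent (length l - 1)"
    by (rule E)
  define N where "N = sum_list l"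
  define \<eta> where "\<eta> = 1 / (real (length l - 1) + real N * C + 1)"
  have \<eta>: "\<eta> > 0" using E.C unfolding \<eta>_def by (intro divide_pos_pos add_nonneg_pos) auto
  have root: "\<exists>y. a < y \<and> y \<le> - \<eta> \<and> E.local_factor p (of_real y) = 0"
    if "prime p" "-1 \<le> a" "a < 0" "(\<Sum>k\<le>N. local_coeff (real p) l k * a ^ k) < 0" for p a
    using E.real_root_exists[of p a] that by (simp add: N_def \<eta>_def)
  show ?thesis
  proof (cases "length l = 2")
    case True
    then obtain a b where ab: "l = [a, b]" by (auto simp: length_Suc_conv numeral_2_eq_2)
    have ab': "b \<le> a" "b \<ge> 1" "a \<ge> 2" using l ab by auto
    obtain n0 where n0: "\<And>p. p \<ge> n0 \<Longrightarrow> prime p \<Longrightarrow> (\<Sum>k\<le>N. local_coeff (real p) l k * (-1) ^ k) < 0"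
      using two_parts_value_at_minus_one[OF ab'] by (auto simp: ab N_def)
    have "\<exists>y. -1 < y \<and> y \<le> - \<eta> \<and> E.local_factor p (of_real y) = 0" if "p \<ge> n0" "prime p" for p
      using root[of p "-1"] n0[OF that] that by auto
    then obtain y where y: "\<And>p. p \<ge> n0 \<Longrightarrow> prime p \<Longrightarrow> -1 < y p \<and> y p \<le> - \<eta> \<and> E.local_factor p (of_real (y p)) = 0"
      by metis
    have "real k \<le> (2 / ln 2) * ln (real p)" if "zeta_exponent (length l - 1) k \<noteq> 0" "prime p" for k p
    proof -
      have "\<not> k \<ge> 3" using that(1) zeta_exponent_1(3)[of k] True by auto
      then have "real k \<le> 2 * 1" by simp
      also have "1 \<le> ln (real p) / ln 2" using prime_ge_2_nat[OF that(2)] by simp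
      finally show ?thesis by simp
    qed
    then show ?thesis using \<eta> y
      by (intro exI[of _ \<eta>] exI[of _ "2 / ln 2"] exI[of _ n0] exI[of _ y]) auto
  next
    case False
    then have u: "real (length l - 1) \<ge> 2" using l(4) by auto
    define n0 where "n0 = nat \<lceil>2 * (real N * C)\<rceil> + 1"
    have "\<exists>y. - 3 / 4 < y \<and> y \<le> - \<eta> \<and> E.local_factor p (of_real y) = 0" if p: "p \<ge> n0" "prime p" for p
    proof (rule root[OF p(2)])
      have p0: "real p > 0" using prime_gt_0_nat[OF p(2)] by simp
      have "real p > 2 * (real N * C)" using p(1) unfolding n0_def by linarith
      then have "real N * C / real p < 1 / 2" using p0 by (simp add: field_simps)
      moreover have "(\<Sum>k\<le>N. local_coeff (real p) l k * (- 3 / 4) ^ k) \<le> 1 + real (length l - 1) * (- 3 / 4) + real N * C / real p"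
        unfolding N_def by (rule E.real_value_near_linear[OF p(2)]) simp
      ultimately show "(\<Sum>k\<le>N. local_coeff (real p) l k * (- 3 / 4) ^ k) < 0" using u by linarith
    qed auto
    then obtain y where y: "\<And>p. p \<ge> n0 \<Longrightarrow> prime p \<Longrightarrow> - 3 / 4 < y p \<and> y p \<le> - \<eta> \<and> E.local_factor p (of_real (y p)) = 0"
      by metis
    have "real k \<le> (1 / ln (4 / 3)) * ln (real p)"
      if p: "p \<ge> n0" "prime p" and k: "real k * (- ln (- y p)) \<le> ln (real p)" for k p
    proof -
      have yp: "0 < - y p" "- y p \<le> 3 / 4" using y[OF p] \<eta> by auto
      have "ln (- y p) \<le> ln (3 / 4)" using yp by simp
      also have "ln (3 / 4 :: real) = - ln (4 / 3)" by (simp add: ln_div)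
      finally have "real k * ln (4 / 3) \<le> real k * (- ln (- y p))" by (intro mult_left_mono) auto
      also note k
      finally show ?thesis by (simp add: field_simps)
    qed
    moreover have "- 1 < y p" if "p \<ge> n0" "prime p" for p using y[OF that] by simp
    ultimately show ?thesis using \<eta> y
      by (intro exI[of _ \<eta>] exI[of _ "1 / ln (4 / 3)"] exI[of _ n0] exI[of _ y]) auto
  qed
qed

text \<open>The factors \<open>\<zeta>(s), \<dots>, \<zeta>(s - N + 1)\<close> of the orbit series, in the variable \<open>z = s - N + 2\<close>.\<close>

definition zeta_prefactor :: "nat \<Rightarrow> complex \<Rightarrow> complex" where
  "zeta_prefactor N z = (\<Prod>i=1..N. zeta (z + of_nat N - 1 - of_nat i))"

lemma zeta_prefactor_meromorphic: "zeta_prefactor N meromorphic_on {z. Re z > 0}"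
  unfolding zeta_prefactor_def[abs_def]
proof (intro meromorphic_intros)
  fix i assume i: "i \<in> {1..N}"
  show "(\<lambda>z. zeta (z + of_nat N - 1 - of_nat i)) meromorphic_on {z. Re z > 0}"
  proof (rule meromorphic_on_compose[OF zeta_meromorphic, where f = "\<lambda>z. z + of_nat N - 1 - of_nat i"])
    show "(\<lambda>z. z + of_nat N - 1 - of_nat i) analytic_on {z. Re z > 0}" by (intro analytic_intros)
    show "(\<lambda>z. z + of_nat N - 1 - of_nat i) ` {z. Re z > 0} \<subseteq> {s. Re s > - 1}" using i by auto
  qed
qed

lemma zeta_prefactor_isCont:
  assumes "Re z > 0" "Im z \<noteq> 0"
  shows "isCont (zeta_prefactor N) z"
  unfolding zeta_prefactor_def[abs_def] isCont_def
proof (intro tendsto_prod)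
  fix i assume i: "i \<in> {1..N}"
  have "z + of_nat N - 1 - of_nat i \<in> {s. Re s > - 1} - {1}"
    using assms i by (auto simp: complex_eq_iff)
  then have "isCont zeta (z + of_nat N - 1 - of_nat i)"
    using zeta_holomorphic
    by (intro continuous_on_interior[OF holomorphic_on_imp_continuous_on])
       (auto simp: interior_open open_halfspace_Re_gt open_Diff)
  moreover have "isCont (\<lambda>z. z + of_nat N - 1 - of_nat i) z" by (intro continuous_intros)
  ultimately have "isCont (\<lambda>z. zeta (z + of_nat N - 1 - of_nat i)) z"
    using isCont_o2[where f = "\<lambda>z. z + of_nat N - 1 - of_nat i" and g = zeta] by blast
  then show "((\<lambda>z. zeta (z + of_nat N - 1 - of_nat i)) \<longlongrightarrow> zeta (z + of_nat N - 1 - of_nat i)) (at z)"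
    by (simp add: isCont_def)
qed

lemma zeta_prefactor_nonzero: "\<forall>\<^sub>\<approx>z\<in>{z. Re z > 0}. zeta_prefactor N z \<noteq> 0"
proof -
  have "connected {z. Re z > 0}" by (intro convex_connected convex_halfspace_Re_gt)
  then consider "\<forall>\<^sub>\<approx>z\<in>{z. Re z > 0}. zeta_prefactor N z = 0" | "\<forall>\<^sub>\<approx>z\<in>{z. Re z > 0}. zeta_prefactor N z \<noteq> 0"
    using meromorphic_imp_constant_or_avoid[OF zeta_prefactor_meromorphic open_halfspace_Re_gt] by blast
  then show ?thesis
  proof cases
    case 1
    have "\<forall>\<^sub>F z in at 3. zeta_prefactor N z = 0"
      using eventually_cosparse_imp_eventually_at[OF 1, of 3] by (simp add: at_within_open[OF _ open_halfspace_Re_gt])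
    moreover have "\<forall>\<^sub>F z in at (3 :: complex). Re z > 2"
    proof -
      have "\<forall>\<^sub>F z in nhds (3 :: complex). z \<in> {z. Re z > 2}"
        by (intro eventually_nhds_in_open open_halfspace_Re_gt) auto
      then show ?thesis by (simp add: eventually_nhds_conv_at)
    qed
    ultimately have "\<forall>\<^sub>F z in at (3 :: complex). False"
    proof eventually_elim
      case (elim z)
      have "zeta (z + of_nat N - 1 - of_nat i) \<noteq> 0" if "i \<in> {1..N}" for i
        using elim(2) that by (intro zeta_euler_product(1)) auto
      then show ?case using elim(1) by (auto simp: zeta_prefactor_def)
    qed
    then show ?thesis by simp
  qed
qed

text \<open>Weighting the number of closed orbits by their length turns the divisor sum into a Dirichlet convolution
  with \<open>1\<close> at \<open>w = s + 1\<close>. Dividing by \<open>\<zeta>(w)\<close> removes the first of the zeta factors.\<close>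

lemma product_orbit_dirichlet:
  fixes X :: "nat \<Rightarrow> 'a set" and T :: "nat \<Rightarrow> 'a \<Rightarrow> 'a"
  assumes T: "\<And>r. r \<ge> 1 \<Longrightarrow> realizes_lattice_count r (X r) (T r)"
    and l: "\<forall>r\<in>set l. r \<ge> 1" "l \<noteq> []"
    and E: "near_linear_euler_product (length l - 1) (sum_list l) (\<lambda>p. local_coeff (real p) l) C c"
    and s: "Re s > real (sum_list l)"
  defines "Y \<equiv> product_space X l" and "S \<equiv> product_map T l"
  shows "summable (orbit_dirichlet_term Y S s)"
    and "orbit_dirichlet Y S s = zeta_prefactor (sum_list l) (s - of_nat (sum_list l) + 2)
       * near_linear_euler_product.continuation (sum_list l) (\<lambda>p. local_coeff (real p) l) c (s - of_nat (sum_list l) + 2)"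
proof -
  define N where "N = sum_list l"
  define w where "w = s + 1"
  define a where "a = (\<lambda>n. n * orbit_count Y S n)"
  define A where "A = (\<lambda>n. of_nat (a n) * of_nat n powr (- w) :: complex)"
  have w: "Re w > real (sum_list l) + 1" "Re w > 1" using s by (auto simp: w_def)
  note FD = fixed_point_dirichlet_series[OF l E w(1)]
  have F: "(\<Sum>d | d dvd n. a d) = fixed_point_count l n" if "n \<ge> 1" for n
    unfolding a_def Y_def S_def using T l(1) that by (rule product_orbit_divisor_sum)
  note D = dirichlet_divisor_sum[of a "fixed_point_count l", OF F w(2) FD(1)]
  have AS: "A (Suc n) = orbit_dirichlet_term Y S s n" for n
  proof -
    have "(of_nat (Suc n) :: complex) \<noteq> 0" using of_nat_neq_0 by blast
    then have "(of_nat (Suc n) :: complex) * of_nat (Suc n) powr (- w) = of_nat (Suc n) powr (- s)"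
      by (simp add: w_def powr_diff powr_minus powr_add field_simps del: of_nat_Suc)
    then show ?thesis by (simp add: A_def a_def orbit_dirichlet_term_def del: of_nat_Suc)
  qed
  have sums: "(\<lambda>n. A (Suc n)) sums infsum A {1..}"
    by (rule infsum_nat_from_1) (use D(1) in \<open>simp add: A_def\<close>)
  then show "summable (orbit_dirichlet_term Y S s)" by (simp add: AS sums_iff)
  have OD: "orbit_dirichlet Y S s = infsum A {1..}"
    using sums by (simp add: AS sums_iff orbit_dirichlet_def)
  have "infsum A {1..} * zeta w
      = near_linear_euler_product.continuation N (\<lambda>p. local_coeff (real p) l) c (w - of_nat N + 1) * (\<Prod>i\<le>N. zeta (w - of_nat i))"
    using D(2) FD(2) by (simp add: A_def N_def)
  also have "(\<Prod>i\<le>N. zeta (w - of_nat i)) = zeta w * (\<Prod>i=1..N. zeta (w - of_nat i))"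
    by (simp add: atMost_atLeast0 prod.atLeast_Suc_atMost)
  finally have "infsum A {1..} = near_linear_euler_product.continuation N (\<lambda>p. local_coeff (real p) l) c (w - of_nat N + 1)
      * (\<Prod>i=1..N. zeta (w - of_nat i))"
    using zeta_euler_product(1)[OF w(2)] by simp
  moreover have "w - of_nat N + 1 = s - of_nat N + 2" by (simp add: w_def)
  moreover have "(\<Prod>i=1..N. zeta (w - of_nat i)) = zeta_prefactor N (s - of_nat N + 2)"
    unfolding zeta_prefactor_def w_def by (intro prod.cong refl arg_cong[of _ _ zeta]) simp
  ultimately show "orbit_dirichlet Y S s = zeta_prefactor (sum_list l) (s - of_nat (sum_list l) + 2)
       * near_linear_euler_product.continuation (sum_list l) (\<lambda>p. local_coeff (real p) l) c (s - of_nat (sum_list l) + 2)"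
    unfolding OD N_def by (simp only: mult.commute)
qed

lemma eventually_at_shift:
  fixes c :: "'a :: real_normed_vector"
  assumes "eventually P (at (z + c))"
  shows "eventually (\<lambda>w. P (w + c)) (at z)"
proof -
  obtain d where d: "d > 0" "\<And>w. w \<noteq> z + c \<Longrightarrow> dist w (z + c) < d \<Longrightarrow> P w"
    using assms by (auto simp: eventually_at)
  have "P (w + c)" if "w \<noteq> z" "dist w z < d" for w
    using that by (intro d(2)) (auto simp: dist_norm)
  then show ?thesis using d(1) by (auto simp: eventually_at)
qed

theorem theorem4p2:
  fixes X :: "nat \<Rightarrow> 'a set" and T :: "nat \<Rightarrow> 'a \<Rightarrow> 'a"
    and l :: "nat list" and N :: nat
  assumes T: "\<And>r. r \<ge> 1 \<Longrightarrow> realizes_lattice_count r (X r) (T r)"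
    and partition: "sorted_wrt (\<ge>) l" "\<forall>k\<in>set l. k \<ge> 1" "N = sum_list l"
    and not_11: "l \<noteq> [1, 1]"
    and cases:
      "length l > 2
       \<or> (length l = 2 \<and> l ! 0 = l ! 1)
       \<or> (length l = 2 \<and> l ! 0 > l ! 1 \<and>
          (\<forall>\<mu>1 \<mu>2. \<mu>1 > \<mu>2 \<and> \<mu>2 \<ge> 1 \<longrightarrow> eval_xq (C_poly [\<mu>1, \<mu>2]) (-1) 1 \<noteq> 0))"
  shows "orbit_dirichlet_natural_boundary
           (product_space X l) (product_map T l) (real N) (real N - 2)"
proof -
  have len: "length l \<ge> 2" using cases by auto
  then have ne: "l \<noteq> []" by auto
  define c where "c = zeta_exponent (length l - 1)"
  obtain C where E: "near_linear_euler_product (length l - 1) (sum_list l) (\<lambda>p. local_coeff (real p) l) C c"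
    using partition_near_linear[OF partition(2) ne] unfolding c_def by blast
  interpret E: near_linear_euler_product "length l - 1" "sum_list l" "\<lambda>p. local_coeff (real p) l" C c by (rule E)
  obtain \<eta> L n0 y where roots: "\<eta> > 0" "L > 0"
    "\<And>p. prime p \<Longrightarrow> p \<ge> n0 \<Longrightarrow> -1 < y p \<and> y p \<le> - \<eta> \<and> E.local_factor p (of_real (y p)) = 0
      \<and> (\<forall>k\<ge>1. c k \<noteq> 0 \<longrightarrow> real k * (- ln (- y p)) \<le> ln (real p) \<longrightarrow> real k \<le> L * ln (real p))"
    using partition_roots[OF partition(2,1) not_11 len E[unfolded c_def]] unfolding c_def by metis
  define D where "D = (\<lambda>z. zeta_prefactor N z * E.continuation z)"
  \<comment> \<open>In the variable \<open>z = s - h\<close> the line \<open>Re s = N - 2\<close> becomes the imaginary axis.\<close>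
  define h :: complex where "h = of_nat N - 2"
  define F0 where "F0 = (\<lambda>s. D (s - h))"
  define H where "H = {s. Re s > real N - 2}"
  have H: "open H" "connected H"
    unfolding H_def by (auto intro: open_halfspace_Re_gt convex_connected convex_halfspace_Re_gt)
  have "D meromorphic_on {z. Re z > 0}"
    unfolding D_def by (intro meromorphic_intros zeta_prefactor_meromorphic E.continuation_meromorphic)
  then have F0: "F0 meromorphic_on H"
    unfolding F0_def by (rule meromorphic_on_compose) (auto intro!: analytic_intros simp: H_def h_def)
  have series: "summable (orbit_dirichlet_term (product_space X l) (product_map T l) s)"
    "orbit_dirichlet (product_space X l) (product_map T l) s = F0 s" if "Re s > real N" for s
    using product_orbit_dirichlet[OF T partition(2) ne E, of s] that partition(3)
    by (auto simp: F0_def D_def h_def algebra_simps)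
  have cont: "orbit_dirichlet_continuation (product_space X l) (product_map T l) (real N) (real N - 2) F0"
    unfolding orbit_dirichlet_continuation_def using F0 series by (simp add: H_def)
  moreover have "\<not> extends_meromorphically_to F (real N - 2) z0"
    if F: "orbit_dirichlet_continuation (product_space X l) (product_map T l) (real N) (real N - 2) F"
      and z0: "Re z0 = real N - 2" for F z0
  proof
    assume "extends_meromorphically_to F (real N - 2) z0"
    then obtain U G where G: "open U" "z0 \<in> U" "G meromorphic_on U" "\<forall>\<^sub>\<approx>s\<in>U \<inter> H. G s = F s"
      unfolding extends_meromorphically_to_def H_def by blast
    have FS: "F s = F0 s" if "Re s > real N" for s
      using F series[of s] that by (auto simp: orbit_dirichlet_continuation_def)
    have mF: "F meromorphic_on H" using F by (simp add: orbit_dirichlet_continuation_def H_def)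
    \<comment> \<open>Two continuations agree up to a discrete set since they agree on the domain of convergence.\<close>
    have eqF: "\<forall>\<^sub>\<approx>s\<in>H. F s = F0 s"
    proof -
      have "(\<lambda>s. F s - F0 s) meromorphic_on H" by (intro meromorphic_intros mF F0)
      then consider "\<forall>\<^sub>\<approx>s\<in>H. F s - F0 s = 0" | "\<forall>\<^sub>\<approx>s\<in>H. F s - F0 s \<noteq> 0"
        using meromorphic_imp_constant_or_avoid[OF _ H] by blast
      then show ?thesis
      proof cases
        case 2
        define v :: complex where "v = of_nat N + 1"
        have "v \<in> H" by (simp add: v_def H_def)
        then have "\<forall>\<^sub>F s in at v. F s - F0 s \<noteq> 0"
          using eventually_cosparse_imp_eventually_at[OF 2, of v] by (simp add: at_within_open[OF _ H(1)])
        moreover have "\<forall>\<^sub>F s in at v. s \<in> {s. Re s > real N}"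
          by (intro eventually_at_in_open' open_halfspace_Re_gt) (simp add: v_def)
        ultimately have "\<forall>\<^sub>F s in at v. False" by eventually_elim (use FS in auto)
        then show ?thesis by simp
      qed simp
    qed
    have UH: "open (U \<inter> H)" using G(1) H(1) by blast
    have near: "\<forall>\<^sub>F s in at v. G s = F0 s" if "v \<in> U" "v \<in> H" for v
    proof -
      have "\<forall>\<^sub>F s in at v. G s = F s"
        using eventually_cosparse_imp_eventually_at[OF G(4), of v] that by (simp add: at_within_open[OF _ UH])
      moreover have "\<forall>\<^sub>F s in at v. F s = F0 s"
        using eventually_cosparse_imp_eventually_at[OF eqF, of v] that by (simp add: at_within_open[OF _ H(1)])
      ultimately show ?thesis by eventually_elim simp
    qed
    define V where "V = (\<lambda>s. s - h) ` U"
    show False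
    proof (rule E.natural_boundary[where R = "zeta_prefactor N" and U = V and ?z0.0 = "z0 - h" and G = "\<lambda>z. G (z + h)", OF roots])
      show "isCont (zeta_prefactor N) z" if "Re z > 0" "Im z \<noteq> 0" for z using that by (rule zeta_prefactor_isCont)
      show "\<forall>\<^sub>\<approx>z\<in>{z. Re z > 0}. zeta_prefactor N z \<noteq> 0" by (rule zeta_prefactor_nonzero)
      show "open V" unfolding V_def using open_translation_subtract[OF G(1)] .
      show "z0 - h \<in> V" using G(2) by (simp add: V_def)
      show "Re (z0 - h) = 0" using z0 by (simp add: h_def)
      show "(\<lambda>z. G (z + h)) meromorphic_on V"
        by (rule meromorphic_on_compose[OF G(3)]) (auto intro!: analytic_intros simp: V_def)
      fix z assume z: "z \<in> V" "Re z > 0"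
      have "z + h \<in> U" "z + h \<in> H" using z by (auto simp: V_def H_def h_def)
      from eventually_at_shift[OF near[OF this]]
      show "\<forall>\<^sub>F w in at z. G (w + h) = zeta_prefactor N w * E.continuation w"
        by (simp add: F0_def D_def)
    qed
  qed
  ultimately show ?thesis unfolding orbit_dirichlet_natural_boundary_def by blast
qed

end
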